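(* For each unimodular cone $C$ in a rational space $(X,\Lambda)$ with a rational inner product $Q$, each face $F\in\mathcal{F}(C)$ and each non-negative integer $n$ such that $\dim(F)\ge\dim(C)-n$, we have $$\mathcal{D}_n^X(C;F)=D_n^X(C;F),$$ where $\mathcal{D}_n^X(C;F)$ is the explicitly constructed operator defined in the context and $D_n^X(C;F)$ is the Berline–Vergne operator.
   Context: Rational spaces. A rational space $(X,\Lambda)$ is a finite-dimensional real vector space $X$ with a lattice $\Lambda$; a point $x$ is rational if $qx\in\Lambda$ for some nonzero integer $q$. An inner product $Q$ is rational if $Q(x,y)\in\mathbb{Q}$ for all rational $x,y$; $Q$ also denotes the induced inner product on $X^*$. A subspace $L$ is rational if $L\cap\Lambda$ is a lattice in $L$; then $X/L$ is a rational space with lattice $\pi_L(\Lambda)$, $\pi_L:X\to X/L$ the projection, and with the rational inner product obtained by identifying $X/L$ with $L^{\perp_Q}$. $(X/L)^*$ is identified with the annihilator $L^\perp\subset X^*$, and $p_L:X^*\to(X/L)^*$ is the orthogonal projection. A rational subspace $L$ carries the Lebesgue measure for which a fundamental domain of $L\cap\Lambda$ has measure $1$, its affine translates carry the translated measure, and every integral over a set is with respect to this measure on its affine hull (evaluation, for a point). $\langle S\rangle$ is the affine hull of $S$ and $L(S)$ the linear span of $\{y-x:x,y\in S\}$. $\mathcal{F}(P)$ is the set of non-empty faces of a polyhedron $P$ (including $P$); for a face $f$, $\pi_f=\pi_{L(f)}$, $p_f=p_{L(f)}$. A rational cone is a cone generated by finitely many lattice elements; it is unimodular if generated by a subset of an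 integral basis ($\mathbb{Z}$-basis) of the lattice, pointed if $C\cap(-C)=\{0\}$. A rational affine cone is $s+C$ with $s$ rational and $C$ a rational cone. The symbol of a constant-coefficient operator $D$ is $\sigma(D)(\xi)=e^{-\langle\xi,x\rangle}De^{\langle\xi,x\rangle}$. Berline–Vergne operators $D_n^X(C;F)$. For a rational polyhedron $P$ let $S(P)(\xi)=\sum_{\gamma\in P\cap\Lambda}e^{\langle\xi,\gamma\rangle}$, $I(P)(\xi)=\int_Pe^{\langle\xi,x\rangle}$, understood as meromorphic functions (by continuation; both are $0$ if $P$ contains a straight line); similarly on rational quotients. For a face $f$ of $P$, $C_P(f)$ is the cone generated by the vectors $y-x$, $y\in P$, $x\in f$, and $\mathfrak{t}(P,f)=\pi_f(\langle f\rangle+C_P(f))\subset X/L(f)$; for a cone $C$ and $F\in\mathcal{F}(C)$, $\mathfrak{t}(C,F)=\pi_F(C)$. By a theorem of Berline and Vergne there is a unique family of maps $\mu_W$, indexed by the rational quotients $W$ of $X$, assigning to each rational affine cone $\mathfrak{a}$ in $W$ a function $\mu_W(\mathfrak{a})$ analytic near $0\in W^*$ with rational Taylor coefficients, such that: $\mu_{\{0\}}(\{0\})=1$; $\mu_W(\mathfrak{a})=0$ if $\mathfrak{a}$ contains a straight line; $S(\mathfrak{a})(\xi)=\sum_{F\in\mathcal{F}(\mathfrak{a})}\mu_{W/L(F)}(\mathfrak{t}(\mathfrak{a},F))(\xi)I(F)(\xi)$, where functions on $(W/L(F))^*$ are pulled back to $W^*$ by orthogonal projection. Let $\mu^k_{X/L}(\mathfrak{a})$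 be the degree-$k$ homogeneous part of the Taylor expansion of $\mu_{X/L}(\mathfrak{a})$ at $0$. Then $D_n^X(C;F)$ is the constant-coefficient operator on $X$ with symbol $p_F^*\,\mu^{\,n-\dim(C)+\dim(F)}_{X/L(F)}(\pi_F(C))$. Operators $L(E;I,J;\alpha)$. Let $E$ be an integral basis of $\Lambda$. For $I\subset E$ let $\mathbb{Z}_+^I$ be the set of functions $\alpha:E\to\mathbb{Z}_{\ge0}$ vanishing off $I$, $|\alpha|=\sum_e\alpha(e)$, $\nabla^\alpha=\prod_{e\in E}\nabla_e^{\alpha(e)}$, $\mathbb{Z}_{>0}^I=\{\alpha\in\mathbb{Z}_+^I:\alpha(e)\ne0\ \forall e\in I\}$ ($\mathbb{Z}_{>0}^\emptyset=\{0\}$), $e(I)\in\mathbb{Z}_+^I$ the indicator function of $I$, $X(I)=\bigoplus_{e\in E\setminus I}\mathbb{R}e$ and $C(I)=\sum_{e\in E\setminus I}\mathbb{R}_+e$ ($X(E)=C(E)=\{0\}$). For fixed $\emptyset\ne I\subset E$ and $\alpha\in\mathbb{Z}_+^I$, $\{L(E;I,J;\alpha): I\subset J\subset E,\ |J|\le|\alpha|+|I|\}$ is the unique family (existence and uniqueness are known) of homogeneous constant-coefficient differential operators of order $|\alpha|-|J|+|I|$, involving derivatives only in directions $Q$-perpendicular to $X(J)$, such that for all $\varphi\in\mathcal{S}(X)$ $$\int_{C(I)}\nabla^\alpha\varphi=\sum_{I\subset J,\ |J|\le|\alpha|+|I|}(-1)^{|J|-|I|}\int_{C(J)}L(E;I,J;\alpha)\varphi.$$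 Operators $\mathcal{D}_n^X(C;F)$. Let $b_n$ be given by $\frac{z}{e^z-1}=\sum_{n\ge0}\frac{b_n}{n!}z^n$, $p(n)=(-1)^n\frac{b_n}{n!}$, $p_I(\nu)=\prod_{e\in I}p(\nu(e))$. (i) If $\dim(C)=\dim(X)$, let $E$ be the integral basis generating $C$; each face is $F=C(I_F)$ for a unique $I_F\subset E$. For $\dim(F)\ge\dim(C)-n$, $$\mathcal{D}_n^X(C;F)=(-1)^{n-\dim(C)+\dim(F)}\sum_{I\subset I_F}\ \sum_{\nu\in\mathbb{Z}_{>0}^I,\ |\nu|=n}p_I(\nu)\,L(E;I,I_F;\nu-e(I)),$$ and $\mathcal{D}_0^X(C;C)=1$, $\mathcal{D}_n^X(C;C)=0$ for $n\ge1$. (ii) In general, $\mathcal{D}_n^X(C;F)$ is the operator $\mathcal{D}_n^{L(C)}(C;F)$, defined as in (i) for $(L(C),L(C)\cap\Lambda)$, regarded as an operator on $X$ via the inclusion $L(C)\hookrightarrow X$. *)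

theory Defs
  imports "HOL-Analysis.Analysis"
begin

text \<open>
  Encoding.  The inner product \<open>Q\<close> is the inner product of the ambient type
  \<open>'a :: euclidean_space\<close>.  A rational space is a linear subspace \<open>X\<close> of \<open>'a\<close>, possibly \<open>{0}\<close>,
  with a lattice \<open>\<Lambda>\<close> in it.  As \<open>Q\<close> identifies \<open>X / L\<close> with the orthogonal complement of \<open>L\<close>
  in \<open>X\<close>, quotients are subspaces of \<open>X\<close> and the projection \<open>\<pi>\<^sub>L\<close> is the orthogonal projection.
  The dual of a subspace \<open>W\<close> is identified with \<open>W\<close> through \<open>Q\<close>: a functional is a vector \<open>\<xi> \<in> W\<close>
  with \<open>\<langle>\<xi>, x\<rangle> = \<xi> \<bullet> x\<close>.  The annihilator of \<open>L\<close> then becomes the orthogonal complement of \<open>L\<close>, and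
  \<open>p\<^sub>L\<close> is again the orthogonal projection.  Functions on a subspace are functions on \<open>'a\<close> whose
  values off the subspace are irrelevant.
\<close>

subsection \<open>Rational spaces\<close>

definition int_span :: "'a::euclidean_space set \<Rightarrow> 'a set" where
  "int_span B = {\<Sum>b\<in>B. of_int (c b) *\<^sub>R b | c :: 'a \<Rightarrow> int. True}"

definition integral_basis :: "'a::euclidean_space set \<Rightarrow> 'a set \<Rightarrow> bool" where
  "integral_basis \<Lambda> B \<longleftrightarrow> finite B \<and> independent B \<and> \<Lambda> = int_span B"

definition lattice_in :: "'a::euclidean_space set \<Rightarrow> 'a set \<Rightarrow> bool" where
  "lattice_in X \<Lambda> \<longleftrightarrow> (\<exists>B. integral_basis \<Lambda> B \<and> span B = X)"

definition rational_space :: "'a::euclidean_space set \<Rightarrow> 'a set \<Rightarrow> bool" where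
  "rational_space X \<Lambda> \<longleftrightarrow> subspace X \<and> lattice_in X \<Lambda>"

definition rational_points :: "'a::euclidean_space set \<Rightarrow> 'a set" where
  "rational_points \<Lambda> = {x. \<exists>q::int. q \<noteq> 0 \<and> of_int q *\<^sub>R x \<in> \<Lambda>}"

definition rational_inner_product :: "'a::euclidean_space set \<Rightarrow> bool" where
  "rational_inner_product \<Lambda> \<longleftrightarrow>
     (\<forall>x\<in>rational_points \<Lambda>. \<forall>y\<in>rational_points \<Lambda>. x \<bullet> y \<in> \<rat>)"

definition rational_subspace :: "'a::euclidean_space set \<Rightarrow> 'a set \<Rightarrow> bool" where
  "rational_subspace \<Lambda> L \<longleftrightarrow> subspace L \<and> lattice_in L (L \<inter> \<Lambda>)"

definition proj :: "'a::euclidean_space set \<Rightarrow> 'a \<Rightarrow> 'a" where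
  "proj V x = (THE y. y \<in> V \<and> (\<forall>v\<in>V. orthogonal (x - y) v))"

definition quot :: "'a::euclidean_space set \<Rightarrow> 'a set \<Rightarrow> 'a set" where
  "quot X L = X \<inter> orthogonal_comp L"

text \<open>
  The lattice of the quotient \<open>W\<close> is \<open>proj W ` \<Lambda>\<close>.  A quotient of a quotient is again a quotient of
  \<open>X\<close>, with the lattice obtained from \<open>\<Lambda>\<close> by one projection.
\<close>

definition rational_quotients :: "'a::euclidean_space set \<Rightarrow> 'a set \<Rightarrow> 'a set set" where
  "rational_quotients X \<Lambda> = {quot X L | L. rational_subspace \<Lambda> L}"


subsection \<open>Cones and faces\<close>

definition Lin :: "'a::euclidean_space set \<Rightarrow> 'a set" where
  "Lin S = span {y - x | x y. x \<in> S \<and> y \<in> S}"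

definition faces :: "'a::euclidean_space set \<Rightarrow> 'a set set" where
  "faces P = {F. F face_of P \<and> F \<noteq> {}}"

definition contains_line :: "'a::euclidean_space set \<Rightarrow> bool" where
  "contains_line P \<longleftrightarrow> (\<exists>x v. v \<noteq> 0 \<and> (\<forall>t::real. x + t *\<^sub>R v \<in> P))"

definition rational_cone :: "'a::euclidean_space set \<Rightarrow> 'a set \<Rightarrow> bool" where
  "rational_cone \<Lambda> C \<longleftrightarrow> (\<exists>G. finite G \<and> G \<subseteq> \<Lambda> \<and> C = convex_cone hull G)"

definition rational_affine_cone :: "'a::euclidean_space set \<Rightarrow> 'a set \<Rightarrow> bool" where
  "rational_affine_cone \<Lambda> a \<longleftrightarrow>
     (\<exists>s C. s \<in> rational_points \<Lambda> \<and> rational_cone \<Lambda> C \<and> a = (+) s ` C)"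

definition unimodular_cone :: "'a::euclidean_space set \<Rightarrow> 'a set \<Rightarrow> bool" where
  "unimodular_cone \<Lambda> C \<longleftrightarrow> (\<exists>B E. integral_basis \<Lambda> B \<and> E \<subseteq> B \<and> C = convex_cone hull E)"

definition transverse_cone :: "'a::euclidean_space set \<Rightarrow> 'a set \<Rightarrow> 'a set \<Rightarrow> 'a set" where
  "transverse_cone W P f =
     proj (quot W (Lin f)) `
       {u + c | u c. u \<in> affine hull f \<and> c \<in> convex_cone hull {y - x | x y. y \<in> P \<and> x \<in> f}}"


subsection \<open>Lattice-normalised integration\<close>

text \<open>
  The image of the product Lebesgue measure under the coordinates of an integral basis of
  \<open>Lin P \<inter> \<Lambda>\<close>, so that a fundamental domain has measure 1, translated to the affine hull of \<open>P\<close>.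
  It does not depend on the choices.  For a point the basis is empty and this is the
  unit point mass.
\<close>

definition hull_measure :: "'a::euclidean_space set \<Rightarrow> 'a set \<Rightarrow> 'a measure" where
  "hull_measure \<Lambda> P =
     (let B = (SOME B. integral_basis (Lin P \<inter> \<Lambda>) B); s = (SOME s. s \<in> P)
      in distr (PiM B (\<lambda>_. lborel :: real measure)) borel (\<lambda>y. s + (\<Sum>b\<in>B. y b *\<^sub>R b)))"

definition integral_over :: "'a::euclidean_space set \<Rightarrow> 'a set \<Rightarrow> ('a \<Rightarrow> real) \<Rightarrow> real" where
  "integral_over \<Lambda> P f = (LINT x:P|hull_measure \<Lambda> P. f x)"


subsection \<open>Analytic and meromorphic germs at the origin\<close>

definition near0 :: "'a::euclidean_space set \<Rightarrow> 'a filter" where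
  "near0 W = inf (nhds 0) (principal W)"

definition multi_indices :: "'a set \<Rightarrow> ('a \<Rightarrow> nat) set" where
  "multi_indices I = {\<alpha>. \<forall>e. e \<notin> I \<longrightarrow> \<alpha> e = 0}"

definition pos_multi_indices :: "'a set \<Rightarrow> ('a \<Rightarrow> nat) set" where
  "pos_multi_indices I = {\<alpha> \<in> multi_indices I. \<forall>e\<in>I. \<alpha> e \<noteq> 0}"

text \<open>Taylor expansion on the dual of \<open>span B\<close>, in the linear coordinates \<open>\<xi> \<mapsto> \<langle>\<xi>, b\<rangle>\<close>, \<open>b \<in> B\<close>.\<close>

definition has_taylor ::
    "'a::euclidean_space set \<Rightarrow> (('a \<Rightarrow> nat) \<Rightarrow> real) \<Rightarrow> ('a \<Rightarrow> real) \<Rightarrow> bool" where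
  "has_taylor B c f \<longleftrightarrow>
     (\<forall>\<^sub>F \<xi> in near0 (span B).
        ((\<lambda>\<alpha>. c \<alpha> * (\<Prod>b\<in>B. (\<xi> \<bullet> b) ^ \<alpha> b)) has_sum f \<xi>) (multi_indices B))"

definition analytic_at0 :: "'a::euclidean_space set \<Rightarrow> ('a \<Rightarrow> real) \<Rightarrow> bool" where
  "analytic_at0 W f \<longleftrightarrow> (\<exists>B c. independent B \<and> span B = W \<and> has_taylor B c f)"

definition rational_analytic_at0 :: "'a::euclidean_space set \<Rightarrow> ('a \<Rightarrow> real) \<Rightarrow> bool" where
  "rational_analytic_at0 \<Lambda> f \<longleftrightarrow> (\<exists>B c. integral_basis \<Lambda> B \<and> range c \<subseteq> \<rat> \<and> has_taylor B c f)"

definition homogeneous_part :: "nat \<Rightarrow> ('a::euclidean_space \<Rightarrow> real) \<Rightarrow> 'a \<Rightarrow> real" where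
  "homogeneous_part k f \<xi> = (deriv ^^ k) (\<lambda>t. f (t *\<^sub>R \<xi>)) 0 / fact k"

definition nonzero_germ :: "'a::euclidean_space set \<Rightarrow> ('a \<Rightarrow> real) \<Rightarrow> bool" where
  "nonzero_germ W G \<longleftrightarrow> analytic_at0 W G \<and> \<not> (\<forall>\<^sub>F \<xi> in near0 W. G \<xi> = 0)"

definition meromorphic_at0 :: "'a::euclidean_space set \<Rightarrow> ('a \<Rightarrow> real) \<Rightarrow> bool" where
  "meromorphic_at0 W M \<longleftrightarrow>
     (\<exists>N G. analytic_at0 W N \<and> nonzero_germ W G \<and>
            (\<forall>\<^sub>F \<xi> in near0 W. G \<xi> \<noteq> 0 \<longrightarrow> M \<xi> = N \<xi> / G \<xi>))"

text \<open>Equality of meromorphic germs: agreement off the zero set of a nonzero analytic germ.\<close>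

definition mero_eq :: "'a::euclidean_space set \<Rightarrow> ('a \<Rightarrow> real) \<Rightarrow> ('a \<Rightarrow> real) \<Rightarrow> bool" where
  "mero_eq W M M' \<longleftrightarrow>
     (\<exists>G. nonzero_germ W G \<and> (\<forall>\<^sub>F \<xi> in near0 W. G \<xi> \<noteq> 0 \<longrightarrow> M \<xi> = M' \<xi>))"

text \<open>
  \<open>M\<close> represents the germ at the origin of the meromorphic function \<open>S(P)\<close>, respectively \<open>I(P)\<close>.
  For a pointed affine cone the domain of convergence is an open cone, which has the origin in its
  closure, so the continuation is determined by the values there arbitrarily close to the origin.
\<close>

definition is_exp_sum ::
    "'a::euclidean_space set \<Rightarrow> 'a set \<Rightarrow> 'a set \<Rightarrow> ('a \<Rightarrow> real) \<Rightarrow> bool" where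
  "is_exp_sum W \<Lambda> P M \<longleftrightarrow>
     (if contains_line P then M = (\<lambda>_. 0)
      else meromorphic_at0 W M \<and>
        (\<forall>\<^sub>F \<xi> in near0 W. (\<lambda>\<gamma>. exp (\<xi> \<bullet> \<gamma>)) summable_on (P \<inter> \<Lambda>) \<longrightarrow>
             M \<xi> = (\<Sum>\<^sub>\<infinity>\<gamma>\<in>P \<inter> \<Lambda>. exp (\<xi> \<bullet> \<gamma>))))"

definition is_exp_integral ::
    "'a::euclidean_space set \<Rightarrow> 'a set \<Rightarrow> 'a set \<Rightarrow> ('a \<Rightarrow> real) \<Rightarrow> bool" where
  "is_exp_integral W \<Lambda> P M \<longleftrightarrow>
     (if contains_line P then M = (\<lambda>_. 0)
      else meromorphic_at0 W M \<and>
        (\<forall>\<^sub>F \<xi> in near0 W. set_integrable (hull_measure \<Lambda> P) P (\<lambda>x. exp (\<xi> \<bullet> x)) \<longrightarrow>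
             M \<xi> = integral_over \<Lambda> P (\<lambda>x. exp (\<xi> \<bullet> x))))"


subsection \<open>Constant-coefficient differential operators\<close>

type_synonym 'a operator = "('a \<Rightarrow> real) \<Rightarrow> 'a \<Rightarrow> real"

definition dir_deriv :: "'a::euclidean_space \<Rightarrow> 'a operator" where
  "dir_deriv v f x = deriv (\<lambda>t. f (x + t *\<^sub>R v)) 0"

definition iter_deriv :: "'a::euclidean_space list \<Rightarrow> 'a operator" where
  "iter_deriv vs = foldr dir_deriv vs"

text \<open>The order of the factors in \<open>\<nabla>\<^sup>\<alpha>\<close> is irrelevant on smooth functions.\<close>

definition nabla :: "('a::euclidean_space \<Rightarrow> nat) \<Rightarrow> 'a operator" where
  "nabla \<alpha> = iter_deriv (SOME vs. count_list vs = \<alpha>)"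

definition smooth :: "'a::euclidean_space set \<Rightarrow> ('a \<Rightarrow> real) \<Rightarrow> bool" where
  "smooth X f \<longleftrightarrow> (\<forall>vs. set vs \<subseteq> X \<longrightarrow> iter_deriv vs f differentiable_on X)"

definition schwartz :: "'a::euclidean_space set \<Rightarrow> ('a \<Rightarrow> real) \<Rightarrow> bool" where
  "schwartz X f \<longleftrightarrow> smooth X f \<and>
     (\<forall>vs k. set vs \<subseteq> X \<longrightarrow> bounded ((\<lambda>x. norm x ^ k * iter_deriv vs f x) ` X))"

definition const_coeff_op :: "'a::euclidean_space set \<Rightarrow> 'a operator \<Rightarrow> bool" where
  "const_coeff_op V D \<longleftrightarrow>
     (\<exists>S c. finite S \<and> (\<forall>vs\<in>S. set vs \<subseteq> V) \<and>
            D = (\<lambda>f x. \<Sum>vs\<in>S. c vs * iter_deriv vs f x))"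

text \<open>Homogeneous of order \<open>k\<close>, involving derivatives only in directions from \<open>V\<close>.\<close>

definition homogeneous_op :: "'a::euclidean_space set \<Rightarrow> nat \<Rightarrow> 'a operator \<Rightarrow> bool" where
  "homogeneous_op V k D \<longleftrightarrow>
     (\<exists>S c. finite S \<and> (\<forall>vs\<in>S. set vs \<subseteq> V \<and> length vs = k) \<and>
            D = (\<lambda>f x. \<Sum>vs\<in>S. c vs * iter_deriv vs f x))"

text \<open>Operators are given as maps on all functions, but they are compared on smooth ones only.\<close>

definition op_eq :: "'a::euclidean_space set \<Rightarrow> 'a operator \<Rightarrow> 'a operator \<Rightarrow> bool" where
  "op_eq X D D' \<longleftrightarrow> (\<forall>f. smooth X f \<longrightarrow> (\<forall>x\<in>X. D f x = D' f x))"

definition has_symbol :: "'a::euclidean_space set \<Rightarrow> 'a operator \<Rightarrow> ('a \<Rightarrow> real) \<Rightarrow> bool" where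
  "has_symbol X D \<sigma> \<longleftrightarrow>
     (\<forall>\<xi>\<in>X. \<forall>x\<in>X. exp (- (\<xi> \<bullet> x)) * D (\<lambda>y. exp (\<xi> \<bullet> y)) x = \<sigma> \<xi>)"


subsection \<open>The Berline--Vergne operators\<close>

text \<open>
  The characterisation of the Berline--Vergne family; only the germs at the origin of the functions
  \<open>\<mu> W a\<close> are determined.
\<close>

definition berline_vergne_family ::
    "'a::euclidean_space set \<Rightarrow> 'a set \<Rightarrow> ('a set \<Rightarrow> 'a set \<Rightarrow> 'a \<Rightarrow> real) \<Rightarrow> bool" where
  "berline_vergne_family X \<Lambda> \<mu> \<longleftrightarrow>
     \<mu> {0} {0} 0 = 1 \<and>
     (\<forall>W\<in>rational_quotients X \<Lambda>. \<forall>a. rational_affine_cone (proj W ` \<Lambda>) a \<longrightarrow>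
        rational_analytic_at0 (proj W ` \<Lambda>) (\<mu> W a) \<and>
        (contains_line a \<longrightarrow> (\<forall>\<^sub>F \<xi> in near0 W. \<mu> W a \<xi> = 0)) \<and>
        (\<forall>S I. is_exp_sum W (proj W ` \<Lambda>) a S \<longrightarrow>
           (\<forall>F\<in>faces a. is_exp_integral W (proj W ` \<Lambda>) F (I F)) \<longrightarrow>
           mero_eq W S
             (\<lambda>\<xi>. \<Sum>F\<in>faces a.
                \<mu> (quot W (Lin F)) (transverse_cone W a F) (proj (quot W (Lin F)) \<xi>) * I F \<xi>)))"

definition BV_op ::
    "'a::euclidean_space set \<Rightarrow> ('a set \<Rightarrow> 'a set \<Rightarrow> 'a \<Rightarrow> real) \<Rightarrow> nat \<Rightarrow> 'a set \<Rightarrow> 'a set \<Rightarrow> 'a operator"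
  where
  "BV_op X \<mu> n C F =
     (SOME D. const_coeff_op X D \<and>
        has_symbol X D
          (\<lambda>\<xi>. homogeneous_part (nat (int n - aff_dim C + aff_dim F))
                 (\<mu> (quot X (Lin F)) (proj (quot X (Lin F)) ` C)) (proj (quot X (Lin F)) \<xi>)))"


subsection \<open>The explicit operators\<close>

text \<open>
  All constructions take place in the rational space \<open>span E\<close> with integral basis \<open>E\<close>, a subspace of \<open>X\<close>;
  \<open>X(I)\<close> is \<open>span (E - I)\<close>, and \<open>sub_cone E I\<close> is the cone \<open>C(I)\<close>.
\<close>

definition sub_cone :: "'a::euclidean_space set \<Rightarrow> 'a set \<Rightarrow> 'a set" where
  "sub_cone E I = convex_cone hull (E - I)"

definition L_family ::
    "'a::euclidean_space set \<Rightarrow> 'a set \<Rightarrow>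
     ('a set \<Rightarrow> 'a set \<Rightarrow> ('a \<Rightarrow> nat) \<Rightarrow> 'a operator) \<Rightarrow> bool" where
  "L_family \<Lambda> E L \<longleftrightarrow>
     (\<forall>I \<alpha>. I \<noteq> {} \<and> I \<subseteq> E \<and> \<alpha> \<in> multi_indices I \<longrightarrow>
        (\<forall>J. I \<subseteq> J \<and> J \<subseteq> E \<and> card J \<le> sum \<alpha> E + card I \<longrightarrow>
           homogeneous_op (span E \<inter> orthogonal_comp (span (E - J)))
             (sum \<alpha> E + card I - card J) (L I J \<alpha>)) \<and>
        (\<forall>\<phi>. schwartz (span E) \<phi> \<longrightarrow>
           integral_over \<Lambda> (sub_cone E I) (nabla \<alpha> \<phi>) =
           (\<Sum>J | I \<subseteq> J \<and> J \<subseteq> E \<and> card J \<le> sum \<alpha> E + card I.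
              (- 1) ^ (card J - card I) * integral_over \<Lambda> (sub_cone E J) (L I J \<alpha> \<phi>))))"

definition bernoulli_b :: "nat \<Rightarrow> real" where
  "bernoulli_b n = fact n * fps_nth (fps_X / (fps_exp 1 - 1)) n"

definition p_coeff :: "nat \<Rightarrow> real" where
  "p_coeff n = (- 1) ^ n * (bernoulli_b n / fact n)"

definition cone_basis :: "'a::euclidean_space set \<Rightarrow> 'a set \<Rightarrow> 'a set" where
  "cone_basis \<Lambda> C = (THE E. integral_basis (span C \<inter> \<Lambda>) E \<and> C = convex_cone hull E)"

definition face_index :: "'a::euclidean_space set \<Rightarrow> 'a set \<Rightarrow> 'a set" where
  "face_index E F = (THE I. I \<subseteq> E \<and> F = sub_cone E I)"

text \<open>
  The operator on \<open>span C\<close> is regarded as an operator on \<open>X\<close> without change: it is built from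
  directional derivatives in directions from \<open>span C\<close>.
\<close>

definition explicit_op ::
    "'a::euclidean_space set \<Rightarrow> ('a set \<Rightarrow> 'a set \<Rightarrow> ('a \<Rightarrow> nat) \<Rightarrow> 'a operator) \<Rightarrow>
     nat \<Rightarrow> 'a set \<Rightarrow> 'a set \<Rightarrow> 'a operator" where
  "explicit_op \<Lambda> L n C F =
     (if F = C then (if n = 0 then (\<lambda>f. f) else (\<lambda>f x. 0))
      else let E = cone_basis \<Lambda> C; K = face_index E F in
        (\<lambda>f x. (- 1) ^ nat (int n - aff_dim C + aff_dim F) *
           (\<Sum>I\<in>Pow K. \<Sum>\<nu> | \<nu> \<in> pos_multi_indices I \<and> sum \<nu> E = n.
              (\<Prod>e\<in>I. p_coeff (\<nu> e)) * L I K (\<lambda>e. \<nu> e - (if e \<in> I then 1 else 0)) f x)))"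

end

theory Submission
  imports Defs
begin

text \<open>
  Write \<open>\<xi>\<^sub>e = \<langle>\<xi>, e\<rangle>\<close> for \<open>e\<close> in the integral basis \<open>E\<close> generating \<open>C\<close>.  The Berline--Vergne identity for the
  cone \<open>C\<close> itself, multiplied by \<open>\<Prod>(- \<xi>\<^sub>e)\<close>, reads
  \<open>\<Prod>\<^sub>E \<xi>\<^sub>e / (exp \<xi>\<^sub>e - 1) = (\<Sum>J \<subseteq> E. m\<^sub>J(\<xi>) \<Prod>\<^sub>J (- \<xi>\<^sub>e))\<close>, where \<open>m\<^sub>J\<close> is the pullback to \<open>X\<close> of the
  function \<open>\<mu>\<close> of the transverse cone along the face \<open>C(J)\<close>.  Testing the defining relation of the
  operators \<open>L(E;I,J;\<alpha>)\<close> on \<open>exp(\<langle>\<xi>,x\<rangle> - s|x|\<^sup>2)\<close> and letting \<open>s\<close> tend to \<open>0\<close> shows that the symbols of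
  the explicit operators satisfy the same relation in every degree.  Its solution is unique among
  families of polynomials \<open>m\<^sub>J\<close> pulled back from \<open>X/L(C(J))\<close>: on the annihilator of \<open>L(C(K))\<close> only the
  terms with \<open>J \<subseteq> K\<close> survive, so that \<open>m\<^sub>K\<close> is determined by induction on \<open>|K|\<close>.  Finally, operators
  with constant coefficients and equal symbols agree on smooth functions.
\<close>

subsection \<open>Orthogonal projections and dual vectors\<close>

text \<open>Exponentials are not Schwartz functions, so the relation defining \<open>L\<close>
  cannot be tested on them; the Gaussian factor repairs this, and dominated convergence removes it
  again as long as every pairing \<open>\<xi> \<bullet> e\<close> is negative. The identity obtained
  there is polynomial in \<xi> and extends to all \<xi>. On the other side, the Berline--Vergne
  equality is only known off the zeros of an unspecified nonzero germ; that germ is cancelled in the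
  ring of power series in one variable, after restriction to lines through the origin. The degrees
  fit because \<open>C(J)\<close> has codimension \<open>card J\<close>: in total degree
  \<open>n\<close> the factor of degree \<open>card J\<close> leaves degree
  \<open>n - card J\<close> for the function attached to \<open>C(J)\<close>. Two objects are
  defined by choice. For \<open>hull_measure\<close> this requires a proof that all bases of a
  lattice give the same measure; for \<open>BV_op\<close> the explicit operator itself serves as the
  witness.\<close>

lemma proj_props:
  assumes "subspace V"
  shows proj_in: "proj V x \<in> V" and proj_orthogonal: "v \<in> V \<Longrightarrow> (x - proj V x) \<bullet> v = 0"
    and proj_unique: "\<lbrakk>y \<in> V; \<And>v. v \<in> V \<Longrightarrow> (x - y) \<bullet> v = 0\<rbrakk> \<Longrightarrow> proj V x = y"
proof -
  have ex: "\<exists>y. y \<in> V \<and> (\<forall>v\<in>V. orthogonal (x - y) v)"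
    using orthogonal_subspace_decomp_exists[of V x] assms
    by (metis add_diff_cancel_left' orthogonal_commute span_eq_iff)
  have un: "y = z" if "y \<in> V \<and> (\<forall>v\<in>V. orthogonal (x - y) v)"
    "z \<in> V \<and> (\<forall>v\<in>V. orthogonal (x - z) v)" for y z
  proof -
    have "(x - y) \<bullet> (y - z) = 0" "(x - z) \<bullet> (y - z) = 0"
      using that assms by (auto simp: orthogonal_def subspace_diff)
    then have "(y - z) \<bullet> (y - z) = 0" by (simp add: inner_simps)
    then show ?thesis by simp
  qed
  have *: "proj V x \<in> V \<and> (\<forall>v\<in>V. orthogonal (x - proj V x) v)"
    unfolding proj_def by (rule theI') (use ex un in blast)
  then show "proj V x \<in> V" "v \<in> V \<Longrightarrow> (x - proj V x) \<bullet> v = 0"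
    by (auto simp: orthogonal_def)
  show "proj V x = y" if "y \<in> V" "\<And>v. v \<in> V \<Longrightarrow> (x - y) \<bullet> v = 0"
    using un[OF *] that by (auto simp: orthogonal_def)
qed

lemma proj_inner: "subspace V \<Longrightarrow> v \<in> V \<Longrightarrow> proj V x \<bullet> v = x \<bullet> v"
  using proj_orthogonal[of V v x] by (simp add: inner_simps)

lemma proj_ident: "subspace V \<Longrightarrow> x \<in> V \<Longrightarrow> proj V x = x"
  by (rule proj_unique) auto

lemma proj_eq_0: "subspace V \<Longrightarrow> (\<And>v. v \<in> V \<Longrightarrow> x \<bullet> v = 0) \<Longrightarrow> proj V x = 0"
  by (rule proj_unique) (auto simp: subspace_0)

lemma linear_proj: "subspace V \<Longrightarrow> linear (proj V)"
  by (rule linearI; rule proj_unique)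
     (auto simp: subspace_add subspace_scale proj_in inner_simps proj_inner)

text \<open>Extend the coordinate functional of \<open>g\<close> linearly, represent it by a vector
  through the orthonormal basis, and project that vector to \<open>span G\<close>, which leaves its
  pairings with \<open>G\<close> unchanged.\<close>

lemma dual_vec_exists:
  fixes G :: "'a::euclidean_space set"
  assumes "independent G"
  shows "\<exists>d. \<forall>g\<in>G. d g \<in> span G \<and> (\<forall>h\<in>G. d g \<bullet> h = (if h = g then 1 else 0))"
proof -
  have "\<exists>v. v \<in> span G \<and> (\<forall>h\<in>G. v \<bullet> h = (if h = g then 1 else 0))" for g
  proof -
    obtain f :: "'a \<Rightarrow> real" where f: "linear f" "\<forall>h\<in>G. f h = (if h = g then 1 else 0)"
      using linear_independent_extend[OF assms, of "\<lambda>h. if h = g then 1 else 0"] by blast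
    define v where "v = proj (span G) (\<Sum>i\<in>Basis. f i *\<^sub>R i)"
    have "v \<bullet> h = f h" if "h \<in> G" for h
    proof -
      have "v \<bullet> h = (\<Sum>i\<in>Basis. f i *\<^sub>R i) \<bullet> h"
        unfolding v_def by (rule proj_inner) (auto simp: that span_base)
      also have "\<dots> = (\<Sum>i\<in>Basis. f i * (h \<bullet> i))"
        by (simp add: inner_sum_left) (simp add: inner_commute)
      also have "\<dots> = f (\<Sum>i\<in>Basis. (h \<bullet> i) *\<^sub>R i)"
        by (simp add: linear_sum[OF f(1)] linear_cmul[OF f(1)] mult.commute)
      finally show ?thesis by (simp add: euclidean_representation)
    qed
    then show ?thesis using f(2) by (intro exI[of _ v]) (auto simp: v_def proj_in)
  qed
  then show ?thesis by metis
qed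

text \<open>Pairing with \<open>dual_vec G g\<close> reads off the \<open>g\<close>-coordinate of a
  point of \<open>span G\<close>; cones, lattices and fundamental boxes are described below by
  conditions on these pairings.\<close>

definition dual_vec :: "'a::euclidean_space set \<Rightarrow> 'a \<Rightarrow> 'a" where
  "dual_vec G = (SOME d. \<forall>g\<in>G. d g \<in> span G \<and> (\<forall>h\<in>G. d g \<bullet> h = (if h = g then 1 else 0)))"

lemma dual_vec:
  assumes "independent G" "g \<in> G"
  shows dual_vec_in_span: "dual_vec G g \<in> span G"
    and dual_vec_inner: "h \<in> G \<Longrightarrow> h \<bullet> dual_vec G g = (if h = g then 1 else 0)"
  using someI_ex[OF dual_vec_exists[OF assms(1)]] assms(2)
  unfolding dual_vec_def[symmetric] by (auto simp: inner_commute)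

lemma inner_dual_vec_sum:
  assumes "independent G" "g \<in> G"
  shows "(\<Sum>h\<in>G. c h *\<^sub>R h) \<bullet> dual_vec G g = c g"
proof -
  have "finite G" using assms(1) by (rule independent_imp_finite)
  have "(\<Sum>h\<in>G. c h *\<^sub>R h) \<bullet> dual_vec G g = (\<Sum>h\<in>G. if h = g then c h else 0)"
    unfolding inner_sum_left by (rule sum.cong) (auto simp: dual_vec_inner[OF assms])
  then show ?thesis using assms \<open>finite G\<close> by simp
qed

lemma sum_dual_vec:
  assumes "independent G" "x \<in> span G"
  shows "(\<Sum>g\<in>G. (x \<bullet> dual_vec G g) *\<^sub>R g) = x"
proof -
  obtain c where x: "x = (\<Sum>g\<in>G. c g *\<^sub>R g)"
    using assms span_finite[OF independent_imp_finite[OF assms(1)]] by auto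
  show ?thesis unfolding x by (rule sum.cong) (simp_all add: inner_dual_vec_sum[OF assms(1)])
qed

text \<open>Functionals may be prescribed freely on a basis, with dual vectors as building blocks.
  This supplies the test functionals at which products of linear forms are seen to be
  nonzero.\<close>

lemma ex_inner_eq:
  fixes G :: "'a::euclidean_space set"
  assumes "independent G"
  shows "\<exists>x\<in>span G. \<forall>g\<in>G. x \<bullet> g = c g"
proof -
  have "(\<Sum>h\<in>G. c h *\<^sub>R dual_vec G h) \<bullet> g = c g" if "g \<in> G" for g
  proof -
    have "(\<Sum>h\<in>G. c h *\<^sub>R dual_vec G h) \<bullet> g = (\<Sum>h\<in>G. if h = g then c h else 0)"
      unfolding inner_sum_left
      by (rule sum.cong) (use that in \<open>auto simp: inner_commute dual_vec_inner[OF assms]\<close>)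
    then show ?thesis using that independent_imp_finite[OF assms] by simp
  qed
  then show ?thesis
    by (intro bexI[of _ "\<Sum>h\<in>G. c h *\<^sub>R dual_vec G h"])
       (auto intro!: span_sum span_scale dual_vec_in_span assms)
qed

lemma span_subset_dual:
  assumes "independent B" "G \<subseteq> B"
  shows "x \<in> span G \<longleftrightarrow> x \<in> span B \<and> (\<forall>b\<in>B - G. x \<bullet> dual_vec B b = 0)"
proof
  assume x: "x \<in> span G"
  have "x \<bullet> dual_vec B b = 0" if b: "b \<in> B - G" for b
    using x
  proof (induction rule: span_induct)
    case base
    show ?case by (auto simp: subspace_def inner_simps)
  next
    case (step y)
    then show ?case using b assms(2) by (auto simp: dual_vec_inner[OF assms(1)])
  qed
  then show "x \<in> span B \<and> (\<forall>b\<in>B - G. x \<bullet> dual_vec B b = 0)"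
    using x span_mono[OF assms(2)] by auto
next
  assume x: "x \<in> span B \<and> (\<forall>b\<in>B - G. x \<bullet> dual_vec B b = 0)"
  have "x = (\<Sum>g\<in>B. (x \<bullet> dual_vec B g) *\<^sub>R g)" using sum_dual_vec[OF assms(1)] x by simp
  also have "\<dots> = (\<Sum>g\<in>G. (x \<bullet> dual_vec B g) *\<^sub>R g)"
    by (rule sum.mono_neutral_right) (use x assms independent_imp_finite in auto)
  also have "\<dots> \<in> span G" by (intro span_sum span_scale span_base)
  finally show "x \<in> span G" .
qed

text \<open>The dual vectors of \<open>G\<close> and of \<open>B\<close> differ in general as
  vectors, but on \<open>span G\<close> they read the same coordinate; this allows switching between
  a basis and a part of it.\<close>

lemma dual_vec_restrict:
  assumes "independent B" "G \<subseteq> B" "x \<in> span G" "g \<in> G"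
  shows "x \<bullet> dual_vec G g = x \<bullet> dual_vec B g"
proof -
  have G: "independent G" using assms independent_mono by blast
  have "g \<in> B" using assms by auto
  have "x \<bullet> dual_vec B g = (\<Sum>h\<in>G. (x \<bullet> dual_vec G h) *\<^sub>R h) \<bullet> dual_vec B g"
    using sum_dual_vec[OF G assms(3)] by simp
  also have "\<dots> = (\<Sum>h\<in>G. if h = g then x \<bullet> dual_vec G h else 0)"
    unfolding inner_sum_left
    by (rule sum.cong) (use assms in \<open>auto simp: dual_vec_inner[OF assms(1) \<open>g \<in> B\<close>]\<close>)
  finally show ?thesis using assms independent_imp_finite[OF G] by simp
qed


subsection \<open>Simplicial cones and their faces\<close>

lemma simplicial_cone_sum:
  fixes G :: "'a::euclidean_space set"
  assumes "finite G"
  shows "convex_cone hull G = {\<Sum>g\<in>G. t g *\<^sub>R g | t. \<forall>g\<in>G. 0 \<le> t g}" (is "_ = ?R")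
proof
  show "convex_cone hull G \<subseteq> ?R"
  proof (rule hull_minimal)
    show "G \<subseteq> ?R"
    proof
      fix g assume "g \<in> G"
      then have "g = (\<Sum>h\<in>G. (if h = g then 1 else 0) *\<^sub>R h)"
        using assms by (subst sum.mono_neutral_right[of G "{g}"]) auto
      then show "g \<in> ?R" by (intro CollectI exI[of _ "\<lambda>h. if h = g then 1 else 0"]) auto
    qed
    have zero: "0 \<in> ?R" by (auto intro!: exI[of _ "\<lambda>_. 0"])
    have add: "x + y \<in> ?R" if "x \<in> ?R" "y \<in> ?R" for x y
    proof -
      obtain t u where "x = (\<Sum>g\<in>G. t g *\<^sub>R g)" "\<forall>g\<in>G. 0 \<le> t g"
        "y = (\<Sum>g\<in>G. u g *\<^sub>R g)" "\<forall>g\<in>G. 0 \<le> u g" using \<open>x \<in> ?R\<close> \<open>y \<in> ?R\<close> by blast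
      then show ?thesis
        by (intro CollectI exI[of _ "\<lambda>g. t g + u g"]) (auto simp: sum.distrib scaleR_left_distrib)
    qed
    have scale: "c *\<^sub>R x \<in> ?R" if "x \<in> ?R" "c \<ge> 0" for x c
    proof -
      obtain t where "x = (\<Sum>g\<in>G. t g *\<^sub>R g)" "\<forall>g\<in>G. 0 \<le> t g" using \<open>x \<in> ?R\<close> by blast
      then have "c *\<^sub>R x = (\<Sum>g\<in>G. (c * t g) *\<^sub>R g)" "\<forall>g\<in>G. 0 \<le> c * t g"
        using \<open>c \<ge> 0\<close> by (simp_all add: scaleR_sum_right)
      then show ?thesis by (intro CollectI exI[of _ "\<lambda>g. c * t g"] conjI)
    qed
    show "convex_cone ?R"
      unfolding convex_cone_iff by (intro conjI ballI allI impI zero add scale)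
  qed
  show "?R \<subseteq> convex_cone hull G"
  proof clarify
    fix t :: "'a \<Rightarrow> real" assume t: "\<forall>g\<in>G. 0 \<le> t g"
    have "(\<Sum>g\<in>H. t g *\<^sub>R g) \<in> convex_cone hull G" if "finite H" "H \<subseteq> G" for H
      using that
      by (induction H) (use t in \<open>simp_all add: convex_cone_hull_contains_0
          convex_cone_hull_add convex_cone_hull_mul hull_inc\<close>)
    then show "(\<Sum>g\<in>G. t g *\<^sub>R g) \<in> convex_cone hull G" using assms by auto
  qed
qed

lemma simplicial_cone_iff:
  assumes "independent G"
  shows "x \<in> convex_cone hull G \<longleftrightarrow> x \<in> span G \<and> (\<forall>g\<in>G. 0 \<le> x \<bullet> dual_vec G g)"
proof
  assume "x \<in> convex_cone hull G"
  then obtain t where t: "x = (\<Sum>g\<in>G. t g *\<^sub>R g)" "\<forall>g\<in>G. 0 \<le> t g"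
    unfolding simplicial_cone_sum[OF independent_imp_finite[OF assms]] by auto
  then show "x \<in> span G \<and> (\<forall>g\<in>G. 0 \<le> x \<bullet> dual_vec G g)"
    unfolding t(1)
    by (auto simp: inner_dual_vec_sum[OF assms] intro!: span_sum intro: span_scale span_base)
next
  assume x: "x \<in> span G \<and> (\<forall>g\<in>G. 0 \<le> x \<bullet> dual_vec G g)"
  then show "x \<in> convex_cone hull G"
    unfolding simplicial_cone_sum[OF independent_imp_finite[OF assms]]
    by (intro CollectI exI[of _ "\<lambda>g. x \<bullet> dual_vec G g"]) (auto simp: sum_dual_vec[OF assms])
qed

text \<open>Dropping generators amounts to setting their coordinates to zero, so membership in any
  face can be tested with the dual vectors of the full set \<open>E\<close>.\<close>

lemma subcone_iff:
  assumes "independent E" "G \<subseteq> E"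
  shows "x \<in> convex_cone hull G \<longleftrightarrow>
    x \<in> convex_cone hull E \<and> (\<forall>b\<in>E - G. x \<bullet> dual_vec E b = 0)"
proof -
  have G: "independent G" using assms independent_mono by blast
  show ?thesis
    unfolding simplicial_cone_iff[OF G] simplicial_cone_iff[OF assms(1)]
  proof (intro iffI conjI ballI; (elim conjE)?)
    fix b assume x: "x \<in> span G" "\<forall>g\<in>G. 0 \<le> x \<bullet> dual_vec G g"
    have d: "x \<in> span E" "\<And>b. b \<in> E - G \<Longrightarrow> x \<bullet> dual_vec E b = 0"
      using x(1) span_subset_dual[OF assms, of x] by auto
    show "x \<in> span E" by (rule d)
    show "x \<bullet> dual_vec E b = 0" if "b \<in> E - G" using that by (rule d)
    show "0 \<le> x \<bullet> dual_vec E b" if "b \<in> E"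
      using x(2) d(2)[of b] dual_vec_restrict[OF assms x(1), of b] that by (cases "b \<in> G") auto
  next
    assume x: "x \<in> span E" "\<forall>g\<in>E. 0 \<le> x \<bullet> dual_vec E g" "\<forall>b\<in>E - G. x \<bullet> dual_vec E b = 0"
    show xG: "x \<in> span G" using x(1,3) span_subset_dual[OF assms, of x] by auto
    fix g assume "g \<in> G"
    then show "0 \<le> x \<bullet> dual_vec G g" using dual_vec_restrict[OF assms xG] x(2) assms(2) by auto
  qed
qed

text \<open>A face determines its generators, so subsets of \<open>E\<close> index the faces without
  repetition.\<close>

lemma gens_in_subcone:
  fixes E :: "'a::euclidean_space set"
  assumes "independent E" "G \<subseteq> E"
  shows "E \<inter> convex_cone hull G = G"
proof
  show "E \<inter> convex_cone hull G \<subseteq> G"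
    using subcone_iff[OF assms] dual_vec_inner[OF assms(1)] by force
  show "G \<subseteq> E \<inter> convex_cone hull G" using assms(2) by (auto simp: hull_inc)
qed

text \<open>A nonempty face of the cone is itself a convex cone, and it contains every generator
  that has a nonzero coefficient in one of its points; so it is generated by
  \<open>E \<inter> F\<close>. Conversely, if a nonnegative coordinate vanishes inside a segment, it
  vanishes at both ends.\<close>

lemma faces_simplicial_cone:
  fixes E :: "'a::euclidean_space set"
  assumes "independent E"
  shows "faces (convex_cone hull E) = (\<lambda>G. convex_cone hull G) ` Pow E"
proof (intro equalityI subsetI)
  fix F assume "F \<in> faces (convex_cone hull E)"
  then have face: "F face_of (convex_cone hull E)" and ne: "F \<noteq> {}" by (auto simp: faces_def)
  let ?C = "convex_cone hull E"
  have sub: "F \<subseteq> ?C" using face by (rule face_of_imp_subset)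
  \<comment> \<open>The face property is only needed for midpoints; equal endpoints are treated
    apart because their open segment is empty.\<close>
  have mid: "a \<in> F" if "a \<in> ?C" "b \<in> ?C" "(1/2) *\<^sub>R a + (1/2) *\<^sub>R b \<in> F" for a b
  proof (cases "a = b")
    case True
    then show ?thesis using that(3) by (simp add: scaleR_left_distrib[symmetric])
  next
    case False
    have "(1/2) *\<^sub>R a + (1/2) *\<^sub>R b \<in> open_segment a b"
      using False by (auto simp: in_segment intro!: exI[of _ "1/2"])
    then show ?thesis using face that unfolding face_of_def by blast
  qed
  have zero: "0 \<in> F" 
  proof -
    obtain x where x: "x \<in> F" using ne by auto
    then have "2 *\<^sub>R x \<in> ?C" using sub by (auto intro: convex_cone_hull_mul)
    then show ?thesis using mid[of 0 "2 *\<^sub>R x"] x by (auto simp: convex_cone_hull_contains_0)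
  qed
  have dbl: "2 *\<^sub>R x \<in> F" if "x \<in> F" for x
  proof (rule mid[of _ 0])
    show "2 *\<^sub>R x \<in> ?C" using that sub by (intro convex_cone_hull_mul) auto
  qed (use that in \<open>auto simp: convex_cone_hull_contains_0\<close>)
  have conv: "convex F" using face by (auto simp: face_of_def)
  have add: "x + y \<in> F" if "x \<in> F" "y \<in> F" for x y
  proof -
    have "(1/2) *\<^sub>R (2 *\<^sub>R x) + (1/2) *\<^sub>R (2 *\<^sub>R y) \<in> F"
      by (rule convexD[OF conv dbl[OF that(1)] dbl[OF that(2)]]) auto
    then show ?thesis by simp
  qed
  \<comment> \<open>Doubling reaches a multiple \<open>2 ^ k\<close> beyond \<open>c\<close>, and
    convexity together with 0 shrinks it back.\<close>
  have scale: "c *\<^sub>R x \<in> F" if "x \<in> F" "0 \<le> c" for c x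
  proof -
    have small: "c *\<^sub>R x \<in> F" if "x \<in> F" "0 \<le> c" "c \<le> 1" for c x
      using conv that zero convexD[of F 0 x "1 - c" c] by auto
    have "(2 ^ k) *\<^sub>R x \<in> F" for k :: nat
      by (induction k) (use that dbl in \<open>auto simp: scaleR_scaleR[symmetric] simp del: scaleR_scaleR\<close>)
    moreover obtain k :: nat where k: "c < 2 ^ k" using real_arch_pow[of 2 c] by auto
    ultimately have "(c / 2 ^ k) *\<^sub>R ((2 ^ k) *\<^sub>R x) \<in> F"
      using that k by (intro small[OF \<open>2 ^ k *\<^sub>R x \<in> F\<close>]) simp_all
    then show ?thesis by simp
  qed
  have "convex_cone F"
    unfolding convex_cone_iff by (intro conjI ballI allI impI zero add scale)
  then have 1: "convex_cone hull (E \<inter> F) \<subseteq> F" by (intro hull_minimal) auto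
  have 2: "F \<subseteq> convex_cone hull (E \<inter> F)"
  proof
    fix x assume x: "x \<in> F"
    have xC: "x \<in> ?C" using x sub by auto
    have "x \<bullet> dual_vec E b = 0" if "b \<in> E - F" for b
    proof (rule ccontr)
      assume nz: "x \<bullet> dual_vec E b \<noteq> 0"
      have b: "b \<in> E" using that by auto
      define c where "c = x \<bullet> dual_vec E b"
      have c: "c > 0" using nz b xC simplicial_cone_iff[OF assms] by (force simp: c_def)
      \<comment> \<open>Removing the whole \<open>b\<close>-component keeps the point in the cone,
        and \<open>x\<close> is the midpoint of twice \<open>y\<close> and twice that component.
        Hence a positive multiple of \<open>b\<close> lies in the face, against the choice of
        \<open>b\<close>.\<close>
      define y where "y = x - c *\<^sub>R b"
      have yC: "y \<in> ?C"
        unfolding simplicial_cone_iff[OF assms]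
      proof (intro conjI ballI)
        show "y \<in> span E" using xC b unfolding y_def simplicial_cone_iff[OF assms]
          by (simp add: span_diff span_scale span_base)
        fix g assume g: "g \<in> E"
        show "0 \<le> y \<bullet> dual_vec E g"
          using xC g b unfolding y_def simplicial_cone_iff[OF assms]
          by (auto simp: inner_simps dual_vec_inner[OF assms g] c_def)
      qed
      have "(2 * c) *\<^sub>R b \<in> F"
      proof (rule mid)
        show "(2 * c) *\<^sub>R b \<in> ?C" using c b by (intro convex_cone_hull_mul hull_inc) auto
        show "2 *\<^sub>R y \<in> ?C" using yC by (intro convex_cone_hull_mul) auto
        show "(1/2) *\<^sub>R (2 * c) *\<^sub>R b + (1/2) *\<^sub>R 2 *\<^sub>R y \<in> F" using x by (simp add: y_def)
      qed
      then have "(1 / (2 * c)) *\<^sub>R ((2 * c) *\<^sub>R b) \<in> F" by (rule scale) (use c in auto)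
      then show False using c that by simp
    qed
    then show "x \<in> convex_cone hull (E \<inter> F)"
      using subcone_iff[OF assms, of "E \<inter> F" x] xC by auto
  qed
  show "F \<in> (\<lambda>G. convex_cone hull G) ` Pow E"
    using 1 2 by blast
next
  fix F assume "F \<in> (\<lambda>G. convex_cone hull G) ` Pow E"
  then obtain G where G: "G \<subseteq> E" "F = convex_cone hull G" by auto
  have "F face_of convex_cone hull E"
    unfolding face_of_def
  proof (intro conjI ballI impI)
    show "F \<subseteq> convex_cone hull E" using hull_mono[OF G(1)] G(2) by simp
    show "convex F" using G convex_convex_cone_hull by auto
    fix a b x assume ab: "a \<in> convex_cone hull E" "b \<in> convex_cone hull E" "x \<in> F" "x \<in> open_segment a b"
    obtain u where u: "0 < u" "u < 1" "x = (1 - u) *\<^sub>R a + u *\<^sub>R b"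
      using ab(4) by (auto simp: in_segment)
    have "a \<bullet> dual_vec E e = 0 \<and> b \<bullet> dual_vec E e = 0" if e: "e \<in> E - G" for e
    proof -
      have "(1 - u) * (a \<bullet> dual_vec E e) + u * (b \<bullet> dual_vec E e) = 0"
        using ab(3) e subcone_iff[OF assms G(1)] G(2) u(3) by (auto simp: inner_simps)
      moreover have nn: "0 \<le> a \<bullet> dual_vec E e" "0 \<le> b \<bullet> dual_vec E e"
        using ab e simplicial_cone_iff[OF assms] by auto
      ultimately have "(1 - u) * (a \<bullet> dual_vec E e) = 0 \<and> u * (b \<bullet> dual_vec E e) = 0"
        using u(1,2) by (subst (asm) add_nonneg_eq_0_iff) auto
      then show ?thesis using u(1,2) by auto
    qed
    then show "a \<in> F" "b \<in> F" using subcone_iff[OF assms G(1)] G(2) ab by auto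
  qed
  then show "F \<in> faces (convex_cone hull E)"
    using G convex_cone_hull_nonempty by (auto simp: faces_def)
qed

lemma span_convex_cone_hull: "span (convex_cone hull G) = span G"
proof
  have "convex_cone hull G \<subseteq> span G"
    by (rule hull_minimal)
       (simp_all add: span_superset convex_cone_def subspace_imp_conic subspace_imp_convex ex_in_conv[symmetric] exI[of _ 0] span_zero)
  then show "span (convex_cone hull G) \<subseteq> span G" by (simp add: span_minimal)
  show "span G \<subseteq> span (convex_cone hull G)" by (intro span_mono hull_subset)
qed

lemma Lin_convex_cone_hull: "Lin (convex_cone hull G) = span G"
proof -
  have "Lin (convex_cone hull G) = span (convex_cone hull G)"
    unfolding Lin_def
  proof (rule span_eq[THEN iffD2], intro conjI subsetI)
    fix z assume "z \<in> {y - x |x y. x \<in> convex_cone hull G \<and> y \<in> convex_cone hull G}"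
    then show "z \<in> span (convex_cone hull G)" by (auto intro: span_diff span_base)
  next
    fix z assume z: "z \<in> convex_cone hull G"
    then have "z - 0 \<in> {y - x |x y. x \<in> convex_cone hull G \<and> y \<in> convex_cone hull G}"
      using convex_cone_hull_contains_0 by blast
    then show "z \<in> span {y - x |x y. x \<in> convex_cone hull G \<and> y \<in> convex_cone hull G}"
      by (simp add: span_base)
  qed
  then show ?thesis by (simp add: span_convex_cone_hull)
qed

lemma aff_dim_simplicial_cone:
  fixes G :: "'a::euclidean_space set"
  assumes "independent G"
  shows "aff_dim (convex_cone hull G) = int (card G)"
proof -
  have "aff_dim (convex_cone hull G) = int (dim (convex_cone hull G))"
    by (rule aff_dim_zero) (simp add: convex_cone_hull_contains_0 hull_inc)
  also have "dim (convex_cone hull G) = dim G" 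
    by (metis dim_span span_convex_cone_hull)
  finally show ?thesis using assms by (simp add: dim_eq_card_independent)
qed

lemma no_line_simplicial_cone:
  fixes G :: "'a::euclidean_space set"
  assumes "independent G"
  shows "\<not> contains_line (convex_cone hull G)"
proof
  assume "contains_line (convex_cone hull G)"
  then obtain x v where v: "v \<noteq> 0" "\<And>t. x + t *\<^sub>R v \<in> convex_cone hull G"
    by (auto simp: contains_line_def)
  have "v \<bullet> dual_vec G g = 0" if g: "g \<in> G" for g
  proof (rule ccontr)
    assume nz: "v \<bullet> dual_vec G g \<noteq> 0"
    have "0 \<le> (x + t *\<^sub>R v) \<bullet> dual_vec G g" for t
      using v(2)[of t] simplicial_cone_iff[OF assms] g by auto
    from this[of "- (x \<bullet> dual_vec G g + 1) / (v \<bullet> dual_vec G g)"] nz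
    show False by (simp add: inner_simps)
  qed
  moreover have "v \<in> span G"
  proof -
    have "x + 1 *\<^sub>R v \<in> span G" "x + 0 *\<^sub>R v \<in> span G"
      using v(2) simplicial_cone_iff[OF assms] by blast+
    then show ?thesis by (metis add_diff_cancel_left' add.right_neutral scaleR_one scaleR_zero_left span_diff)
  qed
  ultimately show False using v(1) sum_dual_vec[OF assms, of v] by simp
qed

lemma closed_simplicial_cone:
  fixes G :: "'a::euclidean_space set"
  assumes "independent G"
  shows "closed (convex_cone hull G)"
proof -
  have "convex_cone hull G = span G \<inter> (\<Inter>g\<in>G. {x. 0 \<le> x \<bullet> dual_vec G g})"
    using simplicial_cone_iff[OF assms] by auto
  moreover have "closed (\<Inter>g\<in>G. {x. 0 \<le> x \<bullet> dual_vec G g})"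
    by (intro closed_INT ballI closed_Collect_le continuous_intros)
  ultimately show ?thesis by (simp add: closed_Int closed_subspace)
qed


subsection \<open>Lattices\<close>

lemma int_span_mem_iff:
  assumes "independent G"
  shows "x \<in> int_span G \<longleftrightarrow> x \<in> span G \<and> (\<forall>g\<in>G. x \<bullet> dual_vec G g \<in> \<int>)"
proof
  assume "x \<in> int_span G"
  then obtain c where x: "x = (\<Sum>b\<in>G. of_int (c b) *\<^sub>R b)" by (auto simp: int_span_def)
  then show "x \<in> span G \<and> (\<forall>g\<in>G. x \<bullet> dual_vec G g \<in> \<int>)"
    unfolding x by (auto simp: inner_dual_vec_sum[OF assms] intro: span_sum span_scale span_base)
next
  assume x: "x \<in> span G \<and> (\<forall>g\<in>G. x \<bullet> dual_vec G g \<in> \<int>)"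
  have "x = (\<Sum>b\<in>G. of_int \<lfloor>x \<bullet> dual_vec G b\<rfloor> *\<^sub>R b)"
    using sum_dual_vec[OF assms, of x] x by (simp add: of_int_floor_cancel cong: sum.cong)
  then show "x \<in> int_span G" unfolding int_span_def by (intro CollectI exI[of _ "\<lambda>b. \<lfloor>x \<bullet> dual_vec G b\<rfloor>"]) simp
qed

lemma countable_int_span:
  fixes G :: "'a::euclidean_space set"
  assumes "finite G"
  shows "countable (int_span G)"
proof -
  have "int_span G \<subseteq> (\<lambda>c :: 'a \<Rightarrow> int. \<Sum>b\<in>G. of_int (c b) *\<^sub>R b) ` (PiE G (\<lambda>_. UNIV))"
  proof
    fix x assume "x \<in> int_span G"
    then obtain c where x: "x = (\<Sum>b\<in>G. of_int (c b) *\<^sub>R b)" by (auto simp: int_span_def)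
    then show "x \<in> (\<lambda>c :: 'a \<Rightarrow> int. \<Sum>b\<in>G. of_int (c b) *\<^sub>R b) ` (PiE G (\<lambda>_. UNIV))"
      by (intro image_eqI[of _ _ "restrict c G"]) (auto cong: sum.cong)
  qed
  then show ?thesis by (rule countable_subset) (use assms in \<open>auto intro!: countable_PiE\<close>)
qed

text \<open>On \<open>span G\<close> the coordinates outside \<open>G\<close> vanish and are
  trivially integral. So every coordinate subspace is rational, with \<open>G\<close> as an integral
  basis of its lattice.\<close>

lemma int_span_subbasis:
  assumes "independent B" "G \<subseteq> B"
  shows "span G \<inter> int_span B = int_span G"
proof -
  have G: "independent G" using assms independent_mono by blast
  show ?thesis
  proof (intro set_eqI iffI)
    fix x assume "x \<in> span G \<inter> int_span B"
    then show "x \<in> int_span G"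
      unfolding int_span_mem_iff[OF G] Int_iff int_span_mem_iff[OF assms(1)]
      using dual_vec_restrict[OF assms, of x] assms(2) by auto
  next
    fix x assume "x \<in> int_span G"
    then have x: "x \<in> span G" "\<And>g. g \<in> G \<Longrightarrow> x \<bullet> dual_vec B g \<in> \<int>"
      unfolding int_span_mem_iff[OF G] using dual_vec_restrict[OF assms, of x] by auto
    moreover have "x \<bullet> dual_vec B b \<in> \<int>" if "b \<in> B" for b
      using x(2)[of b] x(1) span_subset_dual[OF assms, of x] that by (cases "b \<in> G") auto
    ultimately show "x \<in> span G \<inter> int_span B"
      unfolding Int_iff int_span_mem_iff[OF assms(1)] using span_mono[OF assms(2)] by auto
  qed
qed

lemma span_int_span: "finite G \<Longrightarrow> span (int_span G) = span G"
proof (rule antisym)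
  show "span (int_span G) \<subseteq> span G"
    by (rule span_minimal) (auto simp: int_span_def intro: span_sum span_scale span_base)
  assume G: "finite G"
  have "g \<in> int_span G" if "g \<in> G" for g
  proof -
    have "g = (\<Sum>b\<in>G. of_int (if b = g then 1 else 0) *\<^sub>R b)"
      using that G by (subst sum.mono_neutral_right[of G "{g}"]) auto
    then show ?thesis unfolding int_span_def
      by (intro CollectI exI[of _ "\<lambda>b. if b = g then 1 else 0"]) simp
  qed
  then show "span G \<subseteq> span (int_span G)" by (intro span_mono) auto
qed


subsection \<open>The normalised measure of a lattice\<close>

text \<open>The measure of \<open>hull_measure\<close> with its two choices, basis and base point,
  replaced by an explicit basis and the origin.\<close>

definition lat_measure :: "'a::euclidean_space set \<Rightarrow> 'a measure" where
  "lat_measure B = distr (PiM B (\<lambda>_. lborel :: real measure)) borel (\<lambda>y. \<Sum>b\<in>B. y b *\<^sub>R b)"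

lemma sets_lat_measure [simp, measurable_cong]: "sets (lat_measure B) = sets borel"
  by (simp add: lat_measure_def)

lemma space_lat_measure [simp]: "space (lat_measure B) = UNIV"
  by (simp add: lat_measure_def)

interpretation lb: product_sigma_finite "\<lambda>_. lborel :: real measure"
  by standard

lemma measurable_lat_coord [measurable]:
  fixes B :: "'a::euclidean_space set"
  shows "(\<lambda>y. \<Sum>b\<in>B. y b *\<^sub>R b) \<in> borel_measurable (PiM B (\<lambda>_. lborel :: real measure))"
proof -
  have "(\<lambda>y. y b) \<in> borel_measurable (PiM B (\<lambda>_. lborel :: real measure))" if "b \<in> B" for b
    using measurable_component_singleton[OF that, of "\<lambda>_. lborel :: real measure"] by simp
  then show ?thesis by (intro borel_measurable_sum borel_measurable_scaleR) auto
qed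

lemma nn_integral_lat_measure:
  assumes [measurable]: "f \<in> borel_measurable borel"
  shows "(\<integral>\<^sup>+x. f x \<partial>lat_measure B) = (\<integral>\<^sup>+y. f (\<Sum>b\<in>B. y b *\<^sub>R b) \<partial>PiM B (\<lambda>_. lborel))"
  unfolding lat_measure_def by (subst nn_integral_distr) auto

lemma PiM_lborel_translate:
  assumes "finite B"
  shows "distr (PiM B (\<lambda>_. lborel)) (PiM B (\<lambda>_. lborel)) (\<lambda>y. \<lambda>b\<in>B. c b + y b) = PiM B (\<lambda>_. lborel :: real measure)"
proof (rule lb.PiM_eqI[OF assms])
  fix A assume A: "\<And>i. i \<in> B \<Longrightarrow> A i \<in> sets (lborel :: real measure)"
  have "emeasure (distr (PiM B (\<lambda>_. lborel)) (PiM B (\<lambda>_. lborel)) (\<lambda>y. \<lambda>b\<in>B. c b + y b)) (Pi\<^sub>E B A)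
      = emeasure (PiM B (\<lambda>_. lborel :: real measure)) (PiE B (\<lambda>b. (+) (c b) -` A b))"
  proof (subst emeasure_distr)
    show "(\<lambda>y. \<lambda>b\<in>B. c b + y b) \<in> Pi\<^sub>M B (\<lambda>_. lborel) \<rightarrow>\<^sub>M Pi\<^sub>M B (\<lambda>_. lborel)"
      by measurable
    show "Pi\<^sub>E B A \<in> sets (Pi\<^sub>M B (\<lambda>_. lborel))" using A assms by (intro sets_PiM_I_finite) auto
    show "emeasure (Pi\<^sub>M B (\<lambda>_. lborel)) ((\<lambda>y. \<lambda>b\<in>B. c b + y b) -` Pi\<^sub>E B A \<inter> space (Pi\<^sub>M B (\<lambda>_. lborel))) =
      emeasure (Pi\<^sub>M B (\<lambda>_. lborel)) (\<Pi>\<^sub>E b\<in>B. (+) (c b) -` A b)"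
      by (rule arg_cong[where f = "emeasure _"]) (auto simp: space_PiM PiE_iff)
  qed
  also have "\<dots> = (\<Prod>b\<in>B. emeasure lborel ((+) (c b) -` A b))"
  proof (subst lb.emeasure_PiM[OF assms])
    fix i assume "i \<in> B"
    then have "A i \<in> sets borel" using A by simp
    then show "(+) (c i) -` A i \<in> sets lborel"
      using measurable_sets_borel[of "(+) (c i)" borel "A i"] by simp
  qed simp
  also have "\<dots> = (\<Prod>b\<in>B. emeasure lborel (A b))"
  proof (rule prod.cong)
    fix b assume "b \<in> B"
    then have "A b \<in> sets borel" using A by simp
    then show "emeasure lborel ((+) (c b) -` A b) = emeasure lborel (A b)"
      by (subst (2) lborel_distr_plus[of "c b", symmetric], subst emeasure_distr) auto
  qed simp
  finally show "emeasure (distr (PiM B (\<lambda>_. lborel)) (PiM B (\<lambda>_. lborel)) (\<lambda>y. \<lambda>b\<in>B. c b + y b)) (Pi\<^sub>E B A) =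
      (\<Prod>i\<in>B. emeasure lborel (A i))" .
qed simp

lemma nn_integral_lat_translate:
  assumes B: "independent B" and v: "v \<in> span B" and f[measurable]: "f \<in> borel_measurable borel"
  shows "(\<integral>\<^sup>+x. f (x + v) \<partial>lat_measure B) = (\<integral>\<^sup>+x. f x \<partial>lat_measure B)"
proof -
  have fin: "finite B" using B by (rule independent_imp_finite)
  define c where "c b = v \<bullet> dual_vec B b" for b
  have v: "v = (\<Sum>b\<in>B. c b *\<^sub>R b)" unfolding c_def using sum_dual_vec[OF B v] by simp
  have [measurable]: "(\<lambda>y. \<lambda>b\<in>B. c b + y b) \<in> Pi\<^sub>M B (\<lambda>_. lborel) \<rightarrow>\<^sub>M Pi\<^sub>M B (\<lambda>_. lborel)"
    by measurable
  have "(\<integral>\<^sup>+x. f x \<partial>lat_measure B) = (\<integral>\<^sup>+y. f (\<Sum>b\<in>B. y b *\<^sub>R b) \<partial>PiM B (\<lambda>_. lborel))"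
    by (rule nn_integral_lat_measure) measurable
  also have "\<dots> = (\<integral>\<^sup>+y. f (\<Sum>b\<in>B. (\<lambda>b\<in>B. c b + y b) b *\<^sub>R b) \<partial>PiM B (\<lambda>_. lborel))"
    by (subst PiM_lborel_translate[OF fin, of c, symmetric], subst nn_integral_distr) auto
  also have "\<dots> = (\<integral>\<^sup>+y. f ((\<Sum>b\<in>B. y b *\<^sub>R b) + v) \<partial>PiM B (\<lambda>_. lborel))"
    unfolding v by (simp add: sum.distrib[symmetric] scaleR_left_distrib add.commute)
  also have "\<dots> = (\<integral>\<^sup>+x. f (x + v) \<partial>lat_measure B)"
    by (rule nn_integral_lat_measure[symmetric]) measurable
  finally show ?thesis by simp
qed

section \<open>Fundamental domains and independence of the lattice basis\<close>

definition fund_box :: "'a::euclidean_space set \<Rightarrow> 'a set" where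
  "fund_box G = {x \<in> span G. \<forall>g\<in>G. 0 \<le> x \<bullet> dual_vec G g \<and> x \<bullet> dual_vec G g < 1}"

lemma fund_box_borel [measurable]:
  assumes "independent G"
  shows "fund_box G \<in> sets borel"
proof -
  have fin: "finite G" using assms by (rule independent_imp_finite)
  have [measurable]: "span G \<in> sets borel" by (simp add: closed_subspace borel_closed)
  have "fund_box G = span G \<inter> {x\<in>space borel. \<forall>g\<in>G. 0 \<le> x \<bullet> dual_vec G g \<and> x \<bullet> dual_vec G g < 1}"
    by (auto simp: fund_box_def)
  also have "\<dots> \<in> sets borel" using fin by measurable
  finally show ?thesis .
qed

lemma emeasure_fund_box:
  assumes G: "independent G"
  shows "emeasure (lat_measure G) (fund_box G) = 1"
proof -
  have fin: "finite G" using assms by (rule independent_imp_finite)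
  have "emeasure (lat_measure G) (fund_box G) =
    emeasure (PiM G (\<lambda>_. lborel :: real measure)) (PiE G (\<lambda>_. {0..<1}))"
    unfolding lat_measure_def
  proof (subst emeasure_distr)
    show "emeasure (Pi\<^sub>M G (\<lambda>_. lborel))
     ((\<lambda>y. \<Sum>b\<in>G. y b *\<^sub>R b) -` fund_box G \<inter> space (Pi\<^sub>M G (\<lambda>_. lborel))) =
      emeasure (Pi\<^sub>M G (\<lambda>_. lborel :: real measure)) (\<Pi>\<^sub>E _\<in>G. {0..<1})"
      by (rule arg_cong2[of _ _ _ _ emeasure, OF refl])
         (auto simp: space_PiM fund_box_def inner_dual_vec_sum[OF G] PiE_iff
           intro: span_sum span_scale span_base)
  qed (use fund_box_borel[OF G] in auto)
  also have "\<dots> = 1" by (subst lb.emeasure_PiM[OF fin]) auto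
  finally show ?thesis .
qed

text \<open>The lattice point consists of the integer parts of the coordinates; it is unique because
  the box is half-open.\<close>

lemma fund_box_partition:
  assumes G: "independent G" and x: "x \<in> span G"
  shows "\<exists>!\<gamma>. \<gamma> \<in> int_span G \<and> x - \<gamma> \<in> fund_box G"
proof (rule ex_ex1I)
  have fin: "finite G" using assms by (auto intro: independent_imp_finite)
  define \<gamma> where "\<gamma> = (\<Sum>g\<in>G. of_int \<lfloor>x \<bullet> dual_vec G g\<rfloor> *\<^sub>R g)"
  have "\<gamma> \<in> int_span G" unfolding int_span_def \<gamma>_def
    by (intro CollectI exI[of _ "\<lambda>g. \<lfloor>x \<bullet> dual_vec G g\<rfloor>"]) simp
  moreover have "x - \<gamma> \<in> fund_box G"
    using x \<open>\<gamma> \<in> int_span G\<close>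
    by (auto simp: fund_box_def inner_diff_left \<gamma>_def inner_dual_vec_sum[OF G] int_span_mem_iff[OF G] intro!: span_diff)
       linarith
  ultimately show "\<exists>\<gamma>. \<gamma> \<in> int_span G \<and> x - \<gamma> \<in> fund_box G" by blast
next
  fix \<gamma> \<delta> assume *: "\<gamma> \<in> int_span G \<and> x - \<gamma> \<in> fund_box G" "\<delta> \<in> int_span G \<and> x - \<delta> \<in> fund_box G"
  have "\<gamma> \<bullet> dual_vec G g = \<delta> \<bullet> dual_vec G g" if g: "g \<in> G" for g
  proof -
    have "\<gamma> \<bullet> dual_vec G g \<in> \<int>" "\<delta> \<bullet> dual_vec G g \<in> \<int>" using * g int_span_mem_iff[OF G] by auto
    then obtain m n where mn: "\<gamma> \<bullet> dual_vec G g = of_int m" "\<delta> \<bullet> dual_vec G g = of_int n"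
      by (auto elim!: Ints_cases)
    have "0 \<le> (x - \<gamma>) \<bullet> dual_vec G g \<and> (x - \<gamma>) \<bullet> dual_vec G g < 1"
      "0 \<le> (x - \<delta>) \<bullet> dual_vec G g \<and> (x - \<delta>) \<bullet> dual_vec G g < 1"
      using * g by (auto simp: fund_box_def)
    then have "\<bar>real_of_int m - real_of_int n\<bar> < 1" using mn by (simp add: inner_diff_left)
    then have "m = n" by linarith
    then show ?thesis using mn by simp
  qed
  moreover have "\<gamma> \<in> span G" "\<delta> \<in> span G" using * int_span_mem_iff[OF G] by auto
  ultimately show "\<gamma> = \<delta>" using sum_dual_vec[OF G, of \<gamma>] sum_dual_vec[OF G, of \<delta>]
    by (metis (no_types, lifting) sum.cong)
qed

text \<open>Cut \<open>P\<close> along the translates of \<open>Q\<close> and move each piece back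
  by its lattice vector: the moved pieces make up \<open>Q\<close>. Closure of \<Gamma> under
  negation lets both decompositions run over the same index set.\<close>

lemma emeasure_fundamental_domains:
  fixes \<Gamma> P Q :: "'a::euclidean_space set"
  assumes B: "independent B" and \<Gamma>: "countable \<Gamma>" "\<Gamma> \<subseteq> span B" "\<And>\<gamma>. \<gamma> \<in> \<Gamma> \<Longrightarrow> - \<gamma> \<in> \<Gamma>"
    and P: "P \<in> sets borel" "P \<subseteq> span B" "\<And>x. x \<in> span B \<Longrightarrow> \<exists>!\<gamma>. \<gamma> \<in> \<Gamma> \<and> x - \<gamma> \<in> P"
    and Q: "Q \<in> sets borel" "Q \<subseteq> span B" "\<And>x. x \<in> span B \<Longrightarrow> \<exists>!\<gamma>. \<gamma> \<in> \<Gamma> \<and> x - \<gamma> \<in> Q"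
  shows "emeasure (lat_measure B) P = emeasure (lat_measure B) Q"
proof -
  note [measurable] = P(1) Q(1)
  have m: "{x. x - \<gamma> \<in> S} \<in> sets borel" if "S \<in> sets borel" for S :: "'a set" and \<gamma>
  proof -
    note [measurable] = that
    have "{x \<in> space borel. x - \<gamma> \<in> S} \<in> sets borel" by measurable
    then show ?thesis by simp
  qed
  have split: "emeasure (lat_measure B) S = (\<integral>\<^sup>+\<gamma>. emeasure (lat_measure B) (S \<inter> {x. x - \<gamma> \<in> T}) \<partial>count_space \<Gamma>)"
    if S: "S \<in> sets borel" "S \<subseteq> span B"
      and T: "T \<in> sets borel" "\<And>x. x \<in> span B \<Longrightarrow> \<exists>!\<gamma>. \<gamma> \<in> \<Gamma> \<and> x - \<gamma> \<in> T" for S T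
  proof -
    have "S = (\<Union>\<gamma>\<in>\<Gamma>. S \<inter> {x. x - \<gamma> \<in> T})" using S(2) T(2) by blast
    then have "emeasure (lat_measure B) S = emeasure (lat_measure B) (\<Union>\<gamma>\<in>\<Gamma>. S \<inter> {x. x - \<gamma> \<in> T})" by simp
    also have "\<dots> = (\<integral>\<^sup>+\<gamma>. emeasure (lat_measure B) (S \<inter> {x. x - \<gamma> \<in> T}) \<partial>count_space \<Gamma>)"
    proof (rule emeasure_UN_countable[OF _ \<Gamma>(1)])
      show "disjoint_family_on (\<lambda>\<gamma>. S \<inter> {x. x - \<gamma> \<in> T}) \<Gamma>"
        using S(2) T(2) unfolding disjoint_family_on_def by blast
    qed (use S T m in auto)
    finally show ?thesis .
  qed
  have shift: "emeasure (lat_measure B) (P \<inter> {x. x - \<gamma> \<in> Q}) =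
      emeasure (lat_measure B) (Q \<inter> {x. x - (- \<gamma>) \<in> P})" if "\<gamma> \<in> \<Gamma>" for \<gamma>
  proof -
    have "emeasure (lat_measure B) (P \<inter> {x. x - \<gamma> \<in> Q}) = (\<integral>\<^sup>+x. indicator (P \<inter> {x. x - \<gamma> \<in> Q}) x \<partial>lat_measure B)"
      using m[OF Q(1)] P(1) by (subst nn_integral_indicator) auto
    also have "\<dots> = (\<integral>\<^sup>+x. indicator (P \<inter> {x. x - \<gamma> \<in> Q}) (x + \<gamma>) \<partial>lat_measure B)"
      using m[OF Q(1)] P(1) \<Gamma>(2) that by (subst nn_integral_lat_translate[OF B]) auto
    also have "\<dots> = (\<integral>\<^sup>+x. indicator (Q \<inter> {x. x - (- \<gamma>) \<in> P}) x \<partial>lat_measure B)"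
      by (rule nn_integral_cong) (auto simp: indicator_def)
    also have "\<dots> = emeasure (lat_measure B) (Q \<inter> {x. x - (- \<gamma>) \<in> P})"
      using m[OF P(1), of "- \<gamma>"] Q(1) by (subst nn_integral_indicator) auto
    finally show ?thesis .
  qed
  have bij: "bij_betw uminus \<Gamma> \<Gamma>"
    by (rule bij_betwI[of _ _ _ uminus]) (use \<Gamma>(3) in auto)
  have "emeasure (lat_measure B) P = (\<integral>\<^sup>+\<gamma>. emeasure (lat_measure B) (P \<inter> {x. x - \<gamma> \<in> Q}) \<partial>count_space \<Gamma>)"
    using P Q by (intro split)
  also have "\<dots> = (\<integral>\<^sup>+\<gamma>. emeasure (lat_measure B) (Q \<inter> {x. x - (- \<gamma>) \<in> P}) \<partial>count_space \<Gamma>)"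
    by (rule nn_integral_cong) (simp add: shift)
  also have "\<dots> = (\<integral>\<^sup>+\<gamma>. emeasure (lat_measure B) (Q \<inter> {x. x - \<gamma> \<in> P}) \<partial>count_space \<Gamma>)"
    by (rule nn_integral_bij_count_space[OF bij, of "\<lambda>\<gamma>. emeasure (lat_measure B) (Q \<inter> {x. x - \<gamma> \<in> P})"])
  also have "\<dots> = emeasure (lat_measure B) Q"
    using P Q by (intro split[symmetric])
  finally show ?thesis .
qed

text \<open>
  Uniqueness of invariant measures by Fubini: with \<open>P\<close> the fundamental box of \<open>G\<close>, translating in
  both variables turns \<open>m\<^sub>B(A) m\<^sub>G(P)\<close> into \<open>m\<^sub>G(A) m\<^sub>B(-P)\<close>, where
  \<open>m\<^sub>G(P) = m\<^sub>B(-P) = 1\<close> because all fundamental domains of a lattice have the same measure.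
\<close>

lemma lat_measure_eq:
  fixes B G :: "'a::euclidean_space set"
  assumes B: "independent B" and G: "independent G" and eq: "int_span B = int_span G"
  shows "lat_measure B = lat_measure G"
proof (rule measure_eqI)
  have finB: "finite B" and finG: "finite G" using B G independent_imp_finite by auto
  have sp: "span B = span G" using span_int_span[OF finB] span_int_span[OF finG] eq by simp
  let ?P = "fund_box G"
  have P[measurable]: "?P \<in> sets borel" using fund_box_borel[OF G] .
  have mP[measurable]: "uminus -` ?P \<in> sets borel" using measurable_sets_borel[of uminus borel ?P] by simp
  \<comment> \<open>The negated box appears because the two translations below leave the box of
    \<open>G\<close> evaluated at \<open>?g w - ?b z\<close>, to be integrated over
    \<open>z\<close>.\<close>
  have "emeasure (lat_measure B) (fund_box B) = emeasure (lat_measure B) (uminus -` ?P)"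
  proof (rule emeasure_fundamental_domains[OF B, of "int_span G"])
    show neg: "- \<gamma> \<in> int_span G" if "\<gamma> \<in> int_span G" for \<gamma>
      using that unfolding int_span_mem_iff[OF G] by (auto simp: span_neg)
    show "int_span G \<subseteq> span B" using int_span_mem_iff[OF G] sp by auto
    show "fund_box B \<in> sets borel" by (rule fund_box_borel[OF B])
    show "\<exists>!\<gamma>. \<gamma> \<in> int_span G \<and> x - \<gamma> \<in> fund_box B" if "x \<in> span B" for x
      using fund_box_partition[OF B that] eq by simp
    show "\<exists>!\<gamma>. \<gamma> \<in> int_span G \<and> x - \<gamma> \<in> uminus -` ?P" if x: "x \<in> span B" for x
    proof -
      have "- x \<in> span G" using x sp by (simp add: span_neg)
      then obtain \<gamma> where \<gamma>: "\<gamma> \<in> int_span G" "- x - \<gamma> \<in> ?P"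
        and un: "\<And>\<delta>. \<delta> \<in> int_span G \<Longrightarrow> - x - \<delta> \<in> ?P \<Longrightarrow> \<delta> = \<gamma>"
        using fund_box_partition[OF G, of "- x"] by blast
      show ?thesis
      proof (rule ex1I[of _ "- \<gamma>"])
        have "- x - \<gamma> = - (x - - \<gamma>)" by simp
        then show "- \<gamma> \<in> int_span G \<and> x - - \<gamma> \<in> uminus -` ?P" using \<gamma> neg by (simp only: vimage_eq)
        fix \<delta> assume \<delta>: "\<delta> \<in> int_span G \<and> x - \<delta> \<in> uminus -` ?P"
        have "- x - - \<delta> = - (x - \<delta>)" by simp
        then have "- \<delta> = \<gamma>" using \<delta> by (intro un) (simp_all only: neg vimage_eq)
        then show "\<delta> = - \<gamma>" by auto
      qed
    qed
    show "uminus -` ?P \<subseteq> span B" using sp by (auto simp: fund_box_def) (metis minus_minus span_neg)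
  qed (use mP countable_int_span[OF finG] in \<open>auto simp: fund_box_def\<close>)
  then have mB: "emeasure (lat_measure B) (uminus -` ?P) = 1" using emeasure_fund_box[OF B] by simp
  fix A assume "A \<in> sets (lat_measure B)"
  then have A[measurable]: "A \<in> sets borel" by simp
  let ?MB = "PiM B (\<lambda>_. lborel :: real measure)" and ?MG = "PiM G (\<lambda>_. lborel :: real measure)"
  let ?b = "\<lambda>z. \<Sum>b\<in>B. z b *\<^sub>R b" and ?g = "\<lambda>w. \<Sum>g\<in>G. w g *\<^sub>R g"
  interpret MB: finite_product_sigma_finite "\<lambda>_. lborel :: real measure" B by standard (rule finB)
  interpret MG: finite_product_sigma_finite "\<lambda>_. lborel :: real measure" G by standard (rule finG)
  interpret pair_sigma_finite ?MB ?MG ..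
  have gsp: "?g w \<in> span B" "?b z \<in> span G" for w z :: "'a \<Rightarrow> real"
  proof -
    have "?g w \<in> span G" "?b z \<in> span B" by (intro span_sum span_scale span_base; assumption)+
    then show "?g w \<in> span B" "?b z \<in> span G" using sp by auto
  qed
  have ind: "(indicator A x * indicator ?P y :: ennreal) = indicator (A \<times> ?P) (x, y)" for x y
    by (auto simp: indicator_def)
  have "emeasure (lat_measure B) A = emeasure (lat_measure B) A * emeasure (lat_measure G) ?P"
    by (simp add: emeasure_fund_box[OF G])
  also have "\<dots> = (\<integral>\<^sup>+y. emeasure (lat_measure B) A * indicator ?P y \<partial>lat_measure G)"
    by (subst nn_integral_cmult_indicator) auto
  also have "\<dots> = (\<integral>\<^sup>+w. emeasure (lat_measure B) A * indicator ?P (?g w) \<partial>?MG)"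
    by (rule nn_integral_lat_measure) measurable
  also have "\<dots> = (\<integral>\<^sup>+w. (\<integral>\<^sup>+z. indicator A (?b z + ?g w) * indicator ?P (?g w) \<partial>?MB) \<partial>?MG)"
  proof (rule nn_integral_cong)
    fix w :: "'a \<Rightarrow> real"
    have "emeasure (lat_measure B) A = (\<integral>\<^sup>+x. indicator A x \<partial>lat_measure B)" by simp
    also have "\<dots> = (\<integral>\<^sup>+x. indicator A (x + ?g w) \<partial>lat_measure B)"
      by (rule nn_integral_lat_translate[OF B gsp(1), symmetric]) measurable
    also have "\<dots> = (\<integral>\<^sup>+z. indicator A (?b z + ?g w) \<partial>?MB)"
      by (rule nn_integral_lat_measure) measurable
    finally show "emeasure (lat_measure B) A * indicator ?P (?g w) =
      (\<integral>\<^sup>+z. indicator A (?b z + ?g w) * indicator ?P (?g w) \<partial>?MB)"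
      by (subst nn_integral_multc) auto
  qed
  also have "\<dots> = (\<integral>\<^sup>+z. (\<integral>\<^sup>+w. indicator A (?b z + ?g w) * indicator ?P (?g w) \<partial>?MG) \<partial>?MB)"
    by (rule Fubini') measurable
  also have "\<dots> = (\<integral>\<^sup>+z. (\<integral>\<^sup>+w. indicator A (?g w) * indicator ?P (?g w - ?b z) \<partial>?MG) \<partial>?MB)"
  proof (rule nn_integral_cong)
    fix z :: "'a \<Rightarrow> real"
    have "(\<integral>\<^sup>+w. indicator A (?b z + ?g w) * indicator ?P (?g w) \<partial>?MG) =
      (\<integral>\<^sup>+y. indicator A (?b z + y) * indicator ?P y \<partial>lat_measure G)"
      by (rule nn_integral_lat_measure[symmetric]) measurable
    also have "\<dots> = (\<integral>\<^sup>+y. indicator A y * indicator ?P (y - ?b z) \<partial>lat_measure G)"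
      by (subst nn_integral_lat_translate[OF G gsp(2)[of z], symmetric]) (simp_all add: add.commute)
    also have "\<dots> = (\<integral>\<^sup>+w. indicator A (?g w) * indicator ?P (?g w - ?b z) \<partial>?MG)"
      by (rule nn_integral_lat_measure) measurable
    finally show "(\<integral>\<^sup>+w. indicator A (?b z + ?g w) * indicator ?P (?g w) \<partial>?MG) =
      (\<integral>\<^sup>+w. indicator A (?g w) * indicator ?P (?g w - ?b z) \<partial>?MG)" .
  qed
  also have "\<dots> = (\<integral>\<^sup>+w. (\<integral>\<^sup>+z. indicator A (?g w) * indicator ?P (?g w - ?b z) \<partial>?MB) \<partial>?MG)"
    by (rule Fubini'[symmetric]) measurable
  also have "\<dots> = (\<integral>\<^sup>+w. indicator A (?g w) \<partial>?MG)"
  proof (rule nn_integral_cong)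
    fix w :: "'a \<Rightarrow> real"
    have "(\<integral>\<^sup>+z. indicator ?P (?g w - ?b z) \<partial>?MB) = (\<integral>\<^sup>+x. (indicator ?P (?g w - x) :: ennreal) \<partial>lat_measure B)"
      by (rule nn_integral_lat_measure[symmetric]) measurable
    also have "\<dots> = (\<integral>\<^sup>+x. indicator ?P (?g w - (x + ?g w)) \<partial>lat_measure B)"
      by (rule nn_integral_lat_translate[OF B gsp(1), symmetric]) measurable
    also have "\<dots> = (\<integral>\<^sup>+x. indicator (uminus -` ?P) x \<partial>lat_measure B)"
      by (rule nn_integral_cong) (auto simp: indicator_def)
    also have "\<dots> = 1" using mB mP by (simp add: nn_integral_indicator)
    finally show "(\<integral>\<^sup>+z. indicator A (?g w) * indicator ?P (?g w - ?b z) \<partial>?MB) = indicator A (?g w)"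
      by (subst nn_integral_cmult) auto
  qed
  also have "\<dots> = (\<integral>\<^sup>+x. indicator A x \<partial>lat_measure G)"
    by (rule nn_integral_lat_measure[symmetric]) measurable
  finally show "emeasure (lat_measure B) A = emeasure (lat_measure G) A" by simp
qed simp

text \<open>Independence of the basis disposes of the chosen basis, and translation invariance of
  the chosen base point, which lies in \<open>span G\<close>.\<close>

lemma hull_measure_cone:
  fixes G :: "'a::euclidean_space set"
  assumes G: "independent G" and \<Lambda>: "span G \<inter> \<Lambda> = int_span G"
  shows "hull_measure \<Lambda> (convex_cone hull G) = lat_measure G"
proof -
  let ?C = "convex_cone hull G"
  define B where "B = (SOME B. integral_basis (Lin ?C \<inter> \<Lambda>) B)"
  define s where "s = (SOME s. s \<in> ?C)"
  have "integral_basis (Lin ?C \<inter> \<Lambda>) G"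
    using G \<Lambda> by (simp add: integral_basis_def Lin_convex_cone_hull independent_imp_finite)
  then have "integral_basis (Lin ?C \<inter> \<Lambda>) B" unfolding B_def by (rule someI)
  then have B: "independent B" "int_span B = int_span G"
    using \<Lambda> by (auto simp: integral_basis_def Lin_convex_cone_hull)
  have "s \<in> ?C" unfolding s_def by (rule someI[of _ 0]) (rule convex_cone_hull_contains_0)
  then have s: "s \<in> span G" using simplicial_cone_iff[OF G] by auto
  have "hull_measure \<Lambda> ?C = distr (PiM B (\<lambda>_. lborel :: real measure)) borel (\<lambda>y. s + (\<Sum>b\<in>B. y b *\<^sub>R b))"
    by (simp add: hull_measure_def B_def s_def Let_def)
  also have "\<dots> = distr (lat_measure B) borel (\<lambda>x. x + s)"
    unfolding lat_measure_def by (subst distr_distr) (auto simp: o_def add.commute)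
  also have "\<dots> = distr (lat_measure G) borel (\<lambda>x. x + s)"
    by (simp add: lat_measure_eq[OF B(1) G B(2)])
  also have "\<dots> = lat_measure G"
  proof (rule measure_eqI)
    fix A assume "A \<in> sets (distr (lat_measure G) borel (\<lambda>x. x + s))"
    then have [measurable]: "A \<in> sets borel" by simp
    have "emeasure (distr (lat_measure G) borel (\<lambda>x. x + s)) A = (\<integral>\<^sup>+x. indicator A (x + s) \<partial>lat_measure G)"
      by (subst nn_integral_distr[symmetric, where M' = borel]) auto
    also have "\<dots> = (\<integral>\<^sup>+x. indicator A x \<partial>lat_measure G)"
      by (rule nn_integral_lat_translate[OF G s]) measurable
    finally show "emeasure (distr (lat_measure G) borel (\<lambda>x. x + s)) A = emeasure (lat_measure G) A" by simp
  qed simp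
  finally show ?thesis .
qed


subsection \<open>Exponential integrals over simplicial cones\<close>

text \<open>For \<open>z \<ge> 0\<close> the integrand is at least 1 on a half-line of infinite
  length. Recording this value too makes it possible to characterise integrability over a
  cone.\<close>

lemma nn_integral_exp_half_line:
  fixes z :: real
  shows "(\<integral>\<^sup>+t. ennreal (exp (t * z)) * indicator {0..} t \<partial>lborel) = (if z < 0 then ennreal (- 1 / z) else \<infinity>)"
proof (cases "z < 0")
  case True
  have "(\<integral>\<^sup>+t. ennreal (exp (t * z)) * indicator {0..} t \<partial>lborel) = ennreal (0 - exp (0 * z) / z)"
  proof (rule nn_integral_FTC_atLeast)
    show "((\<lambda>t. exp (t * z) / z) has_real_derivative exp (t * z)) (at t)" for t
      using True by (auto intro!: derivative_eq_intros)
    have "filterlim (\<lambda>t. t * z) at_bot at_top"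
      using True by (intro filterlim_tendsto_neg_mult_at_bot[OF tendsto_const _ filterlim_ident, of z, simplified mult.commute[of z]])
        (auto simp: mult.commute)
    then have "((\<lambda>t. exp (t * z)) \<longlongrightarrow> 0) at_top"
      by (rule filterlim_compose[OF exp_at_bot])
    then show "((\<lambda>t. exp (t * z) / z) \<longlongrightarrow> 0) at_top"
      by (rule tendsto_divide_zero)
  qed auto
  then show ?thesis using True by simp
next
  case False
  have "\<infinity> = emeasure lborel {0::real..}"
  proof -
    have "ennreal r \<le> emeasure lborel {0::real..}" for r
    proof (cases "r \<ge> 0")
      case True
      then have "ennreal r = emeasure lborel {0..r}" by simp
      also have "\<dots> \<le> emeasure lborel {0::real..}" by (rule emeasure_mono) auto
      finally show ?thesis .
    qed (simp add: ennreal_neg)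
    then have le: "ennreal r \<le> emeasure lborel {0::real..}" for r .
    show ?thesis
    proof (cases "emeasure lborel {0::real..}")
      case (real r)
      then show ?thesis using le[of "r + 1"] by (simp add: ennreal_le_iff)
    qed simp
  qed
  also have "\<dots> = (\<integral>\<^sup>+t. indicator {0::real..} t \<partial>lborel)" by simp
  also have "\<dots> \<le> (\<integral>\<^sup>+t. ennreal (exp (t * z)) * indicator {0..} t \<partial>lborel)"
    using False by (intro nn_integral_mono) (auto simp: indicator_def)
  finally show ?thesis using False by (simp add: top_unique)
qed

text \<open>In the coordinates of \<open>G\<close> the cone is the nonnegative orthant and the
  exponential is a product, so the integral splits into half-line integrals.\<close>

lemma nn_integral_exp_cone:
  assumes G: "independent G"
  shows "(\<integral>\<^sup>+x. ennreal (exp (\<xi> \<bullet> x)) * indicator (convex_cone hull G) x \<partial>lat_measure G) =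
    (\<Prod>g\<in>G. if \<xi> \<bullet> g < 0 then ennreal (- 1 / (\<xi> \<bullet> g)) else \<infinity>)"
proof -
  have fin: "finite G" using G by (rule independent_imp_finite)
  have [measurable]: "convex_cone hull G \<in> sets borel" by (simp add: closed_simplicial_cone[OF G] borel_closed)
  have "(\<integral>\<^sup>+x. ennreal (exp (\<xi> \<bullet> x)) * indicator (convex_cone hull G) x \<partial>lat_measure G) =
     (\<integral>\<^sup>+y. ennreal (exp (\<xi> \<bullet> (\<Sum>b\<in>G. y b *\<^sub>R b))) * indicator (convex_cone hull G) (\<Sum>b\<in>G. y b *\<^sub>R b)
        \<partial>PiM G (\<lambda>_. lborel))"
    by (rule nn_integral_lat_measure) measurable
  also have "\<dots> = (\<integral>\<^sup>+y. (\<Prod>g\<in>G. ennreal (exp (y g * (\<xi> \<bullet> g))) * indicator {0..} (y g)) \<partial>PiM G (\<lambda>_. lborel))"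
  proof (rule nn_integral_cong)
    fix y :: "'a \<Rightarrow> real"
    have "indicator (convex_cone hull G) (\<Sum>b\<in>G. y b *\<^sub>R b) = (if \<forall>g\<in>G. 0 \<le> y g then 1 else (0::ennreal))"
      unfolding indicator_def simplicial_cone_iff[OF G]
      by (auto simp: inner_dual_vec_sum[OF G] intro: span_sum span_scale span_base)
    also have "\<dots> = (\<Prod>g\<in>G. indicator {0..} (y g))"
      using fin by (auto simp: prod_zero_iff indicator_def intro!: prod.neutral[symmetric])
    moreover have "ennreal (exp (\<xi> \<bullet> (\<Sum>b\<in>G. y b *\<^sub>R b))) = (\<Prod>g\<in>G. ennreal (exp (y g * (\<xi> \<bullet> g))))"
      by (simp add: inner_sum_right exp_sum[OF fin] prod_ennreal)
    ultimately show "ennreal (exp (\<xi> \<bullet> (\<Sum>b\<in>G. y b *\<^sub>R b))) * indicator (convex_cone hull G) (\<Sum>b\<in>G. y b *\<^sub>R b) =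
      (\<Prod>g\<in>G. ennreal (exp (y g * (\<xi> \<bullet> g))) * indicator {0..} (y g))" by (simp add: prod.distrib)
  qed
  also have "\<dots> = (\<Prod>g\<in>G. \<integral>\<^sup>+t. ennreal (exp (t * (\<xi> \<bullet> g))) * indicator {0..} t \<partial>lborel)"
    by (rule lb.product_nn_integral_prod[OF fin]) measurable
  finally show ?thesis by (simp only: nn_integral_exp_half_line)
qed

text \<open>\<open>is_exp_integral\<close> prescribes the value wherever the integral converges,
  hence the exact domain of convergence is determined along with the value.\<close>

lemma exp_integral_cone:
  fixes G :: "'a::euclidean_space set"
  assumes G: "independent G"
  defines "C \<equiv> convex_cone hull G"
  shows set_integrable_exp_cone:
      "set_integrable (lat_measure G) C (\<lambda>x. exp (\<xi> \<bullet> x)) \<longleftrightarrow> (\<forall>g\<in>G. \<xi> \<bullet> g < 0)"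
    and set_integral_exp_cone:
      "(\<forall>g\<in>G. \<xi> \<bullet> g < 0) \<Longrightarrow> (LINT x:C|lat_measure G. exp (\<xi> \<bullet> x)) = (\<Prod>g\<in>G. - 1 / (\<xi> \<bullet> g))"
proof -
  have fin: "finite G" using G by (rule independent_imp_finite)
  have [measurable]: "C \<in> sets borel" unfolding C_def by (simp add: closed_simplicial_cone[OF G] borel_closed)
  have nn: "(\<integral>\<^sup>+x. ennreal (indicator C x *\<^sub>R exp (\<xi> \<bullet> x)) \<partial>lat_measure G) =
      (\<Prod>g\<in>G. if \<xi> \<bullet> g < 0 then ennreal (- 1 / (\<xi> \<bullet> g)) else \<infinity>)"
    unfolding nn_integral_exp_cone[OF G, symmetric]
    by (rule nn_integral_cong) (auto simp: C_def indicator_def)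
  have meas: "(\<lambda>x. indicator C x *\<^sub>R exp (\<xi> \<bullet> x)) \<in> borel_measurable (lat_measure G)" by measurable
  have pos: "(\<Prod>g\<in>G. if \<xi> \<bullet> g < 0 then ennreal (- 1 / (\<xi> \<bullet> g)) else \<infinity>) = ennreal (\<Prod>g\<in>G. - 1 / (\<xi> \<bullet> g))"
    if "\<forall>g\<in>G. \<xi> \<bullet> g < 0"
  proof -
    have "(\<Prod>g\<in>G. if \<xi> \<bullet> g < 0 then ennreal (- 1 / (\<xi> \<bullet> g)) else \<infinity>) = (\<Prod>g\<in>G. ennreal (- 1 / (\<xi> \<bullet> g)))"
      using that by (intro prod.cong) auto
    also have "\<dots> = ennreal (\<Prod>g\<in>G. - 1 / (\<xi> \<bullet> g))"
      using that by (intro prod_ennreal) (auto simp: divide_nonneg_neg less_imp_le intro!: divide_nonpos_neg)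
    finally show ?thesis .
  qed
  have pos': "0 \<le> (\<Prod>g\<in>G. - 1 / (\<xi> \<bullet> g))" if "\<forall>g\<in>G. \<xi> \<bullet> g < 0"
    using that by (intro prod_nonneg) (auto intro!: divide_nonpos_neg)
  have hb: "has_bochner_integral (lat_measure G) (\<lambda>x. indicator C x *\<^sub>R exp (\<xi> \<bullet> x)) (\<Prod>g\<in>G. - 1 / (\<xi> \<bullet> g))"
    if "\<forall>g\<in>G. \<xi> \<bullet> g < 0"
    using nn pos[OF that] by (intro has_bochner_integral_nn_integral[OF meas _ pos'[OF that]]) auto
  \<comment> \<open>In \<open>ennreal\<close> zero times infinity is zero, so the remaining factors
    have to be nonzero.\<close>
  have inf: "(\<Prod>g\<in>G. if \<xi> \<bullet> g < 0 then ennreal (- 1 / (\<xi> \<bullet> g)) else \<infinity>) = \<infinity>" if neg: "\<not> (\<forall>g\<in>G. \<xi> \<bullet> g < 0)"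
  proof -
    obtain g where g: "g \<in> G" "\<not> \<xi> \<bullet> g < 0" using neg by blast
    have "(\<Prod>g\<in>G - {g}. if \<xi> \<bullet> g < 0 then ennreal (- 1 / (\<xi> \<bullet> g)) else \<infinity>) \<noteq> 0"
      using fin by (auto simp: prod_zero_iff ennreal_eq_0_iff divide_less_0_iff not_le zero_less_divide_iff)
    then show ?thesis using g fin by (simp add: prod.remove[of G g] ennreal_top_mult)
  qed
  show "set_integrable (lat_measure G) C (\<lambda>x. exp (\<xi> \<bullet> x)) \<longleftrightarrow> (\<forall>g\<in>G. \<xi> \<bullet> g < 0)"
  proof
    assume "set_integrable (lat_measure G) C (\<lambda>x. exp (\<xi> \<bullet> x))"
    then have "(\<integral>\<^sup>+x. norm (indicator C x *\<^sub>R exp (\<xi> \<bullet> x)) \<partial>lat_measure G) < \<infinity>"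
      unfolding set_integrable_def integrable_iff_bounded by simp
    then have "(\<integral>\<^sup>+x. ennreal (indicator C x *\<^sub>R exp (\<xi> \<bullet> x)) \<partial>lat_measure G) < \<infinity>" by simp
    then show "\<forall>g\<in>G. \<xi> \<bullet> g < 0" using nn inf by (metis less_irrefl)
  qed (use hb in \<open>auto simp: set_integrable_def has_bochner_integral_iff\<close>)
  show "(LINT x:C|lat_measure G. exp (\<xi> \<bullet> x)) = (\<Prod>g\<in>G. - 1 / (\<xi> \<bullet> g))" if "\<forall>g\<in>G. \<xi> \<bullet> g < 0"
    using hb[OF that] by (simp add: set_lebesgue_integral_def has_bochner_integral_iff)
qed


subsection \<open>Multivariate power series\<close>

lemma eventually_near0: "eventually P (near0 W) \<longleftrightarrow> (\<exists>e>0. \<forall>x\<in>W. norm x < e \<longrightarrow> P x)"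
  unfolding near0_def eventually_inf_principal eventually_nhds_metric by (auto simp: dist_norm)

lemma near0_small:
  assumes "finite B" "r > 0"
  shows "\<forall>\<^sub>F \<xi> in near0 W. \<forall>b\<in>B. \<bar>\<xi> \<bullet> b\<bar> < r"
proof -
  have "\<forall>\<^sub>F \<xi> in nhds 0. \<bar>\<xi> \<bullet> b\<bar> < r" for b :: 'a
  proof -
    have "((\<lambda>\<xi>. \<bar>\<xi> \<bullet> b\<bar>) \<longlongrightarrow> \<bar>0 \<bullet> b\<bar>) (nhds 0)" by (intro tendsto_intros) (simp add: filterlim_ident)
    then show ?thesis using assms(2) by (intro order_tendstoD(2)) auto
  qed
  then have "\<forall>\<^sub>F \<xi> in nhds 0. \<forall>b\<in>B. \<bar>\<xi> \<bullet> b\<bar> < r" using assms(1) by (simp add: eventually_ball_finite)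
  then show ?thesis unfolding near0_def by (simp add: eventually_inf_principal eventually_mono)
qed

lemma has_sum_times:
  fixes f :: "'b \<Rightarrow> real" and g :: "'c \<Rightarrow> real"
  assumes f: "(f has_sum a) A" and g: "(g has_sum b) B"
  shows "((\<lambda>(x, y). f x * g y) has_sum a * b) (A \<times> B)"
proof (rule has_sum_SigmaI)
  have sf: "(\<lambda>x. norm (f x)) summable_on A" and sg: "(\<lambda>y. norm (g y)) summable_on B"
    by (rule summable_on_iff_abs_summable_on_real[THEN iffD1, OF has_sum_imp_summable[OF f]],
        rule summable_on_iff_abs_summable_on_real[THEN iffD1, OF has_sum_imp_summable[OF g]])
  show "((\<lambda>y. case (x, y) of (x, y) \<Rightarrow> f x * g y) has_sum f x * b) B" for x
    using has_sum_cmult_right[OF g, of "f x"] by simp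
  show "((\<lambda>x. f x * b) has_sum a * b) A" by (rule has_sum_cmult_left[OF f])
  have "(\<lambda>p. norm ((\<lambda>(x, y). f x * g y) p)) summable_on A \<times> B"
    using sf sg
    by (subst Infinite_Sum.abs_summable_on_Sigma_iff[where f = "\<lambda>(x, y). f x * g y"]) (auto simp: abs_mult infsum_cmult_right' intro!: summable_on_cmult_right summable_on_cmult_left)
  then show "(\<lambda>(x, y). f x * g y) summable_on A \<times> B"
    by (rule abs_summable_summable)
qed

lemma has_sum_prod_multi_indices:
  fixes f :: "'b \<Rightarrow> nat \<Rightarrow> real"
  assumes "finite B" "\<And>b. b \<in> B \<Longrightarrow> (f b has_sum s b) UNIV"
  shows "((\<lambda>\<alpha>. \<Prod>b\<in>B. f b (\<alpha> b)) has_sum (\<Prod>b\<in>B. s b)) (multi_indices B)"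
  using assms
proof (induction B)
  case empty
  have "multi_indices {} = {\<lambda>_::'b. 0}" by (auto simp: multi_indices_def)
  then show ?case by (simp add: has_sum_finite_iff)
next
  case (insert b B)
  have "((\<lambda>(n, \<alpha>). f b n * (\<Prod>c\<in>B. f c (\<alpha> c))) has_sum s b * (\<Prod>c\<in>B. s c)) (UNIV \<times> multi_indices B)"
    by (rule has_sum_times) (use insert in auto)
  also have "?this \<longleftrightarrow> ((\<lambda>\<alpha>. \<Prod>c\<in>insert b B. f c (\<alpha> c)) has_sum (\<Prod>c\<in>insert b B. s c)) (multi_indices (insert b B))"
  proof (rule has_sum_reindex_bij_witness[where i = "\<lambda>\<alpha>. (\<alpha> b, \<alpha>(b := 0))" and j = "\<lambda>(n, \<alpha>). \<alpha>(b := n)"])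
    fix a :: "nat \<times> ('b \<Rightarrow> nat)" assume a: "a \<in> UNIV \<times> multi_indices B"
    then show "(((\<lambda>(n, \<alpha>). \<alpha>(b := n)) a) b, ((\<lambda>(n, \<alpha>). \<alpha>(b := n)) a)(b := 0)) = a"
      using insert.hyps by (auto simp: multi_indices_def fun_eq_iff)
    show "(\<lambda>(n, \<alpha>). \<alpha>(b := n)) a \<in> multi_indices (insert b B)"
      using a by (auto simp: multi_indices_def)
    have "(\<Prod>c\<in>B. f c (if c = b then fst a else snd a c)) = (\<Prod>c\<in>B. f c (snd a c))"
      by (rule prod.cong) (use insert.hyps in auto)
    then show "(\<Prod>c\<in>insert b B. f c ((\<lambda>(n, \<alpha>). \<alpha>(b := n)) a c)) = (\<lambda>(n, \<alpha>). f b n * (\<Prod>c\<in>B. f c (\<alpha> c))) a"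
      using insert.hyps by (simp add: case_prod_unfold fun_upd_def)
  qed (use insert.hyps in \<open>auto simp: multi_indices_def\<close>)
  finally show ?case .
qed

lemma has_taylor_prod:
  fixes B :: "'a::euclidean_space set"
  assumes "finite B" "r > 0"
    and "\<And>b z. b \<in> B \<Longrightarrow> \<bar>z\<bar> < r \<Longrightarrow> ((\<lambda>n. a b n * z ^ n) has_sum \<phi> b z) UNIV"
  shows "has_taylor B (\<lambda>\<alpha>. \<Prod>b\<in>B. a b (\<alpha> b)) (\<lambda>\<xi>. \<Prod>b\<in>B. \<phi> b (\<xi> \<bullet> b))"
  unfolding has_taylor_def
proof (rule eventually_mono[OF near0_small[OF assms(1,2)]])
  fix \<xi> :: 'a assume "\<forall>b\<in>B. \<bar>\<xi> \<bullet> b\<bar> < r"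
  then have "((\<lambda>\<alpha>. \<Prod>b\<in>B. a b (\<alpha> b) * (\<xi> \<bullet> b) ^ \<alpha> b) has_sum (\<Prod>b\<in>B. \<phi> b (\<xi> \<bullet> b))) (multi_indices B)"
    using assms by (intro has_sum_prod_multi_indices) auto
  then show "((\<lambda>\<alpha>. (\<Prod>b\<in>B. a b (\<alpha> b)) * (\<Prod>b\<in>B. (\<xi> \<bullet> b) ^ \<alpha> b)) has_sum (\<Prod>b\<in>B. \<phi> b (\<xi> \<bullet> b))) (multi_indices B)"
    by (simp add: prod.distrib)
qed

definition deg_indices :: "'b set \<Rightarrow> nat \<Rightarrow> ('b \<Rightarrow> nat) set" where
  "deg_indices B k = {\<alpha> \<in> multi_indices B. sum \<alpha> B = k}"

lemma finite_deg_indices: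
  assumes "finite B"
  shows "finite (deg_indices B k)"
proof -
  have "deg_indices B k \<subseteq> {\<alpha>. \<forall>x. (x \<in> B \<longrightarrow> \<alpha> x \<in> {..k}) \<and> (x \<notin> B \<longrightarrow> \<alpha> x = 0)}"
    using assms member_le_sum[of _ B] by (force simp: deg_indices_def multi_indices_def)
  then show ?thesis
    by (rule finite_subset) (intro finite_set_of_finite_funs assms finite_atMost)
qed

definition taylor_part :: "'a::euclidean_space set \<Rightarrow> (('a \<Rightarrow> nat) \<Rightarrow> real) \<Rightarrow> nat \<Rightarrow> 'a \<Rightarrow> real" where
  "taylor_part B c k \<xi> = (\<Sum>\<alpha>\<in>deg_indices B k. c \<alpha> * (\<Prod>b\<in>B. (\<xi> \<bullet> b) ^ \<alpha> b))"

text \<open>\<open>has_sum\<close> is unconditional summation, so the terms may be grouped by total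
  degree, each group being finite.\<close>

lemma has_taylor_sums:
  assumes "finite B" "has_taylor B c f"
  shows "\<forall>\<^sub>F \<xi> in near0 (span B). (\<lambda>k. taylor_part B c k \<xi>) sums f \<xi>"
  using assms(2) unfolding has_taylor_def
proof (rule eventually_mono)
  fix \<xi> assume *: "((\<lambda>\<alpha>. c \<alpha> * (\<Prod>b\<in>B. (\<xi> \<bullet> b) ^ \<alpha> b)) has_sum f \<xi>) (multi_indices B)"
  have bij: "bij_betw snd (Sigma UNIV (deg_indices B)) (multi_indices B)"
    by (rule bij_betwI[of _ _ _ "\<lambda>\<alpha>. (sum \<alpha> B, \<alpha>)"]) (auto simp: deg_indices_def)
  have "((\<lambda>p. c (snd p) * (\<Prod>b\<in>B. (\<xi> \<bullet> b) ^ snd p b)) has_sum f \<xi>) (Sigma UNIV (deg_indices B))"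
    using * by (subst has_sum_reindex_bij_betw[OF bij, of "\<lambda>\<alpha>. c \<alpha> * (\<Prod>b\<in>B. (\<xi> \<bullet> b) ^ \<alpha> b)"])
  then have "((\<lambda>k. taylor_part B c k \<xi>) has_sum f \<xi>) UNIV"
    by (rule has_sum_SigmaD) (use finite_deg_indices[OF assms(1)] in \<open>auto simp: taylor_part_def intro!: has_sum_finite\<close>)
  then show "(\<lambda>k. taylor_part B c k \<xi>) sums f \<xi>" by (rule has_sum_imp_sums)
qed

lemma taylor_part_scale: "taylor_part B c k (t *\<^sub>R \<xi>) = t ^ k * taylor_part B c k \<xi>"
proof -
  have "(\<Prod>b\<in>B. (t *\<^sub>R \<xi> \<bullet> b) ^ \<alpha> b) = t ^ k * (\<Prod>b\<in>B. (\<xi> \<bullet> b) ^ \<alpha> b)" if "\<alpha> \<in> deg_indices B k" for \<alpha>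
    using that by (auto simp: power_mult_distrib prod.distrib deg_indices_def power_sum[symmetric])
  then show ?thesis unfolding taylor_part_def sum_distrib_left by (intro sum.cong) auto
qed

text \<open>The part of degree \<open>k\<close> scales by \<open>t ^ k\<close>, so the parts at
  \<xi> are the coefficients of the restriction to the line through \<xi>.\<close>

lemma has_taylor_line:
  assumes "finite B" "has_taylor B c f" "\<xi> \<in> span B"
  shows "(\<lambda>t. f (t *\<^sub>R \<xi>)) has_fps_expansion Abs_fps (\<lambda>k. taylor_part B c k \<xi>)"
proof (rule has_fps_expansionI)
  obtain e where e: "e > 0" "\<And>x. x \<in> span B \<Longrightarrow> norm x < e \<Longrightarrow> (\<lambda>k. taylor_part B c k x) sums f x"
    using has_taylor_sums[OF assms(1,2)] unfolding eventually_near0 by blast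
  have "((\<lambda>t. norm (t *\<^sub>R \<xi>)) \<longlongrightarrow> norm (0 *\<^sub>R \<xi>)) (nhds 0)"
    by (intro tendsto_intros) (simp add: filterlim_ident)
  then have "\<forall>\<^sub>F t in nhds 0. norm (t *\<^sub>R \<xi>) < e" using e(1) by (intro order_tendstoD(2)) auto
  then show "\<forall>\<^sub>F t in nhds 0. (\<lambda>n. fps_nth (Abs_fps (\<lambda>k. taylor_part B c k \<xi>)) n * t ^ n) sums f (t *\<^sub>R \<xi>)"
    by (rule eventually_mono)
       (use e(2) assms(3) in \<open>simp add: span_scale taylor_part_scale[symmetric] mult.commute\<close>)
qed


subsection \<open>Functions that are polynomial along lines\<close>

text \<open>A coordinate-free substitute for multivariate polynomials: stable under ring operations
  and under pullback along projections, and strong enough to cancel nonzero factors.\<close>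

definition poly_on_lines :: "'a::euclidean_space set \<Rightarrow> ('a \<Rightarrow> real) \<Rightarrow> bool" where
  "poly_on_lines W g \<longleftrightarrow> (\<forall>\<eta>\<in>W. \<forall>\<xi>\<in>W. \<exists>p. \<forall>s. g (\<eta> + s *\<^sub>R \<xi>) = poly p s)"

lemma poly_on_lines_const [simp]: "poly_on_lines W (\<lambda>_. c)"
  unfolding poly_on_lines_def by (intro ballI exI[of _ "[:c:]"]) simp

lemma poly_on_lines_inner [simp]: "poly_on_lines W (\<lambda>\<xi>. \<xi> \<bullet> v)"
  unfolding poly_on_lines_def
proof (intro ballI)
  fix \<eta> \<xi> :: 'a
  show "\<exists>p. \<forall>s. (\<eta> + s *\<^sub>R \<xi>) \<bullet> v = poly p s"
    by (intro exI[of _ "[:\<eta> \<bullet> v, \<xi> \<bullet> v:]"]) (simp add: inner_simps)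
qed

lemma poly_on_lines_add [intro]:
  assumes "poly_on_lines W f" "poly_on_lines W g"
  shows "poly_on_lines W (\<lambda>\<xi>. f \<xi> + g \<xi>)"
  unfolding poly_on_lines_def
proof (intro ballI)
  fix \<eta> \<xi> assume "\<eta> \<in> W" "\<xi> \<in> W"
  then obtain p q where "\<forall>s. f (\<eta> + s *\<^sub>R \<xi>) = poly p s" "\<forall>s. g (\<eta> + s *\<^sub>R \<xi>) = poly q s"
    using assms unfolding poly_on_lines_def by blast
  then show "\<exists>p. \<forall>s. f (\<eta> + s *\<^sub>R \<xi>) + g (\<eta> + s *\<^sub>R \<xi>) = poly p s"
    by (intro exI[of _ "p + q"]) simp
qed

lemma poly_on_lines_mult [intro]:
  assumes "poly_on_lines W f" "poly_on_lines W g"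
  shows "poly_on_lines W (\<lambda>\<xi>. f \<xi> * g \<xi>)"
  unfolding poly_on_lines_def
proof (intro ballI)
  fix \<eta> \<xi> assume "\<eta> \<in> W" "\<xi> \<in> W"
  then obtain p q where "\<forall>s. f (\<eta> + s *\<^sub>R \<xi>) = poly p s" "\<forall>s. g (\<eta> + s *\<^sub>R \<xi>) = poly q s"
    using assms unfolding poly_on_lines_def by blast
  then show "\<exists>p. \<forall>s. f (\<eta> + s *\<^sub>R \<xi>) * g (\<eta> + s *\<^sub>R \<xi>) = poly p s"
    by (intro exI[of _ "p * q"]) simp
qed

lemma poly_on_lines_uminus [intro]: "poly_on_lines W f \<Longrightarrow> poly_on_lines W (\<lambda>\<xi>. - f \<xi>)"
  using poly_on_lines_mult[of W "\<lambda>_. -1" f] by simp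

lemma poly_on_lines_diff [intro]:
  "poly_on_lines W f \<Longrightarrow> poly_on_lines W g \<Longrightarrow> poly_on_lines W (\<lambda>\<xi>. f \<xi> - g \<xi>)"
  using poly_on_lines_add[of W f "\<lambda>\<xi>. - g \<xi>"] by auto

lemma poly_on_lines_sum [intro]:
  "(\<And>i. i \<in> A \<Longrightarrow> poly_on_lines W (f i)) \<Longrightarrow> poly_on_lines W (\<lambda>\<xi>. \<Sum>i\<in>A. f i \<xi>)"
  by (induction A rule: infinite_finite_induct) auto

lemma poly_on_lines_prod [intro]:
  "(\<And>i. i \<in> A \<Longrightarrow> poly_on_lines W (f i)) \<Longrightarrow> poly_on_lines W (\<lambda>\<xi>. \<Prod>i\<in>A. f i \<xi>)"
  by (induction A rule: infinite_finite_induct) auto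

lemma poly_on_lines_power [intro]: "poly_on_lines W f \<Longrightarrow> poly_on_lines W (\<lambda>\<xi>. f \<xi> ^ n)"
  by (induction n) auto

lemma poly_on_lines_prod_list [intro]: "poly_on_lines W (\<lambda>\<xi>. \<Prod>v\<leftarrow>vs. \<xi> \<bullet> v)"
  by (induction vs) auto

lemma poly_on_lines_proj:
  assumes W: "subspace W" and f: "poly_on_lines W f"
  shows "poly_on_lines X (\<lambda>\<xi>. f (proj W \<xi>))"
  unfolding poly_on_lines_def
proof (intro ballI)
  fix \<eta> \<xi>
  obtain p where "\<forall>s. f (proj W \<eta> + s *\<^sub>R proj W \<xi>) = poly p s"
    using f proj_in[OF W] unfolding poly_on_lines_def by blast
  moreover have "proj W (\<eta> + s *\<^sub>R \<xi>) = proj W \<eta> + s *\<^sub>R proj W \<xi>" for s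
    using linear_proj[OF W] by (simp add: linear_add linear_cmul)
  ultimately show "\<exists>p. \<forall>s. f (proj W (\<eta> + s *\<^sub>R \<xi>)) = poly p s" by auto
qed

text \<open>On the line from \<xi> to \<xi>0 both functions are real polynomials in one variable
  with product zero. The one of \<open>a\<close> is nonzero at \<xi>0, so the one of
  \<open>b\<close> is the zero polynomial.\<close>

lemma poly_on_lines_zero_product:
  assumes W: "subspace W" and a: "poly_on_lines W a" and b: "poly_on_lines W b"
    and \<xi>0: "\<xi>0 \<in> W" "a \<xi>0 \<noteq> 0" and ab: "\<And>\<xi>. \<xi> \<in> W \<Longrightarrow> a \<xi> * b \<xi> = 0" and \<xi>: "\<xi> \<in> W"
  shows "b \<xi> = 0"
proof -
  have d: "\<xi>0 - \<xi> \<in> W" using W \<xi>0 \<xi> by (simp add: subspace_diff)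
  obtain p where p: "\<And>s. a (\<xi> + s *\<^sub>R (\<xi>0 - \<xi>)) = poly p s" using a \<xi> d unfolding poly_on_lines_def by blast
  obtain q where q: "\<And>s. b (\<xi> + s *\<^sub>R (\<xi>0 - \<xi>)) = poly q s" using b \<xi> d unfolding poly_on_lines_def by blast
  have "poly (p * q) s = 0" for s
    using ab[of "\<xi> + s *\<^sub>R (\<xi>0 - \<xi>)"] W \<xi> d by (simp add: p q subspace_add subspace_scale)
  then have "p * q = 0" using poly_all_0_iff_0 by blast
  moreover have "p \<noteq> 0" using p[of 1] \<xi>0(2) by auto
  ultimately have "q = 0" by simp
  then show ?thesis using q[of 0] by simp
qed


subsection \<open>Expansions of germs along lines\<close>

text \<open>Links expansions with \<open>homogeneous_part\<close>, which is defined by derivatives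
  at 0.\<close>

lemma fps_nth_eq_deriv:
  fixes f :: "real \<Rightarrow> real"
  assumes "f has_fps_expansion F"
  shows "(deriv ^^ k) f 0 = fact k * fps_nth F k"
  using assms
proof (induction k arbitrary: f F)
  case 0
  then show ?case
    by (auto simp: has_fps_expansion_def eval_fps_at_0 dest: eventually_nhds_x_imp_x)
next
  case (Suc k)
  from Suc.IH[OF has_fps_expansion_deriv[OF Suc.prems]]
  show ?case by (simp add: funpow_swap1 algebra_simps)
qed

lemma fps_expansion_unique:
  fixes f :: "real \<Rightarrow> real"
  assumes "f has_fps_expansion F" "g has_fps_expansion G" "\<forall>\<^sub>F t in nhds 0. f t = g t"
  shows "F = G"
proof -
  have "f has_fps_expansion G"
    using assms(2,3) unfolding has_fps_expansion_def by (auto elim: eventually_elim2)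
  then show ?thesis
    using fps_nth_eq_deriv[OF assms(1)] fps_nth_eq_deriv[of f G] by (simp add: fps_eq_iff)
qed

text \<open>
  Expanding germs only along lines through the origin avoids re-expansion at other points: the
  identity theorem reduces to the ring of power series in one variable, and the coefficients, as
  functions of the direction, are polynomial along lines.
\<close>

definition line_expansion :: "'a::euclidean_space set \<Rightarrow> ('a \<Rightarrow> real) \<Rightarrow> ('a \<Rightarrow> real fps) \<Rightarrow> bool" where
  "line_expansion W f F \<longleftrightarrow>
     (\<forall>\<xi>\<in>W. (\<lambda>t. f (t *\<^sub>R \<xi>)) has_fps_expansion F \<xi>) \<and> (\<forall>k. poly_on_lines W (\<lambda>\<xi>. fps_nth (F \<xi>) k))"

lemma line_expansion_homogeneous_part:
  "line_expansion W f F \<Longrightarrow> \<xi> \<in> W \<Longrightarrow> homogeneous_part k f \<xi> = fps_nth (F \<xi>) k"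
  unfolding homogeneous_part_def line_expansion_def by (auto dest!: fps_nth_eq_deriv[of _ _ k])

lemma line_expansion_mult:
  assumes "line_expansion W f F" "line_expansion W g G"
  shows "line_expansion W (\<lambda>\<xi>. f \<xi> * g \<xi>) (\<lambda>\<xi>. F \<xi> * G \<xi>)"
  using assms unfolding line_expansion_def
  by (auto intro!: has_fps_expansion_mult simp: fps_mult_nth poly_on_lines_sum poly_on_lines_mult)

lemma line_expansion_sum:
  assumes "\<And>i. i \<in> A \<Longrightarrow> line_expansion W (f i) (F i)"
  shows "line_expansion W (\<lambda>\<xi>. \<Sum>i\<in>A. f i \<xi>) (\<lambda>\<xi>. \<Sum>i\<in>A. F i \<xi>)"
  using assms unfolding line_expansion_def
  by (auto intro!: has_fps_expansion_sum simp: fps_sum_nth poly_on_lines_sum)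

lemma line_expansion_diff:
  assumes "line_expansion W f F" "line_expansion W g G"
  shows "line_expansion W (\<lambda>\<xi>. f \<xi> - g \<xi>) (\<lambda>\<xi>. F \<xi> - G \<xi>)"
  using assms unfolding line_expansion_def
  by (auto intro!: has_fps_expansion_diff simp: poly_on_lines_diff)

lemma line_expansion_proj:
  assumes W: "subspace W" and f: "line_expansion W f F"
  shows "line_expansion X (\<lambda>\<xi>. f (proj W \<xi>)) (\<lambda>\<xi>. F (proj W \<xi>))"
proof -
  have "f (proj W (t *\<^sub>R \<xi>)) = f (t *\<^sub>R proj W \<xi>)" for t \<xi>
    by (simp add: linear_cmul[OF linear_proj[OF W]])
  moreover have "poly_on_lines X (\<lambda>\<xi>. fps_nth (F (proj W \<xi>)) k)" for k
    using f by (intro poly_on_lines_proj[OF W, of "\<lambda>\<xi>. fps_nth (F \<xi>) k"]) (simp add: line_expansion_def)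
  ultimately show ?thesis using f proj_in[OF W] unfolding line_expansion_def by auto
qed

lemma line_expansion_prod_linear:
  assumes "finite K"
  shows "line_expansion W (\<lambda>\<xi>. \<Prod>e\<in>K. - (\<xi> \<bullet> e)) (\<lambda>\<xi>. fps_const (\<Prod>e\<in>K. - (\<xi> \<bullet> e)) * fps_X ^ card K)"
  unfolding line_expansion_def
proof (intro conjI allI ballI)
  fix \<xi>
  have "(\<lambda>t. \<Prod>e\<in>K. - (t *\<^sub>R \<xi> \<bullet> e)) = (\<lambda>t. (\<Prod>e\<in>K. - (\<xi> \<bullet> e)) * t ^ card K)"
    using prod.distrib[of "\<lambda>e. - (\<xi> \<bullet> e)" "\<lambda>_. t" K for t] by (simp add: fun_eq_iff mult.commute)
  moreover have "\<dots> has_fps_expansion fps_const (\<Prod>e\<in>K. - (\<xi> \<bullet> e)) * fps_X ^ card K"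
    by (intro fps_expansion_intros)
  ultimately show "(\<lambda>t. \<Prod>e\<in>K. - (t *\<^sub>R \<xi> \<bullet> e)) has_fps_expansion fps_const (\<Prod>e\<in>K. - (\<xi> \<bullet> e)) * fps_X ^ card K"
    by simp
next
  fix k
  show "poly_on_lines W (\<lambda>\<xi>. fps_nth (fps_const (\<Prod>e\<in>K. - (\<xi> \<bullet> e)) * fps_X ^ card K) k)"
    by (cases "k = card K") (simp_all add: poly_on_lines_prod poly_on_lines_uminus)
qed

lemma has_taylor_line_expansion:
  assumes "finite B" "has_taylor B c f"
  shows "line_expansion (span B) f (\<lambda>\<xi>. Abs_fps (\<lambda>k. taylor_part B c k \<xi>))"
  unfolding line_expansion_def
proof (intro conjI ballI allI)
  show "poly_on_lines (span B) (\<lambda>\<xi>. fps_nth (Abs_fps (\<lambda>k. taylor_part B c k \<xi>)) k)" for k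
    unfolding taylor_part_def fps_nth_Abs_fps
    by (intro poly_on_lines_sum poly_on_lines_mult poly_on_lines_prod poly_on_lines_power
        poly_on_lines_const poly_on_lines_inner)
qed (rule has_taylor_line[OF assms])

text \<open>If all Taylor parts vanished on \<open>W\<close>, the germ would be zero near the
  origin.\<close>

lemma nonzero_germ_line_expansion:
  assumes "nonzero_germ W g"
  shows "\<exists>G \<xi>. line_expansion W g G \<and> \<xi> \<in> W \<and> G \<xi> \<noteq> 0"
proof -
  obtain B c where B: "independent B" "span B = W" "has_taylor B c g"
    using assms unfolding nonzero_germ_def analytic_at0_def by blast
  have fin: "finite B" using B(1) by (rule independent_imp_finite)
  have "\<exists>\<xi>\<in>W. \<exists>k. taylor_part B c k \<xi> \<noteq> 0"
  proof (rule ccontr)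
    assume "\<not> ?thesis"
    then have zero: "taylor_part B c k \<xi> = 0" if "\<xi> \<in> W" for k \<xi> using that by blast
    obtain e where e: "e > 0" "\<And>x. x \<in> W \<Longrightarrow> norm x < e \<Longrightarrow> (\<lambda>k. taylor_part B c k x) sums g x"
      using has_taylor_sums[OF fin B(3)] B(2) unfolding eventually_near0 by blast
    have "g x = 0" if "x \<in> W" "norm x < e" for x
      using e(2)[OF that] zero[OF that(1)] sums_unique2[OF _ sums_zero] by simp
    then have "\<forall>\<^sub>F \<xi> in near0 W. g \<xi> = 0" unfolding eventually_near0 using e(1) by blast
    then show False using assms unfolding nonzero_germ_def by simp
  qed
  then show ?thesis
    using has_taylor_line_expansion[OF fin B(3)] B(2) by (force simp: fps_eq_iff)
qed

text \<open>Every line through the origin stays near 0 for small parameters, and an expansion is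
  determined by the values there.\<close>

lemma line_expansion_mult_eq_0:
  assumes W: "subspace W" and g: "line_expansion W g G" and h: "line_expansion W h H"
    and gh: "\<forall>\<^sub>F \<xi> in near0 W. g \<xi> * h \<xi> = 0" and \<xi>: "\<xi> \<in> W"
  shows "G \<xi> * H \<xi> = 0"
proof (rule fps_expansion_unique)
  show "(\<lambda>t. g (t *\<^sub>R \<xi>) * h (t *\<^sub>R \<xi>)) has_fps_expansion G \<xi> * H \<xi>"
    using line_expansion_mult[OF g h] \<xi> unfolding line_expansion_def by auto
  obtain e where e: "e > 0" "\<And>x. x \<in> W \<Longrightarrow> norm x < e \<Longrightarrow> g x * h x = 0"
    using gh unfolding eventually_near0 by blast
  have "((\<lambda>t. norm (t *\<^sub>R \<xi>)) \<longlongrightarrow> norm (0 *\<^sub>R \<xi>)) (nhds 0)"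
    by (intro tendsto_intros) (simp add: filterlim_ident)
  then have "\<forall>\<^sub>F t in nhds 0. norm (t *\<^sub>R \<xi>) < e" using e(1) by (intro order_tendstoD(2)) auto
  then show "\<forall>\<^sub>F t in nhds 0. g (t *\<^sub>R \<xi>) * h (t *\<^sub>R \<xi>) = 0"
    by (rule eventually_mono) (use e(2) \<xi> W in \<open>auto simp: subspace_scale\<close>)
qed auto

text \<open>In each direction one of the two power series is zero, so any coefficient of
  \<open>G\<close> times any coefficient of \<open>H\<close> vanishes identically; cancelling one
  coefficient of \<open>G\<close> that is nonzero somewhere kills all those of
  \<open>H\<close>.\<close>

lemma poly_on_lines_fps_zero_product:
  assumes W: "subspace W" and G: "\<And>k. poly_on_lines W (\<lambda>\<xi>. fps_nth (G \<xi>) k)"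
    and H: "\<And>k. poly_on_lines W (\<lambda>\<xi>. fps_nth (H \<xi>) k)"
    and nz: "\<xi>0 \<in> W" "G \<xi>0 \<noteq> 0" and GH: "\<And>\<xi>. \<xi> \<in> W \<Longrightarrow> G \<xi> * H \<xi> = (0 :: real fps)" and \<xi>: "\<xi> \<in> W"
  shows "H \<xi> = 0"
proof -
  obtain k where k: "fps_nth (G \<xi>0) k \<noteq> 0" using nz(2) by (auto simp: fps_eq_iff)
  have "fps_nth (H \<xi>) j = 0" for j
  proof (rule poly_on_lines_zero_product[OF W _ _ nz(1) _ _ \<xi>])
    show "poly_on_lines W (\<lambda>\<xi>. fps_nth (G \<xi>) k)" "poly_on_lines W (\<lambda>\<xi>. fps_nth (H \<xi>) j)"
      by (rule G, rule H)
    show "fps_nth (G \<xi>0) k \<noteq> 0" by (rule k)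
    show "fps_nth (G \<xi>) k * fps_nth (H \<xi>) j = 0" if "\<xi> \<in> W" for \<xi> using GH[OF that] by auto
  qed
  then show ?thesis by (simp add: fps_eq_iff)
qed


subsection \<open>The Todd function\<close>

text \<open>The generating function of the Bernoulli numbers, completed at its removable
  singularity. Dividing it by \<open>- z\<close> gives the sum of the geometric series in
  \<open>exp z\<close>, see \<open>todd_eq\<close>.\<close>

definition todd :: "real \<Rightarrow> real" where
  "todd z = (if z = 0 then 1 else z / (exp z - 1))"

definition todd_coeff :: "nat \<Rightarrow> real" where
  "todd_coeff n = bernoulli_b n / fact n"

text \<open>Numerator and denominator both start in degree 1, so the formal quotient expands the
  actual one; inside the radius of convergence the series converges absolutely, as
  \<open>has_sum\<close> demands.\<close>

lemma todd_has_sum: "\<exists>r>0. \<forall>z. \<bar>z\<bar> < r \<longrightarrow> ((\<lambda>n. todd_coeff n * z ^ n) has_sum todd z) UNIV"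
proof -
  let ?F = "fps_X / (fps_exp 1 - 1) :: real fps"
  have sd: "subdegree (fps_exp 1 - 1 :: real fps) = 1"
    by (rule subdegreeI) auto
  have nz: "fps_exp 1 - 1 \<noteq> (0 :: real fps)" using sd by auto
  have "(\<lambda>x. if x = 0 then (1::real) else x / (exp x - 1)) has_fps_expansion ?F"
    using nz sd by (intro has_fps_expansion_divide fps_expansion_intros has_fps_expansion_exp1) auto
  then have F: "fps_conv_radius ?F > 0" "\<forall>\<^sub>F z in nhds 0. eval_fps ?F z = todd z"
    unfolding has_fps_expansion_def todd_def by auto
  obtain d where d: "d > 0" "\<And>z. \<bar>z\<bar> < d \<Longrightarrow> eval_fps ?F z = todd z"
    using F(2) unfolding eventually_nhds_metric by (auto simp: dist_real_def)
  obtain r where r: "r > 0" "ereal r \<le> fps_conv_radius ?F"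
    using F(1) by (metis ereal_dense2 less_ereal.simps(1) less_imp_le zero_ereal_def)
  show ?thesis
  proof (intro exI[of _ "min r d"] conjI allI impI)
    show "0 < min r d" using r d by auto
    fix z :: real assume z: "\<bar>z\<bar> < min r d"
    have zr: "norm z < fps_conv_radius ?F" using z by (intro less_le_trans[OF _ r(2)]) simp
    have c: "todd_coeff n = fps_nth ?F n" for n by (simp add: todd_coeff_def bernoulli_b_def)
    have "(\<lambda>n. todd_coeff n * z ^ n) sums todd z"
      using summable_sums[OF summable_fps[OF zr]] d(2)[of z] z by (simp add: c eval_fps_def)
    then show "((\<lambda>n. todd_coeff n * z ^ n) has_sum todd z) UNIV"
      using norm_summable_fps[OF zr] by (intro norm_summable_imp_has_sum) (auto simp: c)
  qed
qed

lemma todd_coeff_0: "todd_coeff 0 = 1"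
proof -
  obtain r where "r > 0" "\<And>z. \<bar>z\<bar> < r \<Longrightarrow> ((\<lambda>n. todd_coeff n * z ^ n) has_sum todd z) UNIV"
    using todd_has_sum by blast
  then have "(\<lambda>n. todd_coeff n * 0 ^ n) sums todd 0" by (intro has_sum_imp_sums) auto
  then show ?thesis by (simp add: powser_sums_zero_iff todd_def)
qed


subsection \<open>Directional derivatives of smooth functions on a subspace\<close>

text \<open>Lines with direction in \<open>X\<close> through points of \<open>X\<close> stay in
  \<open>X\<close>, so differentiability within the subspace suffices.\<close>

lemma dir_deriv_has_derivative:
  assumes X: "subspace X" and f: "(f has_derivative f') (at x within X)" and x: "x \<in> X" "v \<in> X"
  shows "((\<lambda>t. f (x + t *\<^sub>R v)) has_real_derivative f' v) (at 0)" "dir_deriv v f x = f' v"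
proof -
  have "((\<lambda>t. x + t *\<^sub>R v) has_derivative (\<lambda>t. t *\<^sub>R v)) (at 0)"
    by (auto intro!: derivative_eq_intros)
  moreover have "(f has_derivative f') (at (x + 0 *\<^sub>R v) within (\<lambda>t. x + t *\<^sub>R v) ` UNIV)"
    using f by (auto intro!: has_derivative_subset[OF f] subspace_add[OF X] subspace_scale[OF X] x)
  ultimately have "((\<lambda>t. f (x + t *\<^sub>R v)) has_derivative (\<lambda>t. f' (t *\<^sub>R v))) (at 0)"
    by (rule has_derivative_in_compose)
  then show *: "((\<lambda>t. f (x + t *\<^sub>R v)) has_real_derivative f' v) (at 0)"
    using has_derivative_bounded_linear[OF f]
    by (simp add: has_field_derivative_def bounded_linear.linear linear_cmul mult_commute_abs)
  show "dir_deriv v f x = f' v" unfolding dir_deriv_def by (rule DERIV_imp_deriv[OF *])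
qed

lemma dir_deriv_along:
  assumes X: "subspace X" and f: "f differentiable_on X" and x: "x \<in> X" "v \<in> X"
  shows "((\<lambda>t. f (x + t *\<^sub>R v)) has_real_derivative dir_deriv v f (x + t *\<^sub>R v)) (at t)"
proof -
  have xt: "x + t *\<^sub>R v \<in> X" using X x by (simp add: subspace_add subspace_scale)
  then obtain f' where "(f has_derivative f') (at (x + t *\<^sub>R v) within X)"
    using f by (auto simp: differentiable_on_def differentiable_def)
  from dir_deriv_has_derivative[OF X this xt x(2)]
  have "((\<lambda>s. f (x + t *\<^sub>R v + s *\<^sub>R v)) has_real_derivative dir_deriv v f (x + t *\<^sub>R v)) (at 0)"
    by simp
  from DERIV_shift[of "\<lambda>s. f (x + s *\<^sub>R v)" "dir_deriv v f (x + t *\<^sub>R v)" 0 t] this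
  show ?thesis by (simp add: algebra_simps)
qed

lemma dir_deriv_along0:
  assumes X: "subspace X" and f: "f differentiable_on X" and x: "x \<in> X" "v \<in> X"
  shows "((\<lambda>t. f (x + t *\<^sub>R v)) has_real_derivative dir_deriv v f x) (at 0)"
  using dir_deriv_along[OF assms, of 0] by simp

lemma dir_deriv_sum_direction:
  assumes X: "subspace X" and f: "f differentiable_on X" and x: "x \<in> X" "B \<subseteq> X"
  shows "dir_deriv (\<Sum>b\<in>B. c b *\<^sub>R b) f x = (\<Sum>b\<in>B. c b * dir_deriv b f x)"
proof -
  obtain f' where f': "(f has_derivative f') (at x within X)"
    using f x by (auto simp: differentiable_on_def differentiable_def)
  have lin: "linear f'" using has_derivative_bounded_linear[OF f'] by (rule bounded_linear.linear)
  have "(\<Sum>b\<in>B. c b *\<^sub>R b) \<in> X" using X x by (auto intro!: subspace_sum subspace_scale)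
  then show ?thesis
    using x(2) dir_deriv_has_derivative(2)[OF X f' x(1)]
    by (auto simp: linear_sum[OF lin] linear_cmul[OF lin] intro!: sum.cong)
qed

lemma dir_deriv_sum:
  assumes X: "subspace X" and f: "\<And>i. i \<in> A \<Longrightarrow> g i differentiable_on X" and x: "x \<in> X" "v \<in> X"
  shows "dir_deriv v (\<lambda>x. \<Sum>i\<in>A. c i * g i x) x = (\<Sum>i\<in>A. c i * dir_deriv v (g i) x)"
  unfolding dir_deriv_def[of v "\<lambda>x. \<Sum>i\<in>A. c i * g i x"]
  by (rule DERIV_imp_deriv)
     (auto intro!: DERIV_sum DERIV_cmult dir_deriv_along0[OF X] f x)

lemma dir_deriv_cong:
  assumes "subspace X" "\<And>y. y \<in> X \<Longrightarrow> f y = g y" "x \<in> X" "v \<in> X"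
  shows "dir_deriv v f x = dir_deriv v g x"
  unfolding dir_deriv_def using assms by (simp add: subspace_add subspace_scale)

section \<open>Iterated derivatives and their independence of the order\<close>

lemma iter_deriv_Nil [simp]: "iter_deriv [] f = f"
  by (simp add: iter_deriv_def)

lemma iter_deriv_Cons [simp]: "iter_deriv (v # vs) f = dir_deriv v (iter_deriv vs f)"
  by (simp add: iter_deriv_def)

lemma iter_deriv_append: "iter_deriv (us @ vs) f = iter_deriv us (iter_deriv vs f)"
  by (simp add: iter_deriv_def)

lemma smooth_iter_deriv: "smooth X f \<Longrightarrow> set vs \<subseteq> X \<Longrightarrow> smooth X (iter_deriv vs f)"
  unfolding smooth_def iter_deriv_append[symmetric] by auto

lemma smooth_differentiable: "smooth X f \<Longrightarrow> f differentiable_on X"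
  unfolding smooth_def by (metis empty_set empty_subsetI iter_deriv_Nil)

lemma smooth_dir_deriv: "smooth X f \<Longrightarrow> v \<in> X \<Longrightarrow> smooth X (dir_deriv v f)"
  using smooth_iter_deriv[of X f "[v]"] by simp

text \<open>The mean value theorem is applied along \<open>u\<close> and then, to the derivative so
  obtained, along \<open>v\<close>. What matters is that the second difference on the left is
  symmetric in \<open>u\<close> and \<open>v\<close>.\<close>

lemma second_difference:
  assumes X: "subspace X" and f: "smooth X f" and x: "x \<in> X" "u \<in> X" "v \<in> X" and h: "h > 0"
  shows "\<exists>s t. 0 < s \<and> s < h \<and> 0 < t \<and> t < h \<and>
    f (x + h *\<^sub>R u + h *\<^sub>R v) - f (x + h *\<^sub>R u) - f (x + h *\<^sub>R v) + f x =
    h\<^sup>2 * dir_deriv v (dir_deriv u f) (x + s *\<^sub>R u + t *\<^sub>R v)"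
proof -
  have fd: "f differentiable_on X" using f by (rule smooth_differentiable)
  have fud: "dir_deriv u f differentiable_on X"
    using f x by (intro smooth_differentiable smooth_dir_deriv)
  have mem: "x + s *\<^sub>R u \<in> X" "x + t *\<^sub>R v \<in> X" for s t
    using x X by (auto simp: subspace_add subspace_scale)
  define g where "g = (\<lambda>s. f ((x + h *\<^sub>R v) + s *\<^sub>R u) - f (x + s *\<^sub>R u))"
  have "(g has_real_derivative dir_deriv u f ((x + h *\<^sub>R v) + s *\<^sub>R u) - dir_deriv u f (x + s *\<^sub>R u)) (at s)" for s
    unfolding g_def by (intro DERIV_diff dir_deriv_along[OF X fd] mem x)
  then obtain s where s: "0 < s" "s < h"
    "g h - g 0 = (h - 0) * (dir_deriv u f ((x + h *\<^sub>R v) + s *\<^sub>R u) - dir_deriv u f (x + s *\<^sub>R u))"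
    using MVT2[OF h, of g "\<lambda>s. dir_deriv u f ((x + h *\<^sub>R v) + s *\<^sub>R u) - dir_deriv u f (x + s *\<^sub>R u)"]
    by blast
  define k where "k = (\<lambda>t. dir_deriv u f ((x + s *\<^sub>R u) + t *\<^sub>R v))"
  have "(k has_real_derivative dir_deriv v (dir_deriv u f) ((x + s *\<^sub>R u) + t *\<^sub>R v)) (at t)" for t
    unfolding k_def by (intro dir_deriv_along[OF X fud] mem x)
  then obtain t where t: "0 < t" "t < h"
    "k h - k 0 = (h - 0) * dir_deriv v (dir_deriv u f) ((x + s *\<^sub>R u) + t *\<^sub>R v)"
    using MVT2[OF h, of k "\<lambda>t. dir_deriv v (dir_deriv u f) ((x + s *\<^sub>R u) + t *\<^sub>R v)"] by blast
  have "f (x + h *\<^sub>R u + h *\<^sub>R v) - f (x + h *\<^sub>R u) - f (x + h *\<^sub>R v) + f x = g h - g 0"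
    by (simp add: g_def add_ac)
  also have "\<dots> = h * (k h - k 0)" using s(3) by (simp add: k_def add_ac)
  also have "\<dots> = h\<^sup>2 * dir_deriv v (dir_deriv u f) (x + s *\<^sub>R u + t *\<^sub>R v)"
    using t(3) by (simp add: power2_eq_square)
  finally show ?thesis using s t by blast
qed

text \<open>The same second difference yields both mixed derivatives at points tending to
  \<open>x\<close>, where they are continuous.\<close>

lemma dir_deriv_commute:
  assumes X: "subspace X" and f: "smooth X f" and x: "x \<in> X" "u \<in> X" "v \<in> X"
  shows "dir_deriv u (dir_deriv v f) x = dir_deriv v (dir_deriv u f) x"
proof -
  define h where "h n = inverse (real (Suc n))" for n
  have h: "h n > 0" for n by (simp add: h_def)
  have h0: "h \<longlonglongrightarrow> 0" unfolding h_def by (rule LIMSEQ_inverse_real_of_nat)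
  have cont: "continuous_on X (dir_deriv b (dir_deriv a f))" if "a \<in> X" "b \<in> X" for a b
    using f that by (intro differentiable_imp_continuous_on smooth_differentiable smooth_dir_deriv)
  have lim: "(\<lambda>n. dir_deriv b (dir_deriv a f) (x + s n *\<^sub>R a + t n *\<^sub>R b))
      \<longlonglongrightarrow> dir_deriv b (dir_deriv a f) x"
    if ab: "a \<in> X" "b \<in> X" and st: "\<And>n. 0 < s n \<and> s n < h n \<and> 0 < t n \<and> t n < h n" for a b s t
  proof -
    have "s \<longlonglongrightarrow> 0" "t \<longlonglongrightarrow> 0"
      using st by (auto intro!: tendsto_sandwich[OF _ _ tendsto_const h0] always_eventually less_imp_le)
    then have "(\<lambda>n. x + s n *\<^sub>R a + t n *\<^sub>R b) \<longlonglongrightarrow> x + 0 *\<^sub>R a + 0 *\<^sub>R b"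
      by (intro tendsto_intros)
    then show ?thesis
      using continuous_on_tendsto_compose[OF cont[OF ab], of "\<lambda>n. x + s n *\<^sub>R a + t n *\<^sub>R b" x] x ab X
      by (auto simp: subspace_add subspace_scale)
  qed
  obtain s t where st: "\<And>n. 0 < s n \<and> s n < h n \<and> 0 < t n \<and> t n < h n \<and>
    f (x + h n *\<^sub>R u + h n *\<^sub>R v) - f (x + h n *\<^sub>R u) - f (x + h n *\<^sub>R v) + f x =
    (h n)\<^sup>2 * dir_deriv v (dir_deriv u f) (x + s n *\<^sub>R u + t n *\<^sub>R v)"
    using second_difference[OF X f x h] by metis
  obtain s' t' where st': "\<And>n. 0 < s' n \<and> s' n < h n \<and> 0 < t' n \<and> t' n < h n \<and>
    f (x + h n *\<^sub>R v + h n *\<^sub>R u) - f (x + h n *\<^sub>R v) - f (x + h n *\<^sub>R u) + f x =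
    (h n)\<^sup>2 * dir_deriv u (dir_deriv v f) (x + s' n *\<^sub>R v + t' n *\<^sub>R u)"
    using second_difference[OF X f x(1,3,2) h] by metis
  have "dir_deriv v (dir_deriv u f) (x + s n *\<^sub>R u + t n *\<^sub>R v) =
        dir_deriv u (dir_deriv v f) (x + s' n *\<^sub>R v + t' n *\<^sub>R u)" for n
  proof -
    have "(h n)\<^sup>2 * dir_deriv v (dir_deriv u f) (x + s n *\<^sub>R u + t n *\<^sub>R v) =
        (h n)\<^sup>2 * dir_deriv u (dir_deriv v f) (x + s' n *\<^sub>R v + t' n *\<^sub>R u)"
    proof -
      have e: "x + h n *\<^sub>R v + h n *\<^sub>R u = x + h n *\<^sub>R u + h n *\<^sub>R v" by (simp add: add_ac)
      from conjunct2[OF conjunct2[OF conjunct2[OF conjunct2[OF st[of n]]]]]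
        conjunct2[OF conjunct2[OF conjunct2[OF conjunct2[OF st'[of n]]]], unfolded e]
      show ?thesis by linarith
    qed
    then show ?thesis using h[of n] by simp
  qed
  then show ?thesis
    using lim[of u v s t] lim[of v u s' t'] st st' x LIMSEQ_unique by auto
qed

lemma iter_deriv_move:
  assumes "subspace X" "smooth X f" "set (us @ v # ws) \<subseteq> X" "x \<in> X"
  shows "iter_deriv (us @ v # ws) f x = iter_deriv (v # us @ ws) f x"
  using assms(3,4)
proof (induction us arbitrary: x)
  case (Cons u us)
  have "iter_deriv ((u # us) @ v # ws) f x = dir_deriv u (iter_deriv (v # us @ ws) f) x"
    using Cons by (auto intro!: dir_deriv_cong[OF assms(1)] simp del: iter_deriv_Cons simp: iter_deriv_Cons[of u])
  also have "\<dots> = dir_deriv v (dir_deriv u (iter_deriv (us @ ws) f)) x"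
    using Cons(2,3) by (auto intro!: dir_deriv_commute[OF assms(1)] smooth_iter_deriv assms(2))
  finally show ?case by simp
qed simp

lemma iter_deriv_perm:
  assumes "subspace X" "smooth X f" "set vs \<subseteq> X" "x \<in> X" "mset vs = mset ws"
  shows "iter_deriv vs f x = iter_deriv ws f x"
  using assms(3-5)
proof (induction vs arbitrary: ws x)
  case (Cons v vs)
  then obtain us us' where ws: "ws = us @ v # us'"
    by (metis list.set_intros(1) mset_eq_setD split_list)
  have eq: "mset vs = mset (us @ us')" using Cons.prems(3) ws by simp
  have "iter_deriv (v # vs) f x = dir_deriv v (iter_deriv (us @ us') f) x"
    unfolding iter_deriv_Cons
    by (rule dir_deriv_cong[OF assms(1)]) (use Cons eq in auto)
  also have "\<dots> = iter_deriv ws f x"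
    unfolding ws using Cons.prems mset_eq_setD[OF Cons.prems(3)] ws
    by (subst iter_deriv_move[OF assms(1,2)]) auto
  finally show ?case .
qed simp

text \<open>Ensures that the choice of a list in the definition of \<open>nabla\<close>
  succeeds.\<close>

lemma ex_count_list:
  assumes "finite B" "\<alpha> \<in> multi_indices B"
  shows "\<exists>vs. count_list vs = \<alpha> \<and> set vs \<subseteq> B"
proof -
  define M where "M = Abs_multiset \<alpha>"
  have "finite {x. 0 < \<alpha> x}"
    by (rule finite_subset[OF _ assms(1)]) (use assms(2) in \<open>auto simp: multi_indices_def\<close>)
  then have M: "count M = \<alpha>" unfolding M_def by simp
  obtain vs where vs: "mset vs = M" using ex_mset by blast
  have "count_list vs = \<alpha>" using M vs by (metis count_mset ext)
  moreover have "set vs \<subseteq> B"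
    using assms(2) M vs unfolding multi_indices_def
    by (metis (mono_tags, lifting) count_eq_zero_iff mem_Collect_eq set_mset_mset subsetI)
  ultimately show ?thesis by blast
qed

lemma mset_eq_count_list: "mset vs = mset ws \<longleftrightarrow> count_list vs = count_list ws"
  by (auto simp: multiset_eq_iff fun_eq_iff count_mset)

lemma nabla_iter_deriv:
  assumes "subspace X" "smooth X f" "set vs \<subseteq> X" "x \<in> X" "count_list vs = \<alpha>"
  shows "nabla \<alpha> f x = iter_deriv vs f x"
proof -
  have "count_list (SOME vs. count_list vs = \<alpha>) = \<alpha>"
    using assms(5) by (rule someI)
  then have "mset vs = mset (SOME vs. count_list vs = \<alpha>)"
    unfolding mset_eq_count_list using assms(5) by simp
  from iter_deriv_perm[OF assms(1-4) this] show ?thesis unfolding nabla_def by simp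
qed

lemma dir_deriv_nabla:
  assumes "subspace X" "smooth X f" "finite B" "B \<subseteq> X" "\<alpha> \<in> multi_indices B"
  shows "\<lbrakk>x \<in> X; b \<in> B\<rbrakk> \<Longrightarrow> dir_deriv b (nabla \<alpha> f) x = nabla (\<alpha>(b := Suc (\<alpha> b))) f x"
    and "nabla \<alpha> f differentiable_on X"
proof -
  obtain vs where vs: "count_list vs = \<alpha>" "set vs \<subseteq> B" using ex_count_list[OF assms(3,5)] by auto
  have vsX: "set vs \<subseteq> X" using vs assms(4) by auto
  show "dir_deriv b (nabla \<alpha> f) x = nabla (\<alpha>(b := Suc (\<alpha> b))) f x" if x: "x \<in> X" "b \<in> B"
  proof -
    have "dir_deriv b (nabla \<alpha> f) x = dir_deriv b (iter_deriv vs f) x"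
      by (rule dir_deriv_cong[OF assms(1)])
         (use x assms nabla_iter_deriv[OF assms(1,2) vsX _ vs(1)] in auto)
    also have "\<dots> = nabla (\<alpha>(b := Suc (\<alpha> b))) f x"
      using nabla_iter_deriv[OF assms(1,2), of "b # vs" x "\<alpha>(b := Suc (\<alpha> b))"] vs vsX assms(4) x
      by (auto simp: fun_eq_iff)
    finally show ?thesis .
  qed
  have "iter_deriv vs f differentiable_on X" using assms(2) vsX by (auto simp: smooth_def)
  then show "nabla \<alpha> f differentiable_on X"
    using nabla_iter_deriv[OF assms(1,2) vsX _ vs(1)]
    by (simp add: differentiable_on_def) (metis differentiable_transform_within zero_less_one)
qed


subsection \<open>Operators are determined by their symbols\<close>

text \<open>Writing each direction in the basis \<open>B\<close> turns operator and symbol into sums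
  over the same multi-indices with the same coefficients. As \<open>q\<close> vanishes off
  \<open>A\<close>, finite index sets can be enlarged when expressions are combined.\<close>

lemma iter_deriv_normal_form:
  assumes X: "subspace X" and B: "independent B" "span B = X" and vs: "set vs \<subseteq> X"
  shows "\<exists>A q. finite A \<and> A \<subseteq> multi_indices B \<and> (\<forall>\<alpha>. \<alpha> \<notin> A \<longrightarrow> q \<alpha> = 0) \<and>
    (\<forall>\<xi>. (\<Prod>v\<leftarrow>vs. \<xi> \<bullet> v) = (\<Sum>\<alpha>\<in>A. q \<alpha> * (\<Prod>b\<in>B. (\<xi> \<bullet> b) ^ \<alpha> b))) \<and>
    (\<forall>f x. smooth X f \<longrightarrow> x \<in> X \<longrightarrow> iter_deriv vs f x = (\<Sum>\<alpha>\<in>A. q \<alpha> * nabla \<alpha> f x))"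
  using vs
proof (induction vs)
  case Nil
  have "nabla (\<lambda>_. 0) f x = f x" if "smooth X f" "x \<in> X" for f x
    using nabla_iter_deriv[OF X that(1), of "[]" x "\<lambda>_. 0"] that(2) by (simp add: fun_eq_iff)
  then show ?case
    by (intro exI[of _ "{\<lambda>_. 0}"] exI[of _ "\<lambda>\<alpha>. if \<alpha> = (\<lambda>_. 0) then 1 else 0"])
       (auto simp: multi_indices_def)
next
  case (Cons v vs)
  have finB: "finite B" and BX: "B \<subseteq> X" using B independent_imp_finite span_superset by auto
  obtain A q where A: "finite A" "A \<subseteq> multi_indices B" "\<forall>\<alpha>. \<alpha> \<notin> A \<longrightarrow> q \<alpha> = 0"
    and sym: "\<And>\<xi>. (\<Prod>v\<leftarrow>vs. \<xi> \<bullet> v) = (\<Sum>\<alpha>\<in>A. q \<alpha> * (\<Prod>b\<in>B. (\<xi> \<bullet> b) ^ \<alpha> b))"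
    and der: "\<And>f x. smooth X f \<Longrightarrow> x \<in> X \<Longrightarrow> iter_deriv vs f x = (\<Sum>\<alpha>\<in>A. q \<alpha> * nabla \<alpha> f x)"
    using Cons by auto
  define c where "c b = v \<bullet> dual_vec B b" for b
  have v: "(\<Sum>b\<in>B. c b *\<^sub>R b) = v" unfolding c_def using Cons(2) B by (intro sum_dual_vec) auto
  define up :: "('a \<Rightarrow> nat) \<times> 'a \<Rightarrow> 'a \<Rightarrow> nat" where "up = (\<lambda>(\<alpha>, b). \<alpha>(b := Suc (\<alpha> b)))"
  \<comment> \<open>Different pairs may lead to the same raised multi-index, so the new coefficient
    collects the whole fibre of \<open>up\<close>.\<close>
  define q' where "q' \<beta> = (\<Sum>p\<in>A \<times> B. if up p = \<beta> then q (fst p) * c (snd p) else 0)" for \<beta>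
  have fin: "finite (A \<times> B)" using A finB by auto
  have key: "(\<Sum>\<beta>\<in>up ` (A \<times> B). q' \<beta> * g \<beta>) = (\<Sum>\<alpha>\<in>A. \<Sum>b\<in>B. q \<alpha> * c b * g (\<alpha>(b := Suc (\<alpha> b))))" for g
  proof -
    have "(\<Sum>\<beta>\<in>up ` (A \<times> B). q' \<beta> * g \<beta>) =
        (\<Sum>\<beta>\<in>up ` (A \<times> B). \<Sum>p\<in>A \<times> B. if up p = \<beta> then q (fst p) * c (snd p) * g \<beta> else 0)"
      unfolding q'_def sum_distrib_right by (intro sum.cong) auto
    also have "\<dots> = (\<Sum>p\<in>A \<times> B. \<Sum>\<beta>\<in>up ` (A \<times> B). if up p = \<beta> then q (fst p) * c (snd p) * g \<beta> else 0)"
      by (rule sum.swap)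
    also have "\<dots> = (\<Sum>p\<in>A \<times> B. q (fst p) * c (snd p) * g (up p))"
      by (rule sum.cong) (use fin in auto)
    also have "\<dots> = (\<Sum>\<alpha>\<in>A. \<Sum>b\<in>B. q \<alpha> * c b * g (\<alpha>(b := Suc (\<alpha> b))))"
      by (simp add: sum.cartesian_product up_def case_prod_unfold)
    finally show ?thesis .
  qed
  show ?case
  proof (intro exI[of _ "up ` (A \<times> B)"] exI[of _ q'] conjI allI impI)
    show "finite (up ` (A \<times> B))" using fin by simp
    show "up ` (A \<times> B) \<subseteq> multi_indices B" using A(2) by (auto simp: up_def multi_indices_def)
    show "q' \<beta> = 0" if "\<beta> \<notin> up ` (A \<times> B)" for \<beta>
      unfolding q'_def by (rule sum.neutral) (use that in auto)
    show "(\<Prod>w\<leftarrow>v # vs. \<xi> \<bullet> w) = (\<Sum>\<alpha>\<in>up ` (A \<times> B). q' \<alpha> * (\<Prod>b\<in>B. (\<xi> \<bullet> b) ^ \<alpha> b))" for \<xi>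
    proof -
      have "(\<Prod>w\<leftarrow>v # vs. \<xi> \<bullet> w) = (\<Sum>b\<in>B. c b * (\<xi> \<bullet> b)) * (\<Sum>\<alpha>\<in>A. q \<alpha> * (\<Prod>b\<in>B. (\<xi> \<bullet> b) ^ \<alpha> b))"
        using sym[of \<xi>] by (simp add: v[symmetric] inner_sum_right)
      also have "\<dots> = (\<Sum>\<alpha>\<in>A. \<Sum>b\<in>B. q \<alpha> * c b * ((\<xi> \<bullet> b) * (\<Prod>b\<in>B. (\<xi> \<bullet> b) ^ \<alpha> b)))"
        unfolding sum_distrib_left sum_distrib_right by (intro sum.cong refl) (simp add: mult_ac)
      also have "\<dots> = (\<Sum>\<alpha>\<in>A. \<Sum>b\<in>B. q \<alpha> * c b * (\<Prod>b'\<in>B. (\<xi> \<bullet> b') ^ ((\<alpha>(b := Suc (\<alpha> b))) b')))"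
      proof (intro sum.cong refl arg_cong2[of _ _ _ _ "(*)"])
        fix \<alpha> b assume "b \<in> B"
        then show "(\<xi> \<bullet> b) * (\<Prod>b\<in>B. (\<xi> \<bullet> b) ^ \<alpha> b) = (\<Prod>b'\<in>B. (\<xi> \<bullet> b') ^ ((\<alpha>(b := Suc (\<alpha> b))) b'))"
          using finB by (simp add: prod.remove[of B b] mult.assoc)
      qed
      finally show ?thesis unfolding key .
    qed
    fix f x assume f: "smooth X f" and x: "x \<in> X"
    have "iter_deriv (v # vs) f x = dir_deriv v (\<lambda>x. \<Sum>\<alpha>\<in>A. q \<alpha> * nabla \<alpha> f x) x"
      unfolding iter_deriv_Cons using Cons(2) x by (intro dir_deriv_cong[OF X]) (auto simp: der[OF f])
    also have "\<dots> = (\<Sum>\<alpha>\<in>A. q \<alpha> * dir_deriv v (nabla \<alpha> f) x)"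
      using Cons(2) x A(2) by (intro dir_deriv_sum[OF X]) (auto intro!: dir_deriv_nabla(2)[OF X f finB BX])
    also have "\<dots> = (\<Sum>\<alpha>\<in>A. \<Sum>b\<in>B. q \<alpha> * c b * nabla (\<alpha>(b := Suc (\<alpha> b))) f x)"
    proof (intro sum.cong refl)
      fix \<alpha> assume "\<alpha> \<in> A"
      then have \<alpha>: "\<alpha> \<in> multi_indices B" using A(2) by auto
      then have "nabla \<alpha> f differentiable_on X" by (intro dir_deriv_nabla(2)[OF X f finB BX])
      then have "dir_deriv v (nabla \<alpha> f) x = (\<Sum>b\<in>B. c b * dir_deriv b (nabla \<alpha> f) x)"
        unfolding v[symmetric] by (rule dir_deriv_sum_direction[OF X _ x BX])
      then show "q \<alpha> * dir_deriv v (nabla \<alpha> f) x = (\<Sum>b\<in>B. q \<alpha> * c b * nabla (\<alpha>(b := Suc (\<alpha> b))) f x)"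
        by (simp add: sum_distrib_left mult.assoc dir_deriv_nabla(1)[OF X f finB BX \<alpha> x])
    qed
    finally show "iter_deriv (v # vs) f x = (\<Sum>\<alpha>\<in>up ` (A \<times> B). q' \<alpha> * nabla \<alpha> f x)" unfolding key .
  qed
qed

lemma const_coeff_op_normal_form:
  assumes X: "subspace X" and B: "independent B" "span B = X" and D: "const_coeff_op X D"
  shows "\<exists>A q. finite A \<and> A \<subseteq> multi_indices B \<and> (\<forall>\<alpha>. \<alpha> \<notin> A \<longrightarrow> q \<alpha> = 0) \<and>
    (\<forall>f x. smooth X f \<longrightarrow> x \<in> X \<longrightarrow> D f x = (\<Sum>\<alpha>\<in>A. q \<alpha> * nabla \<alpha> f x))"
proof -
  obtain S c where S: "finite S" "\<forall>vs\<in>S. set vs \<subseteq> X"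
    and D: "D = (\<lambda>f x. \<Sum>vs\<in>S. c vs * iter_deriv vs f x)"
    using D by (auto simp: const_coeff_op_def)
  obtain A q where A: "\<And>vs. vs \<in> S \<Longrightarrow> finite (A vs) \<and> A vs \<subseteq> multi_indices B \<and>
      (\<forall>\<alpha>. \<alpha> \<notin> A vs \<longrightarrow> q vs \<alpha> = 0) \<and>
      (\<forall>f x. smooth X f \<longrightarrow> x \<in> X \<longrightarrow> iter_deriv vs f x = (\<Sum>\<alpha>\<in>A vs. q vs \<alpha> * nabla \<alpha> f x))"
  proof -
    define P where "P vs A q \<longleftrightarrow> finite A \<and> A \<subseteq> multi_indices B \<and> (\<forall>\<alpha>. \<alpha> \<notin> A \<longrightarrow> q \<alpha> = 0) \<and>
      (\<forall>f x. smooth X f \<longrightarrow> x \<in> X \<longrightarrow> iter_deriv vs f x = (\<Sum>\<alpha>\<in>A. q \<alpha> * nabla \<alpha> f x))" for vs A q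
    have "\<exists>A q. P vs A q" if "vs \<in> S" for vs
    proof -
      have "set vs \<subseteq> X" using S(2) that by blast
      from iter_deriv_normal_form[OF X B this] show ?thesis unfolding P_def by (elim exE conjE) blast
    qed
    then obtain A q where "\<And>vs. vs \<in> S \<Longrightarrow> P vs (A vs) (q vs)" by metis
    then show ?thesis using that unfolding P_def by blast
  qed
  define A' where "A' = (\<Union>vs\<in>S. A vs)"
  have finA: "finite A'" using A S by (auto simp: A'_def)
  show ?thesis
  proof (intro exI[of _ A'] exI[of _ "\<lambda>\<alpha>. \<Sum>vs\<in>S. c vs * q vs \<alpha>"] conjI allI impI)
    show "finite A'" by (rule finA)
    show "A' \<subseteq> multi_indices B" unfolding A'_def by (rule UN_least) (use A in blast)
    show "(\<Sum>vs\<in>S. c vs * q vs \<alpha>) = 0" if "\<alpha> \<notin> A'" for \<alpha>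
      by (rule sum.neutral) (use that A in \<open>auto simp: A'_def\<close>)
    fix f x assume fx: "smooth X f" "x \<in> X"
    have "D f x = (\<Sum>vs\<in>S. c vs * (\<Sum>\<alpha>\<in>A'. q vs \<alpha> * nabla \<alpha> f x))"
      unfolding D
    proof (intro sum.cong refl arg_cong2[of _ _ _ _ "(*)"])
      fix vs assume vs: "vs \<in> S"
      have "iter_deriv vs f x = (\<Sum>\<alpha>\<in>A vs. q vs \<alpha> * nabla \<alpha> f x)" using A[OF vs] fx by auto
      also have "\<dots> = (\<Sum>\<alpha>\<in>A'. q vs \<alpha> * nabla \<alpha> f x)"
        by (rule sum.mono_neutral_left) (use A[OF vs] vs finA in \<open>auto simp: A'_def\<close>)
      finally show "iter_deriv vs f x = (\<Sum>\<alpha>\<in>A'. q vs \<alpha> * nabla \<alpha> f x)" .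
    qed
    also have "\<dots> = (\<Sum>\<alpha>\<in>A'. (\<Sum>vs\<in>S. c vs * q vs \<alpha>) * nabla \<alpha> f x)"
      unfolding sum_distrib_left sum_distrib_right by (subst sum.swap) (simp add: mult_ac)
    finally show "D f x = (\<Sum>\<alpha>\<in>A'. (\<Sum>vs\<in>S. c vs * q vs \<alpha>) * nabla \<alpha> f x)" .
  qed
qed

text \<open>Induction on the variables: as a polynomial in the variable \<open>b\<close> all
  coefficients vanish, and the coefficient at a given exponent is a polynomial in the remaining
  variables.\<close>

lemma multivariate_poly_zero:
  fixes q :: "('b \<Rightarrow> nat) \<Rightarrow> real"
  assumes "finite B" "finite A" "A \<subseteq> multi_indices B"
    and "\<And>x. (\<Sum>\<alpha>\<in>A. q \<alpha> * (\<Prod>b\<in>B. x b ^ \<alpha> b)) = 0" and "\<alpha> \<in> A"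
  shows "q \<alpha> = 0"
  using assms
proof (induction B arbitrary: A q \<alpha> rule: finite_induct)
  case empty
  then have "A = {\<lambda>_. 0}" "\<alpha> = (\<lambda>_. 0)" by (auto simp: multi_indices_def)
  then show ?case using empty(3)[of undefined] by simp
next
  case (insert b B)
  define k where "k = \<alpha> b"
  \<comment> \<open>The multi-indices with the same \<open>b\<close>-exponent as \<alpha>, with that
    entry erased; updating \<open>b\<close> to \<open>k\<close> restores it.\<close>
  define A' where "A' = (\<lambda>\<beta>. \<beta>(b := 0)) ` {\<beta>\<in>A. \<beta> b = k}"
  have inj: "inj_on (\<lambda>\<beta>. \<beta>(b := 0)) {\<beta>\<in>A. \<beta> b = k}"
    by (rule inj_onI) (metis (mono_tags, lifting) fun_upd_triv fun_upd_upd mem_Collect_eq)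
  have "(q ((\<alpha>(b := 0))(b := k))) = 0"
  proof (rule insert.IH[of A' "\<lambda>\<beta>. q (\<beta>(b := k))" "\<alpha>(b := 0)"])
    show "finite A'" using insert.prems by (auto simp: A'_def)
    show "A' \<subseteq> multi_indices B" using insert.prems by (auto simp: A'_def multi_indices_def)
    show "\<alpha>(b := 0) \<in> A'" using insert.prems by (auto simp: A'_def k_def)
    fix x :: "'b \<Rightarrow> real"
    define N where "N = Max ((\<lambda>\<beta>. \<beta> b) ` A)"
    have N: "\<beta> b \<le> N" if "\<beta> \<in> A" for \<beta> unfolding N_def using that insert.prems(1) by auto
    define a where "a j = (\<Sum>\<beta>\<in>{\<beta>\<in>A. \<beta> b = j}. q \<beta> * (\<Prod>c\<in>B. x c ^ \<beta> c))" for j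
    have "(\<Sum>j\<le>N. a j * z ^ j) = 0" for z
    proof -
      have "(\<Sum>j\<le>N. a j * z ^ j) = (\<Sum>j\<le>N. \<Sum>\<beta>\<in>{\<beta>\<in>A. \<beta> b = j}. q \<beta> * (\<Prod>c\<in>B. x c ^ \<beta> c) * z ^ \<beta> b)"
        unfolding a_def sum_distrib_right by (intro sum.cong) auto
      also have "\<dots> = (\<Sum>\<beta>\<in>A. q \<beta> * (\<Prod>c\<in>B. x c ^ \<beta> c) * z ^ \<beta> b)"
        by (rule sum.group) (use insert.prems(1) N in auto)
      also have "\<dots> = (\<Sum>\<beta>\<in>A. q \<beta> * (\<Prod>c\<in>insert b B. (x(b := z)) c ^ \<beta> c))"
      proof (intro sum.cong refl)
        fix \<beta>
        have "(\<Prod>c\<in>B. x c ^ \<beta> c) = (\<Prod>c\<in>B. (x(b := z)) c ^ \<beta> c)"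
          by (rule prod.cong) (use insert.hyps in auto)
        then show "q \<beta> * (\<Prod>c\<in>B. x c ^ \<beta> c) * z ^ \<beta> b = q \<beta> * (\<Prod>c\<in>insert b B. (x(b := z)) c ^ \<beta> c)"
          using insert.hyps by simp
      qed
      finally show ?thesis using insert.prems(3) by simp
    qed
    then have "\<forall>j\<le>N. a j = 0" using polyfun_eq_0[of a N] by auto
    then have "a k = 0" using N[OF insert.prems(4)] by (auto simp: k_def)
    moreover have "a k = (\<Sum>\<beta>\<in>A'. q (\<beta>(b := k)) * (\<Prod>c\<in>B. x c ^ \<beta> c))"
      unfolding a_def A'_def
    proof (subst sum.reindex[OF inj], intro sum.cong refl)
      fix \<beta> assume "\<beta> \<in> {\<beta> \<in> A. \<beta> b = k}"
      then have "(\<beta>(b := 0))(b := k) = \<beta>" by auto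
      moreover have "(\<Prod>c\<in>B. x c ^ \<beta> c) = (\<Prod>c\<in>B. x c ^ (\<beta>(b := 0)) c)"
        by (rule prod.cong) (use insert.hyps in auto)
      ultimately show "q \<beta> * (\<Prod>c\<in>B. x c ^ \<beta> c) =
        ((\<lambda>\<beta>. q (\<beta>(b := k)) * (\<Prod>c\<in>B. x c ^ \<beta> c)) \<circ> (\<lambda>\<beta>. \<beta>(b := 0))) \<beta>" by simp
    qed
    ultimately show "(\<Sum>\<beta>\<in>A'. q (\<beta>(b := k)) * (\<Prod>c\<in>B. x c ^ \<beta> c)) = 0" by simp
  qed
  then show ?case by (simp add: k_def)
qed

lemma iter_deriv_exp:
  "iter_deriv vs (\<lambda>y. exp (\<xi> \<bullet> y)) = (\<lambda>x. (\<Prod>v\<leftarrow>vs. \<xi> \<bullet> v) * exp (\<xi> \<bullet> x))"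
proof (induction vs)
  case (Cons v vs)
  have "((\<lambda>t. (\<Prod>v\<leftarrow>vs. \<xi> \<bullet> v) * exp (\<xi> \<bullet> (x + t *\<^sub>R v))) has_real_derivative
     (\<Prod>v\<leftarrow>v # vs. \<xi> \<bullet> v) * exp (\<xi> \<bullet> x)) (at 0)" for x
    unfolding inner_add_right inner_scaleR_right by (auto intro!: derivative_eq_intros)
  then show ?case by (auto simp: Cons dir_deriv_def fun_eq_iff intro!: DERIV_imp_deriv)
qed simp

lemma smooth_exp: "smooth X (\<lambda>y. exp (\<xi> \<bullet> y))"
  unfolding smooth_def iter_deriv_exp
  by (auto intro!: derivative_intros simp: differentiable_on_def intro: differentiable_at_withinI
      simp: differentiable_def intro!: exI derivative_eq_intros)

lemma prod_list_count_list:
  assumes "finite E" "set vs \<subseteq> E"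
  shows "(\<Prod>v\<leftarrow>vs. f v) = (\<Prod>e\<in>E. f e ^ count_list vs e :: real)"
  using assms(2)
proof (induction vs)
  case (Cons v vs)
  have "(\<Prod>b\<in>E - {v}. f b ^ count_list (v # vs) b) = (\<Prod>b\<in>E - {v}. f b ^ count_list vs b)"
    by (rule prod.cong) auto
  then show ?case using Cons assms(1) by (simp add: prod.remove[of E v] mult.assoc)
qed simp

text \<open>In normal form the difference of the operators, applied to an exponential and evaluated
  at 0, is a polynomial in the pairings with \<open>B\<close>. These take arbitrary values, so the
  coefficients vanish.\<close>

lemma op_eq_symbol:
  assumes X: "subspace X"
    and D: "const_coeff_op X D" "has_symbol X D \<sigma>" and D': "const_coeff_op X D'" "has_symbol X D' \<sigma>"
  shows "op_eq X D D'"
proof -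
  obtain B where B: "independent B" "span B = X"
    using basis_exists[of X] X by (metis span_eq_iff subset_antisym span_mono)
  have finB: "finite B" and BX: "B \<subseteq> X" using B independent_imp_finite span_superset by auto
  obtain A q where A: "finite A" "A \<subseteq> multi_indices B" "\<forall>\<alpha>. \<alpha> \<notin> A \<longrightarrow> q \<alpha> = 0"
    "\<And>f x. smooth X f \<Longrightarrow> x \<in> X \<Longrightarrow> D f x = (\<Sum>\<alpha>\<in>A. q \<alpha> * nabla \<alpha> f x)"
    using const_coeff_op_normal_form[OF X B D(1)] by blast
  obtain A' q' where A': "finite A'" "A' \<subseteq> multi_indices B" "\<forall>\<alpha>. \<alpha> \<notin> A' \<longrightarrow> q' \<alpha> = 0"
    "\<And>f x. smooth X f \<Longrightarrow> x \<in> X \<Longrightarrow> D' f x = (\<Sum>\<alpha>\<in>A'. q' \<alpha> * nabla \<alpha> f x)"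
    using const_coeff_op_normal_form[OF X B D'(1)] by blast
  have diff: "D f x - D' f x = (\<Sum>\<alpha>\<in>A \<union> A'. (q \<alpha> - q' \<alpha>) * nabla \<alpha> f x)"
    if "smooth X f" "x \<in> X" for f x
  proof -
    have "D f x = (\<Sum>\<alpha>\<in>A \<union> A'. q \<alpha> * nabla \<alpha> f x)"
      unfolding A(4)[OF that] by (rule sum.mono_neutral_left) (use A A' in auto)
    moreover have "D' f x = (\<Sum>\<alpha>\<in>A \<union> A'. q' \<alpha> * nabla \<alpha> f x)"
      unfolding A'(4)[OF that] by (rule sum.mono_neutral_left) (use A A' in auto)
    ultimately show ?thesis by (simp add: sum_subtractf[symmetric] left_diff_distrib)
  qed
  have nabla_exp: "nabla \<alpha> (\<lambda>y. exp (\<xi> \<bullet> y)) 0 = (\<Prod>b\<in>B. (\<xi> \<bullet> b) ^ \<alpha> b)" if \<alpha>: "\<alpha> \<in> multi_indices B" for \<alpha> \<xi>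
  proof -
    obtain vs where vs: "count_list vs = \<alpha>" "set vs \<subseteq> B" using ex_count_list[OF finB \<alpha>] by auto
    have "nabla \<alpha> (\<lambda>y. exp (\<xi> \<bullet> y)) 0 = (\<Prod>v\<leftarrow>vs. \<xi> \<bullet> v)"
      using nabla_iter_deriv[OF X smooth_exp, of vs 0 \<alpha>] vs BX X by (auto simp: iter_deriv_exp subspace_0)
    also have "\<dots> = (\<Prod>b\<in>B. (\<xi> \<bullet> b) ^ count_list vs b)"
      by (rule prod_list_count_list[OF finB vs(2)])
    finally show ?thesis by (simp add: vs)
  qed
  have "q \<alpha> - q' \<alpha> = 0" if \<alpha>: "\<alpha> \<in> A \<union> A'" for \<alpha>
  proof (rule multivariate_poly_zero[OF finB _ _ _ \<alpha>, of "\<lambda>\<alpha>. q \<alpha> - q' \<alpha>"])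
    show "finite (A \<union> A')" "A \<union> A' \<subseteq> multi_indices B" using A A' by auto
    fix x :: "'a \<Rightarrow> real"
    obtain \<xi> where \<xi>: "\<xi> \<in> X" "\<And>b. b \<in> B \<Longrightarrow> \<xi> \<bullet> b = x b" using ex_inner_eq[OF B(1), of x] B by auto
    have "D (\<lambda>y. exp (\<xi> \<bullet> y)) 0 = D' (\<lambda>y. exp (\<xi> \<bullet> y)) 0"
      using D(2) D'(2) \<xi>(1) subspace_0[OF X] unfolding has_symbol_def by force
    then have "(\<Sum>\<alpha>\<in>A \<union> A'. (q \<alpha> - q' \<alpha>) * nabla \<alpha> (\<lambda>y. exp (\<xi> \<bullet> y)) 0) = 0"
      using diff[OF smooth_exp subspace_0[OF X], of \<xi>] by simp
    moreover have "nabla \<alpha> (\<lambda>y. exp (\<xi> \<bullet> y)) 0 = (\<Prod>b\<in>B. x b ^ \<alpha> b)" if "\<alpha> \<in> A \<union> A'" for \<alpha>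
      using nabla_exp[of \<alpha> \<xi>] that A(2) A'(2) \<xi>(2) by (auto intro!: prod.cong)
    ultimately show "(\<Sum>\<alpha>\<in>A \<union> A'. (q \<alpha> - q' \<alpha>) * (\<Prod>b\<in>B. x b ^ \<alpha> b)) = 0" by simp
  qed
  then show ?thesis unfolding op_eq_def using diff by (auto intro!: sum.neutral) 
qed


subsection \<open>Exponentials damped by a Gaussian\<close>

text \<open>Polynomials in \<open>x\<close> and the damping parameter \<open>s\<close>, the factors
  that appear when \<open>gauss\<close> is differentiated. Keeping \<open>s\<close> as a variable
  gives bounds uniform in \<open>s\<close> as well as the value at \<open>s = 0\<close>.\<close>

inductive_set param_poly :: "(real \<Rightarrow> 'a::euclidean_space \<Rightarrow> real) set" where
  param_poly_const: "(\<lambda>s x. c) \<in> param_poly"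
| param_poly_param: "(\<lambda>s x. s) \<in> param_poly"
| param_poly_inner: "(\<lambda>s x. x \<bullet> v) \<in> param_poly"
| param_poly_add: "p \<in> param_poly \<Longrightarrow> q \<in> param_poly \<Longrightarrow> (\<lambda>s x. p s x + q s x) \<in> param_poly"
| param_poly_mult: "p \<in> param_poly \<Longrightarrow> q \<in> param_poly \<Longrightarrow> (\<lambda>s x. p s x * q s x) \<in> param_poly"

lemma param_poly_deriv:
  assumes "p \<in> param_poly"
  shows "\<exists>p'\<in>param_poly. \<forall>s x. ((\<lambda>t. p s (x + t *\<^sub>R v)) has_real_derivative p' s x) (at 0)"
  using assms
proof induction
  case (param_poly_const c)
  show ?case by (rule bexI[of _ "\<lambda>s x. 0"]) (auto intro: param_poly.param_poly_const)
next
  case param_poly_param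
  show ?case by (rule bexI[of _ "\<lambda>s x. 0"]) (auto intro: param_poly.param_poly_const)
next
  case (param_poly_inner w)
  show ?case
    by (rule bexI[of _ "\<lambda>s x. v \<bullet> w"])
       (auto intro: param_poly.param_poly_const intro!: derivative_eq_intros simp: inner_add_left)
next
  case (param_poly_add p q)
  then obtain p' q' where "p' \<in> param_poly" "\<forall>s x. ((\<lambda>t. p s (x + t *\<^sub>R v)) has_real_derivative p' s x) (at 0)"
    "q' \<in> param_poly" "\<forall>s x. ((\<lambda>t. q s (x + t *\<^sub>R v)) has_real_derivative q' s x) (at 0)" by blast
  then show ?case
    by (intro bexI[of _ "\<lambda>s x. p' s x + q' s x"] param_poly.param_poly_add) (auto intro!: DERIV_add)
next
  case (param_poly_mult p q)
  then obtain p' q' where *: "p' \<in> param_poly" "\<And>s x. ((\<lambda>t. p s (x + t *\<^sub>R v)) has_real_derivative p' s x) (at 0)"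
    "q' \<in> param_poly" "\<And>s x. ((\<lambda>t. q s (x + t *\<^sub>R v)) has_real_derivative q' s x) (at 0)" by blast
  have "((\<lambda>t. p s (x + t *\<^sub>R v) * q s (x + t *\<^sub>R v)) has_real_derivative p' s x * q s x + q' s x * p s x) (at 0)" for s x
    using DERIV_mult[OF *(2)[of s x] *(4)[of s x]] by simp
  then show ?case
    by (intro bexI[of _ "\<lambda>s x. p' s x * q s x + q' s x * p s x"] param_poly.param_poly_add param_poly.param_poly_mult * param_poly_mult.hyps) auto
qed

lemma param_poly_differentiable: "p \<in> param_poly \<Longrightarrow> p s differentiable (at x)"
proof (induction rule: param_poly.induct)
  case (param_poly_inner v)
  show ?case by (rule bounded_linear_imp_differentiable) (rule bounded_linear_inner_left)
qed (auto intro: differentiable_add differentiable_mult)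

lemma param_poly_continuous: "p \<in> param_poly \<Longrightarrow> continuous_on UNIV (p s)"
  by (intro differentiable_imp_continuous_on)
     (auto simp: differentiable_on_def param_poly_differentiable differentiable_at_withinI)

lemma param_poly_measurable: "p \<in> param_poly \<Longrightarrow> p s \<in> borel_measurable borel"
  by (intro borel_measurable_continuous_onI param_poly_continuous)

lemma param_poly_tendsto: "p \<in> param_poly \<Longrightarrow> (\<sigma> \<longlongrightarrow> s) F \<Longrightarrow> ((\<lambda>i. p (\<sigma> i) x) \<longlongrightarrow> p s x) F"
  by (induction rule: param_poly.induct) (auto intro!: tendsto_intros)

lemma param_poly_bound:
  assumes "p \<in> param_poly"
  shows "\<exists>c k. 0 \<le> c \<and> (\<forall>s x. 0 \<le> s \<longrightarrow> s \<le> 1 \<longrightarrow> \<bar>p s x\<bar> \<le> c * (1 + norm x) ^ k)"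
  using assms
proof induction
  case (param_poly_const c)
  show ?case by (rule exI[of _ "\<bar>c\<bar>"], rule exI[of _ 0]) auto
next
  case param_poly_param
  show ?case by (rule exI[of _ 1], rule exI[of _ 0]) auto
next
  case (param_poly_inner v)
  have "\<bar>x \<bullet> v\<bar> \<le> norm v * (1 + norm x) ^ 1" for x :: 'a
    using Cauchy_Schwarz_ineq2[of x v] by (simp add: algebra_simps add_increasing)
  then show ?case by (intro exI[of _ "norm v"] exI[of _ 1]) auto
next
  case (param_poly_add p q)
  then obtain c k d l where c: "0 \<le> c" "\<And>s x. 0 \<le> s \<Longrightarrow> s \<le> 1 \<Longrightarrow> \<bar>p s x\<bar> \<le> c * (1 + norm x) ^ k"
    and d: "0 \<le> d" "\<And>s x. 0 \<le> s \<Longrightarrow> s \<le> 1 \<Longrightarrow> \<bar>q s x\<bar> \<le> d * (1 + norm x) ^ l" by blast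
  have "\<bar>p s x + q s x\<bar> \<le> (c + d) * (1 + norm x) ^ (k + l)" if s: "0 \<le> s" "s \<le> 1" for s x
  proof -
    have "c * (1 + norm x) ^ k \<le> c * (1 + norm x) ^ (k + l)" "d * (1 + norm x) ^ l \<le> d * (1 + norm x) ^ (k + l)"
      using c d by (auto intro!: mult_left_mono power_increasing)
    then show ?thesis using c(2)[OF s, of x] d(2)[OF s, of x] by (simp add: distrib_right)
  qed
  then show ?case using c d by (intro exI[of _ "c + d"] exI[of _ "k + l"]) auto
next
  case (param_poly_mult p q)
  then obtain c k d l where c: "0 \<le> c" "\<And>s x. 0 \<le> s \<Longrightarrow> s \<le> 1 \<Longrightarrow> \<bar>p s x\<bar> \<le> c * (1 + norm x) ^ k"
    and d: "0 \<le> d" "\<And>s x. 0 \<le> s \<Longrightarrow> s \<le> 1 \<Longrightarrow> \<bar>q s x\<bar> \<le> d * (1 + norm x) ^ l" by blast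
  have "\<bar>p s x * q s x\<bar> \<le> (c * d) * (1 + norm x) ^ (k + l)" if s: "0 \<le> s" "s \<le> 1" for s x
    using mult_mono[OF c(2)[OF s] d(2)[OF s], of x x] c d by (simp add: abs_mult power_add mult_ac)
  then show ?case using c d by (intro exI[of _ "c * d"] exI[of _ "k + l"]) auto
qed

section \<open>Damped exponentials and their decay\<close>

definition gauss :: "'a::euclidean_space \<Rightarrow> real \<Rightarrow> 'a \<Rightarrow> real" where
  "gauss \<xi> s x = exp (\<xi> \<bullet> x - s * (x \<bullet> x))"

lemma gauss_differentiable: "gauss \<xi> s differentiable (at x)"
proof -
  have "(\<lambda>x. \<xi> \<bullet> x - s * (x \<bullet> x)) differentiable (at x)"
    unfolding differentiable_def by (rule exI) (auto intro!: derivative_eq_intros)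
  moreover have "exp differentiable (at (\<xi> \<bullet> x - s * (x \<bullet> x)))"
    using DERIV_exp[of "\<xi> \<bullet> x - s * (x \<bullet> x)"] field_differentiable_def[of exp]
      field_differentiable_imp_differentiable by blast
  ultimately show ?thesis
    using differentiable_chain_at[of "\<lambda>x. \<xi> \<bullet> x - s * (x \<bullet> x)" x exp] by (simp add: gauss_def[abs_def] o_def)
qed

lemma iter_deriv_gauss:
  "\<exists>p\<in>param_poly. \<forall>s. iter_deriv vs (gauss \<xi> s) = (\<lambda>x. p s x * gauss \<xi> s x)"
proof (induction vs)
  case Nil
  show ?case by (rule bexI[of _ "\<lambda>s x. 1"]) (auto intro: param_poly_const)
next
  case (Cons v vs)
  then obtain p where p: "p \<in> param_poly" "\<And>s. iter_deriv vs (gauss \<xi> s) = (\<lambda>x. p s x * gauss \<xi> s x)" by blast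
  obtain p' where p': "p' \<in> param_poly" "\<And>s x. ((\<lambda>t. p s (x + t *\<^sub>R v)) has_real_derivative p' s x) (at 0)"
    using param_poly_deriv[OF p(1)] by blast
  \<comment> \<open>Product rule; the bracket is the derivative of the exponent of
    \<open>gauss\<close> in direction \<open>v\<close>.\<close>
  define q where "q = (\<lambda>s x. p' s x + p s x * (\<xi> \<bullet> v + (- 2 * s) * (x \<bullet> v)))"
  have "q \<in> param_poly" unfolding q_def by (intro param_poly.intros p p')
  moreover have "iter_deriv (v # vs) (gauss \<xi> s) = (\<lambda>x. q s x * gauss \<xi> s x)" for s
  proof
    fix x
    have g: "((\<lambda>t. gauss \<xi> s (x + t *\<^sub>R v)) has_real_derivative (\<xi> \<bullet> v + (- 2 * s) * (x \<bullet> v)) * gauss \<xi> s x) (at 0)"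
      unfolding gauss_def inner_simps
      by (auto intro!: derivative_eq_intros simp: algebra_simps inner_commute)
    have "((\<lambda>t. p s (x + t *\<^sub>R v) * gauss \<xi> s (x + t *\<^sub>R v)) has_real_derivative q s x * gauss \<xi> s x) (at 0)"
      using DERIV_mult[OF p'(2) g] by (simp add: q_def algebra_simps)
    then show "iter_deriv (v # vs) (gauss \<xi> s) x = q s x * gauss \<xi> s x"
      by (simp add: p(2) dir_deriv_def DERIV_imp_deriv)
  qed
  ultimately show ?case by blast
qed

text \<open>At \<open>s = 0\<close> the damped function is the exponential itself, so the polynomial
  factor specialises to the symbol.\<close>

lemma iter_deriv_gauss_symbol:
  "\<exists>p\<in>param_poly. (\<forall>s. iter_deriv vs (gauss \<xi> s) = (\<lambda>x. p s x * gauss \<xi> s x)) \<and> (\<forall>x. p 0 x = (\<Prod>v\<leftarrow>vs. \<xi> \<bullet> v))"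
proof -
  obtain p where p: "p \<in> param_poly" "\<And>s. iter_deriv vs (gauss \<xi> s) = (\<lambda>x. p s x * gauss \<xi> s x)"
    using iter_deriv_gauss by blast
  have "p 0 x = (\<Prod>v\<leftarrow>vs. \<xi> \<bullet> v)" for x
    using p(2)[of 0] by (simp add: gauss_def[abs_def] iter_deriv_exp fun_eq_iff)
  with p show ?thesis by blast
qed

lemma power_le_exp:
  assumes "a > (0::real)"
  shows "\<exists>K\<ge>0. \<forall>r\<ge>0. (1 + r) ^ k \<le> K * exp (a * r)"
proof (intro exI conjI allI impI)
  \<comment> \<open>The constant comes from bounding \<open>exp (a * (1 + r))\<close> below by the
    single term of degree \<open>k\<close> of its series.\<close>
  show "0 \<le> fact k * exp a / a ^ k" using assms by simp
  fix r :: real assume r: "r \<ge> 0"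
  have "(a * (1 + r)) ^ k / fact k \<le> exp (a * (1 + r))"
  proof -
    have "(\<Sum>n\<in>{k}. (a * (1 + r)) ^ n /\<^sub>R fact n) \<le> (\<Sum>n. (a * (1 + r)) ^ n /\<^sub>R fact n)"
      using assms r by (intro sum_le_suminf summable_exp_generic) auto
    then show ?thesis by (simp add: exp_def divide_inverse mult.commute)
  qed
  then have "a ^ k * (1 + r) ^ k \<le> fact k * exp (a + a * r)"
    by (simp add: power_mult_distrib[symmetric] distrib_left divide_le_eq mult.commute)
  then show "(1 + r) ^ k \<le> fact k * exp a / a ^ k * exp (a * r)"
    using assms by (simp add: exp_add pos_le_divide_eq mult.commute mult.left_commute)
qed

lemma schwartz_gauss:
  assumes s: "0 < s" "s \<le> 1"
  shows "schwartz X (gauss \<xi> s)"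
  unfolding schwartz_def smooth_def
proof (intro conjI allI impI)
  fix vs :: "'a list"
  obtain p where p: "p \<in> param_poly" "\<And>s. iter_deriv vs (gauss \<xi> s) = (\<lambda>x. p s x * gauss \<xi> s x)"
    using iter_deriv_gauss by blast
  show "iter_deriv vs (gauss \<xi> s) differentiable_on X"
    unfolding p(2) differentiable_on_def
    using differentiable_mult[OF param_poly_differentiable[OF p(1)] gauss_differentiable]
    by (blast intro: differentiable_at_withinI)
  fix k
  obtain c l where c: "0 \<le> c" "\<And>s x. 0 \<le> s \<Longrightarrow> s \<le> 1 \<Longrightarrow> \<bar>p s x\<bar> \<le> c * (1 + norm x) ^ l"
    using param_poly_bound[OF p(1)] by blast
  obtain K where K: "K \<ge> 0" "\<And>r::real. r \<ge> 0 \<Longrightarrow> (1 + r) ^ (k + l) \<le> K * exp (1 * r)"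
    using power_le_exp[of 1 "k + l"] by auto
  \<comment> \<open>The summand 1 makes room for the factor \<open>exp (norm x)\<close> that
    dominates the powers of \<open>norm x\<close>; the quadratic exponent is then bounded by
    completing the square.\<close>
  define b where "b = norm \<xi> + 1"
  have "norm (norm x ^ k * iter_deriv vs (gauss \<xi> s) x) \<le> c * (K * exp (b\<^sup>2 / (4 * s)))" for x
  proof -
    have 1: "norm x ^ k * \<bar>p s x\<bar> \<le> c * (1 + norm x) ^ (k + l)"
    proof -
      have "norm x ^ k * \<bar>p s x\<bar> \<le> (1 + norm x) ^ k * (c * (1 + norm x) ^ l)"
        using c(2)[of s x] s c(1) by (intro mult_mono power_mono) auto
      then show ?thesis by (simp add: power_add mult_ac)
    qed
    have 2: "gauss \<xi> s x \<le> exp (norm \<xi> * norm x - s * (norm x)\<^sup>2)"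
      using Cauchy_Schwarz_ineq2[of \<xi> x] by (simp add: gauss_def dot_square_norm)
    have "b * norm x - s * (norm x)\<^sup>2 \<le> b\<^sup>2 / (4 * s)"
    proof -
      have "0 \<le> (2 * s * norm x - b)\<^sup>2" by simp
      then have "4 * s * (b * norm x - s * (norm x)\<^sup>2) \<le> b\<^sup>2" by (simp add: power2_eq_square algebra_simps)
      then show ?thesis using s by (simp add: field_simps)
    qed
    then have 3: "exp (1 * norm x) * exp (norm \<xi> * norm x - s * (norm x)\<^sup>2) \<le> exp (b\<^sup>2 / (4 * s))"
      by (simp add: exp_add[symmetric] b_def algebra_simps)
    have "norm (norm x ^ k * iter_deriv vs (gauss \<xi> s) x) = norm x ^ k * \<bar>p s x\<bar> * gauss \<xi> s x"
      by (simp add: p(2) abs_mult gauss_def)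
    also have "\<dots> \<le> (c * (1 + norm x) ^ (k + l)) * exp (norm \<xi> * norm x - s * (norm x)\<^sup>2)"
      using c(1) by (intro mult_mono[OF 1 2]) (auto simp: gauss_def)
    also have "\<dots> \<le> (c * (K * exp (1 * norm x))) * exp (norm \<xi> * norm x - s * (norm x)\<^sup>2)"
      using K(2)[of "norm x"] c(1) by (intro mult_right_mono mult_left_mono) auto
    also have "\<dots> = c * (K * (exp (1 * norm x) * exp (norm \<xi> * norm x - s * (norm x)\<^sup>2)))" by simp
    also have "\<dots> \<le> c * (K * exp (b\<^sup>2 / (4 * s)))"
      using 3 c(1) K(1) by (intro mult_left_mono) auto
    finally show ?thesis .
  qed
  then show "bounded ((\<lambda>x. norm x ^ k * iter_deriv vs (gauss \<xi> s) x) ` X)"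
    unfolding bounded_iff by blast
qed

text \<open>On the cone \<open>- (\<xi> \<bullet> x)\<close> grows at least linearly in
  \<open>norm x\<close>. Half of the decay absorbs the polynomial; the other half remains and is
  integrable, as half of \<xi> is still negative on the generators.\<close>

lemma cone_exp_bound:
  fixes G :: "'a::euclidean_space set"
  assumes G: "independent G" and \<xi>: "\<And>g. g \<in> G \<Longrightarrow> \<xi> \<bullet> g < 0"
  shows "\<exists>K\<ge>0. \<forall>x\<in>convex_cone hull G. (1 + norm x) ^ k * exp (\<xi> \<bullet> x) \<le> K * exp (((1/2) *\<^sub>R \<xi>) \<bullet> x)"
proof -
  have fin: "finite G" using G by (rule independent_imp_finite)
  obtain \<delta> where \<delta>: "\<delta> > 0" "\<And>g. g \<in> G \<Longrightarrow> \<delta> * norm g \<le> - (\<xi> \<bullet> g)"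
  proof -
    \<comment> \<open>The entry 1 keeps the minimum defined and positive when \<open>G\<close> is
      empty.\<close>
    define S where "S = insert 1 ((\<lambda>g. - (\<xi> \<bullet> g) / norm g) ` G)"
    have nz: "norm g > 0" if "g \<in> G" for g using \<xi>[OF that] by auto
    have "finite S" "S \<noteq> {}" using fin by (auto simp: S_def)
    then have "Min S > 0" "\<And>g. g \<in> G \<Longrightarrow> Min S \<le> - (\<xi> \<bullet> g) / norm g"
      using \<xi> nz by (auto simp: S_def divide_neg_pos)
    then show ?thesis using nz by (intro that[of "Min S"]) (simp_all only: pos_le_divide_eq)
  qed
  obtain K where K: "K \<ge> 0" "\<And>r::real. r \<ge> 0 \<Longrightarrow> (1 + r) ^ k \<le> K * exp (\<delta> / 2 * r)"
    using power_le_exp[of "\<delta> / 2" k] \<delta>(1) by auto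
  have "(1 + norm x) ^ k * exp (\<xi> \<bullet> x) \<le> K * exp (((1/2) *\<^sub>R \<xi>) \<bullet> x)" if x: "x \<in> convex_cone hull G" for x
  proof -
    obtain t where t: "x = (\<Sum>g\<in>G. t g *\<^sub>R g)" "\<And>g. g \<in> G \<Longrightarrow> 0 \<le> t g"
      using x unfolding simplicial_cone_sum[OF fin] by auto
    have "\<delta> * norm x \<le> \<delta> * (\<Sum>g\<in>G. t g * norm g)"
      unfolding t(1) using t(2) \<delta>(1) by (intro mult_left_mono sum_norm_le) auto
    also have "\<dots> \<le> (\<Sum>g\<in>G. t g * - (\<xi> \<bullet> g))"
      unfolding sum_distrib_left mult.left_commute[of \<delta>]
      by (intro sum_mono mult_left_mono t(2) \<delta>(2))
    also have "\<dots> = - (\<xi> \<bullet> x)" unfolding t(1) by (simp add: inner_sum_right sum_negf)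
    finally have *: "\<delta> / 2 * norm x \<le> - (\<xi> \<bullet> x) / 2" by simp
    have "(1 + norm x) ^ k * exp (\<xi> \<bullet> x) \<le> (K * exp (- (\<xi> \<bullet> x) / 2)) * exp (\<xi> \<bullet> x)"
      using K(2)[of "norm x"] * K(1)
      by (intro mult_right_mono order_trans[OF K(2)] mult_left_mono) auto
    also have "\<dots> = K * exp (((1/2) *\<^sub>R \<xi>) \<bullet> x)" by (simp add: exp_add[symmetric])
    finally show ?thesis .
  qed
  then show ?thesis using K(1) by blast
qed

text \<open>Dominated convergence: the Gaussian factor is at most 1 and
  \<open>param_poly_bound\<close> is uniform for \<open>s\<close> between 0 and 1, so
  \<open>cone_exp_bound\<close> yields one majorant for all \<open>n\<close>.\<close>

lemma integral_param_poly_gauss: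
  fixes G :: "'a::euclidean_space set"
  assumes G: "independent G" and \<xi>: "\<And>g. g \<in> G \<Longrightarrow> \<xi> \<bullet> g < 0" and p: "p \<in> param_poly"
    and \<sigma>: "\<And>n. 0 \<le> \<sigma> n \<and> \<sigma> n \<le> 1" "\<sigma> \<longlonglongrightarrow> 0"
  defines "C \<equiv> convex_cone hull G"
  shows "\<And>n. set_integrable (lat_measure G) C (\<lambda>x. p (\<sigma> n) x * gauss \<xi> (\<sigma> n) x)"
    and "(\<lambda>n. LINT x:C|lat_measure G. p (\<sigma> n) x * gauss \<xi> (\<sigma> n) x)
      \<longlonglongrightarrow> (LINT x:C|lat_measure G. p 0 x * exp (\<xi> \<bullet> x))"
proof -
  have [measurable]: "C \<in> sets borel" unfolding C_def by (simp add: closed_simplicial_cone[OF G] borel_closed)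
  have [measurable]: "p s \<in> borel_measurable borel" for s by (rule param_poly_measurable[OF p])
  have [measurable]: "gauss \<xi> s \<in> borel_measurable borel" for s unfolding gauss_def[abs_def] by measurable
  obtain c k where c: "0 \<le> c" "\<And>s x. 0 \<le> s \<Longrightarrow> s \<le> 1 \<Longrightarrow> \<bar>p s x\<bar> \<le> c * (1 + norm x) ^ k"
    using param_poly_bound[OF p] by blast
  obtain K where K: "K \<ge> 0" "\<And>x. x \<in> C \<Longrightarrow> (1 + norm x) ^ k * exp (\<xi> \<bullet> x) \<le> K * exp (((1/2) *\<^sub>R \<xi>) \<bullet> x)"
    using cone_exp_bound[OF G \<xi>] unfolding C_def by blast
  define w where "w x = c * K * (indicator C x *\<^sub>R exp (((1/2) *\<^sub>R \<xi>) \<bullet> x))" for x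
  have w: "integrable (lat_measure G) w"
    using set_integrable_exp_cone[OF G, of "(1/2) *\<^sub>R \<xi>"] \<xi>
    unfolding w_def set_integrable_def C_def by (intro integrable_mult_right) auto
  have bound: "norm (indicator C x *\<^sub>R (p s x * gauss \<xi> s x)) \<le> w x" if s: "0 \<le> s" "s \<le> 1" for s x
  proof (cases "x \<in> C")
    case True
    have "\<bar>p s x\<bar> * gauss \<xi> s x \<le> (c * (1 + norm x) ^ k) * exp (\<xi> \<bullet> x)"
      using c s by (intro mult_mono c) (auto simp: gauss_def)
    also have "\<dots> \<le> c * (K * exp (((1/2) *\<^sub>R \<xi>) \<bullet> x))"
      using mult_left_mono[OF K(2)[OF True] c(1)] by (simp add: mult.assoc)
    finally show ?thesis using True by (simp add: w_def abs_mult gauss_def mult.assoc)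
  qed (simp add: w_def)
  have int: "set_integrable (lat_measure G) C (\<lambda>x. p s x * gauss \<xi> s x)" if "0 \<le> s" "s \<le> 1" for s
    unfolding set_integrable_def
    by (rule Bochner_Integration.integrable_bound[OF w])
       (use bound[OF that] in \<open>auto intro!: AE_I2 order_trans[OF _ abs_ge_self]\<close>)
  then show "set_integrable (lat_measure G) C (\<lambda>x. p (\<sigma> n) x * gauss \<xi> (\<sigma> n) x)" for n
    using \<sigma>(1) by auto
  have g0: "gauss \<xi> 0 x = exp (\<xi> \<bullet> x)" for x by (simp add: gauss_def)
  show "(\<lambda>n. LINT x:C|lat_measure G. p (\<sigma> n) x * gauss \<xi> (\<sigma> n) x)
      \<longlonglongrightarrow> (LINT x:C|lat_measure G. p 0 x * exp (\<xi> \<bullet> x))"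
    unfolding set_lebesgue_integral_def g0[symmetric]
  proof (rule integral_dominated_convergence[OF _ _ w])
    show "AE x in lat_measure G. (\<lambda>n. indicator C x *\<^sub>R (p (\<sigma> n) x * gauss \<xi> (\<sigma> n) x))
       \<longlonglongrightarrow> indicator C x *\<^sub>R (p 0 x * gauss \<xi> 0 x)"
      unfolding gauss_def
      by (intro AE_I2 tendsto_intros param_poly_tendsto[OF p] \<sigma>(2))
    show "AE x in lat_measure G. norm (indicator C x *\<^sub>R (p (\<sigma> n) x * gauss \<xi> (\<sigma> n) x)) \<le> w x" for n
      using bound \<sigma>(1) by (intro AE_I2) auto
  qed measurable
qed


subsection \<open>The defining relation of the operators \<open>L\<close> on symbols\<close>

text \<open>Evaluation at 0 is enough since exponentials are eigenfunctions of constant-coefficient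
  operators; see \<open>has_symbol_op_symbol\<close>.\<close>

definition op_symbol :: "'a::euclidean_space operator \<Rightarrow> 'a \<Rightarrow> real" where
  "op_symbol D \<xi> = D (\<lambda>y. exp (\<xi> \<bullet> y)) 0"

lemma op_symbol_sum:
  "op_symbol (\<lambda>f x. \<Sum>vs\<in>S. c vs * iter_deriv vs f x) \<xi> = (\<Sum>vs\<in>S. c vs * (\<Prod>v\<leftarrow>vs. \<xi> \<bullet> v))"
  by (simp add: op_symbol_def iter_deriv_exp)

lemma poly_on_lines_op_symbol:
  assumes "homogeneous_op V k D"
  shows "poly_on_lines W (op_symbol D)"
proof -
  obtain S c where "D = (\<lambda>f x. \<Sum>vs\<in>S. c vs * iter_deriv vs f x)"
    using assms unfolding homogeneous_op_def by blast
  then have "op_symbol D = (\<lambda>\<xi>. \<Sum>vs\<in>S. c vs * (\<Prod>v\<leftarrow>vs. \<xi> \<bullet> v))"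
    by (simp only: op_symbol_sum[abs_def])
  then show ?thesis by (simp add: poly_on_lines_sum poly_on_lines_mult poly_on_lines_prod_list)
qed

text \<open>Derivatives along \<open>V\<close> only see the pairings of \<xi> with \<open>V\<close>;
  this is what makes such a symbol a pullback from a quotient.\<close>

lemma op_symbol_cong:
  assumes "homogeneous_op V k D" "\<And>v. v \<in> V \<Longrightarrow> \<xi> \<bullet> v = \<eta> \<bullet> v"
  shows "op_symbol D \<xi> = op_symbol D \<eta>"
proof -
  obtain S c where S: "\<forall>vs\<in>S. set vs \<subseteq> V" "D = (\<lambda>f x. \<Sum>vs\<in>S. c vs * iter_deriv vs f x)"
    using assms(1) unfolding homogeneous_op_def by blast
  have "(\<Prod>v\<leftarrow>vs. \<xi> \<bullet> v) = (\<Prod>v\<leftarrow>vs. \<eta> \<bullet> v)" if "vs \<in> S" for vs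
    using S(1) that assms(2) by (intro arg_cong[where f = prod_list] map_cong) auto
  then show ?thesis unfolding S(2) op_symbol_sum by simp
qed

text \<open>By linearity a single iterated derivative suffices; in the limit its polynomial factor
  no longer depends on \<open>x\<close> and leaves the integral.\<close>

lemma integral_gauss_op:
  fixes G :: "'a::euclidean_space set"
  assumes D: "D = (\<lambda>f x. \<Sum>vs\<in>S. c vs * iter_deriv vs f x)"
    and G: "independent G" and \<xi>: "\<And>g. g \<in> G \<Longrightarrow> \<xi> \<bullet> g < 0"
    and \<sigma>: "\<And>n. 0 \<le> \<sigma> n \<and> \<sigma> n \<le> 1" "\<sigma> \<longlonglongrightarrow> 0"
  shows "(\<lambda>n. LINT x:convex_cone hull G|lat_measure G. D (gauss \<xi> (\<sigma> n)) x)
      \<longlonglongrightarrow> op_symbol D \<xi> * (\<Prod>g\<in>G. - 1 / (\<xi> \<bullet> g))"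
proof -
  let ?C = "convex_cone hull G"
  define P where "P vs = (SOME p. p \<in> param_poly \<and> (\<forall>s. iter_deriv vs (gauss \<xi> s) = (\<lambda>x. p s x * gauss \<xi> s x)) \<and>
    (\<forall>x. p 0 x = (\<Prod>v\<leftarrow>vs. \<xi> \<bullet> v)))" for vs
  have P: "P vs \<in> param_poly" "\<And>s. iter_deriv vs (gauss \<xi> s) = (\<lambda>x. P vs s x * gauss \<xi> s x)"
    "\<And>x. P vs 0 x = (\<Prod>v\<leftarrow>vs. \<xi> \<bullet> v)" for vs
    using someI_ex[OF iter_deriv_gauss_symbol[of vs \<xi>, unfolded Bex_def]] unfolding P_def[symmetric] by auto
  have eq: "(LINT x:?C|lat_measure G. D (gauss \<xi> (\<sigma> n)) x) =
      (\<Sum>vs\<in>S. c vs * (LINT x:?C|lat_measure G. P vs (\<sigma> n) x * gauss \<xi> (\<sigma> n) x))" for n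
  proof -
    have "(LINT x:?C|lat_measure G. D (gauss \<xi> (\<sigma> n)) x) =
        (LINT x|lat_measure G. (\<Sum>vs\<in>S. c vs * (indicator ?C x *\<^sub>R (P vs (\<sigma> n) x * gauss \<xi> (\<sigma> n) x))))"
      unfolding set_lebesgue_integral_def D P(2) by (simp add: sum_distrib_left mult.left_commute)
    also have "\<dots> = (\<Sum>vs\<in>S. LINT x|lat_measure G. c vs * (indicator ?C x *\<^sub>R (P vs (\<sigma> n) x * gauss \<xi> (\<sigma> n) x)))"
      using integral_param_poly_gauss(1)[OF G \<xi> P(1) \<sigma>]
      by (intro Bochner_Integration.integral_sum integrable_mult_right) (auto simp: set_integrable_def)
    finally show ?thesis by (simp add: set_lebesgue_integral_def)
  qed
  have "(\<lambda>n. \<Sum>vs\<in>S. c vs * (LINT x:?C|lat_measure G. P vs (\<sigma> n) x * gauss \<xi> (\<sigma> n) x))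
     \<longlonglongrightarrow> (\<Sum>vs\<in>S. c vs * (LINT x:?C|lat_measure G. P vs 0 x * exp (\<xi> \<bullet> x)))"
    by (intro tendsto_sum tendsto_mult tendsto_const integral_param_poly_gauss(2)[OF G \<xi> P(1) \<sigma>])
  moreover have "(LINT x:?C|lat_measure G. P vs 0 x * exp (\<xi> \<bullet> x)) = (\<Prod>v\<leftarrow>vs. \<xi> \<bullet> v) * (\<Prod>g\<in>G. - 1 / (\<xi> \<bullet> g))" for vs
    using set_integral_exp_cone[OF G, of \<xi>] \<xi> by (simp add: P(3))
  ultimately show ?thesis unfolding eq unfolding D op_symbol_sum by (simp add: sum_distrib_right mult.assoc)
qed

text \<open>From any \<xi>, moving far enough along a functional equal to -1 on \<open>E\<close>
  leads into the region where all pairings are negative; so the polynomial on this line has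
  infinitely many zeros.\<close>

lemma poly_on_lines_negative_cone:
  fixes E :: "'a::euclidean_space set"
  assumes E: "independent E" and f: "poly_on_lines UNIV f"
    and zero: "\<And>\<xi>. (\<And>e. e \<in> E \<Longrightarrow> \<xi> \<bullet> e < 0) \<Longrightarrow> f \<xi> = 0"
  shows "f \<xi> = 0"
proof -
  have fin: "finite E" using E by (rule independent_imp_finite)
  obtain \<xi>0 where \<xi>0: "\<And>e. e \<in> E \<Longrightarrow> \<xi>0 \<bullet> e = -1" using ex_inner_eq[OF E, of "\<lambda>_. -1"] by auto
  obtain p where p: "\<And>s. f (\<xi> + s *\<^sub>R \<xi>0) = poly p s" using f unfolding poly_on_lines_def by blast
  define M where "M = (\<Sum>e\<in>E. \<bar>\<xi> \<bullet> e\<bar>)"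
  have "poly p s = 0" if "s > M" for s
  proof -
    have "(\<xi> + s *\<^sub>R \<xi>0) \<bullet> e < 0" if "e \<in> E" for e
    proof -
      have "\<bar>\<xi> \<bullet> e\<bar> \<le> M" unfolding M_def using fin that by (intro member_le_sum) auto
      then show ?thesis using \<xi>0[OF that] \<open>s > M\<close> by (simp add: inner_simps)
    qed
    then show ?thesis using zero p by metis
  qed
  then have "{M<..} \<subseteq> {s. poly p s = 0}" by auto
  then have "infinite {s. poly p s = 0}" using infinite_Ioi infinite_super by blast
  then have "p = 0" using poly_roots_finite by blast
  then show ?thesis using p[of 0] by simp
qed

text \<open>The limit relation for damped exponentials is multiplied by the product of all
  \<open>- (\<xi> \<bullet> e)\<close>: the denominators from the integral over \<open>C(J)\<close>
  cancel, and the factors indexed by \<open>J\<close> remain.\<close>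

lemma L_family_symbol:
  fixes E B :: "'a::euclidean_space set"
  assumes B: "independent B" "E \<subseteq> B" and L: "L_family (int_span B) E L"
    and I: "I \<noteq> {}" "I \<subseteq> E" and \<alpha>: "\<alpha> \<in> multi_indices I"
  shows "(\<Prod>e\<in>E. (\<xi> \<bullet> e) ^ \<alpha> e) * (\<Prod>e\<in>I. - (\<xi> \<bullet> e)) =
    (\<Sum>J | I \<subseteq> J \<and> J \<subseteq> E \<and> card J \<le> sum \<alpha> E + card I.
       (- 1) ^ (card J - card I) * op_symbol (L I J \<alpha>) \<xi> * (\<Prod>e\<in>J. - (\<xi> \<bullet> e)))"
proof -
  have E: "independent E" using B independent_mono by blast
  have finE: "finite E" using E by (rule independent_imp_finite)
  let ?\<J> = "{J. I \<subseteq> J \<and> J \<subseteq> E \<and> card J \<le> sum \<alpha> E + card I}"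
  have hom: "homogeneous_op (span E \<inter> orthogonal_comp (span (E - J))) (sum \<alpha> E + card I - card J) (L I J \<alpha>)"
    if "J \<in> ?\<J>" for J using L I \<alpha> that unfolding L_family_def by blast
  have rel: "integral_over (int_span B) (sub_cone E I) (nabla \<alpha> \<phi>) =
           (\<Sum>J\<in>?\<J>. (- 1) ^ (card J - card I) * integral_over (int_span B) (sub_cone E J) (L I J \<alpha> \<phi>))"
    if "schwartz (span E) \<phi>" for \<phi>
    using L I \<alpha> that unfolding L_family_def by blast
  have int: "integral_over (int_span B) (sub_cone E J) f = (LINT x:convex_cone hull (E - J)|lat_measure (E - J). f x)" for J f
  proof -
    have "independent (E - J)" "span (E - J) \<inter> int_span B = int_span (E - J)"
      using E B independent_mono int_span_subbasis[OF B(1), of "E - J"] by blast+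
    then show ?thesis by (simp add: integral_over_def sub_cone_def hull_measure_cone)
  qed
  have indE: "independent (E - J)" for J using E independent_mono by blast
  \<comment> \<open>The very list chosen by \<open>nabla\<close>, so that
    \<open>nabla \<alpha>\<close> unfolds to \<open>iter_deriv vs\<close>.\<close>
  define vs where "vs = (SOME vs. count_list vs = \<alpha>)"
  have vs: "count_list vs = \<alpha>"
  proof -
    have "\<alpha> \<in> multi_indices E" using \<alpha> I by (auto simp: multi_indices_def)
    then show ?thesis unfolding vs_def using ex_count_list[OF finE] by (metis (mono_tags, lifting) someI_ex)
  qed
  have "set vs \<subseteq> E"
  proof
    fix v assume "v \<in> set vs"
    then have "\<alpha> v \<noteq> 0" using vs by (metis count_list_0_iff)
    then show "v \<in> E" using \<alpha> I by (auto simp: multi_indices_def)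
  qed
  then have vs_prod: "(\<Prod>v\<leftarrow>vs. \<xi> \<bullet> v) = (\<Prod>e\<in>E. (\<xi> \<bullet> e) ^ \<alpha> e)" for \<xi>
    using prod_list_count_list[OF finE] vs by blast
  define \<sigma> where "\<sigma> n = inverse (real (Suc n))" for n
  have \<sigma>: "\<And>n. 0 \<le> \<sigma> n \<and> \<sigma> n \<le> 1" "\<sigma> \<longlonglongrightarrow> 0" "\<And>n. 0 < \<sigma> n"
    using LIMSEQ_inverse_real_of_nat unfolding \<sigma>_def[abs_def] by (simp_all add: inverse_le_1_iff)
  have main: "(\<Prod>e\<in>E. (\<xi> \<bullet> e) ^ \<alpha> e) * (\<Prod>e\<in>E - I. - 1 / (\<xi> \<bullet> e)) =
    (\<Sum>J\<in>?\<J>. (- 1) ^ (card J - card I) * (op_symbol (L I J \<alpha>) \<xi> * (\<Prod>e\<in>E - J. - 1 / (\<xi> \<bullet> e))))"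
    if \<xi>: "\<And>e. e \<in> E \<Longrightarrow> \<xi> \<bullet> e < 0" for \<xi>
  proof (rule LIMSEQ_unique)
    let ?l = "\<lambda>n. integral_over (int_span B) (sub_cone E I) (nabla \<alpha> (gauss \<xi> (\<sigma> n)))"
    have "(\<lambda>n. LINT x:convex_cone hull (E - I)|lat_measure (E - I).
             (\<lambda>f x. \<Sum>ws\<in>{vs}. 1 * iter_deriv ws f x) (gauss \<xi> (\<sigma> n)) x)
      \<longlonglongrightarrow> op_symbol (\<lambda>f x. \<Sum>ws\<in>{vs}. 1 * iter_deriv ws f x) \<xi> * (\<Prod>g\<in>E - I. - 1 / (\<xi> \<bullet> g))"
      by (rule integral_gauss_op[OF refl indE _ \<sigma>(1,2)]) (use \<xi> in auto)
    then show "?l \<longlonglongrightarrow> (\<Prod>e\<in>E. (\<xi> \<bullet> e) ^ \<alpha> e) * (\<Prod>e\<in>E - I. - 1 / (\<xi> \<bullet> e))"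
      by (simp add: int nabla_def vs_def[symmetric] op_symbol_def iter_deriv_exp vs_prod)
    have "?l = (\<lambda>n. \<Sum>J\<in>?\<J>. (- 1) ^ (card J - card I) * (LINT x:convex_cone hull (E - J)|lat_measure (E - J). L I J \<alpha> (gauss \<xi> (\<sigma> n)) x))"
      using rel[OF schwartz_gauss] \<sigma> by (simp add: int)
    also have "\<dots> \<longlonglongrightarrow> (\<Sum>J\<in>?\<J>. (- 1) ^ (card J - card I) * (op_symbol (L I J \<alpha>) \<xi> * (\<Prod>e\<in>E - J. - 1 / (\<xi> \<bullet> e))))"
    proof (intro tendsto_sum tendsto_mult tendsto_const)
      fix J assume "J \<in> ?\<J>"
      from hom[OF this] obtain S c where "L I J \<alpha> = (\<lambda>f x. \<Sum>vs\<in>S. c vs * iter_deriv vs f x)"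
        unfolding homogeneous_op_def by blast
      then show "(\<lambda>n. LINT x:convex_cone hull (E - J)|lat_measure (E - J). L I J \<alpha> (gauss \<xi> (\<sigma> n)) x)
         \<longlonglongrightarrow> op_symbol (L I J \<alpha>) \<xi> * (\<Prod>e\<in>E - J. - 1 / (\<xi> \<bullet> e))"
        by (rule integral_gauss_op[OF _ indE _ \<sigma>(1,2)]) (use \<xi> in auto)
    qed
    finally show "?l \<longlonglongrightarrow> (\<Sum>J\<in>?\<J>. (- 1) ^ (card J - card I) * (op_symbol (L I J \<alpha>) \<xi> * (\<Prod>e\<in>E - J. - 1 / (\<xi> \<bullet> e))))" .
  qed
  have cancel: "(\<Prod>e\<in>E - J. - 1 / (\<xi> \<bullet> e)) * (\<Prod>e\<in>E. - (\<xi> \<bullet> e)) = (\<Prod>e\<in>J. - (\<xi> \<bullet> e))"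
    if \<xi>: "\<And>e. e \<in> E \<Longrightarrow> \<xi> \<bullet> e < 0" and J: "J \<subseteq> E" for \<xi> J
  proof -
    have "(\<Prod>e\<in>E - J. - 1 / (\<xi> \<bullet> e)) * (\<Prod>e\<in>E - J. - (\<xi> \<bullet> e)) = 1"
      unfolding prod.distrib[symmetric] using \<xi> by (intro prod.neutral) force
    moreover have "(\<Prod>e\<in>E. - (\<xi> \<bullet> e)) = (\<Prod>e\<in>E - J. - (\<xi> \<bullet> e)) * (\<Prod>e\<in>J. - (\<xi> \<bullet> e))"
      using prod.subset_diff[OF J finE] by blast
    ultimately show ?thesis by (simp add: mult.assoc[symmetric])
  qed
  let ?f = "\<lambda>\<xi>. (\<Prod>e\<in>E. (\<xi> \<bullet> e) ^ \<alpha> e) * (\<Prod>e\<in>I. - (\<xi> \<bullet> e)) -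
    (\<Sum>J\<in>?\<J>. (- 1) ^ (card J - card I) * op_symbol (L I J \<alpha>) \<xi> * (\<Prod>e\<in>J. - (\<xi> \<bullet> e)))"
  have "?f \<xi> = 0"
  proof (rule poly_on_lines_negative_cone[OF E, of ?f])
    show "poly_on_lines UNIV ?f"
    proof (intro poly_on_lines_diff poly_on_lines_mult poly_on_lines_sum poly_on_lines_prod poly_on_lines_power
        poly_on_lines_uminus poly_on_lines_inner poly_on_lines_const)
      fix J assume "J \<in> ?\<J>"
      from hom[OF this] show "poly_on_lines UNIV (op_symbol (L I J \<alpha>))" by (rule poly_on_lines_op_symbol)
    qed
    fix \<xi> :: 'a assume \<xi>: "\<And>e. e \<in> E \<Longrightarrow> \<xi> \<bullet> e < 0"
    have "(\<Prod>e\<in>E. (\<xi> \<bullet> e) ^ \<alpha> e) * (\<Prod>e\<in>I. - (\<xi> \<bullet> e)) =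
        ((\<Prod>e\<in>E. (\<xi> \<bullet> e) ^ \<alpha> e) * (\<Prod>e\<in>E - I. - 1 / (\<xi> \<bullet> e))) * (\<Prod>e\<in>E. - (\<xi> \<bullet> e))"
      by (simp only: cancel[OF \<xi> I(2), symmetric] mult.assoc)
    also have "\<dots> = (\<Sum>J\<in>?\<J>. (- 1) ^ (card J - card I) * (op_symbol (L I J \<alpha>) \<xi> * ((\<Prod>e\<in>E - J. - 1 / (\<xi> \<bullet> e)) * (\<Prod>e\<in>E. - (\<xi> \<bullet> e)))))"
      using arg_cong[OF main[OF \<xi>], of "\<lambda>z. z * (\<Prod>e\<in>E. - (\<xi> \<bullet> e))"]
      by (simp only: sum_distrib_right mult.assoc)
    also have "\<dots> = (\<Sum>J\<in>?\<J>. (- 1) ^ (card J - card I) * op_symbol (L I J \<alpha>) \<xi> * (\<Prod>e\<in>J. - (\<xi> \<bullet> e)))"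
      by (intro sum.cong refl) (simp only: cancel[OF \<xi>] mem_Collect_eq mult.assoc)
    finally show "?f \<xi> = 0" by simp
  qed
  then show ?thesis by simp
qed


subsection \<open>The symbols of the explicit operators\<close>

definition todd_part :: "'a::euclidean_space set \<Rightarrow> nat \<Rightarrow> 'a \<Rightarrow> real" where
  "todd_part E n = taylor_part E (\<lambda>\<nu>. \<Prod>e\<in>E. todd_coeff (\<nu> e)) n"

text \<open>The symbol of \<open>explicit_op\<close> on the face \<open>C(K)\<close>, which has
  codimension \<open>card K\<close>: hence the exponent \<open>n - card K\<close>. The case
  \<open>K = {}\<close> is the face \<open>F = C\<close>.\<close>

definition explicit_symbol ::
    "('a::euclidean_space set \<Rightarrow> 'a set \<Rightarrow> ('a \<Rightarrow> nat) \<Rightarrow> 'a operator) \<Rightarrow> 'a set \<Rightarrow> nat \<Rightarrow> 'a set \<Rightarrow> 'a \<Rightarrow> real" where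
  "explicit_symbol L E n K \<xi> =
     (if K = {} then (if n = 0 then 1 else 0)
      else (- 1) ^ (n - card K) * (\<Sum>I\<in>Pow K. \<Sum>\<nu> | \<nu> \<in> pos_multi_indices I \<and> sum \<nu> E = n.
        (\<Prod>e\<in>I. p_coeff (\<nu> e)) * op_symbol (L I K (\<lambda>e. \<nu> e - (if e \<in> I then 1 else 0))) \<xi>))"

lemma p_coeff_todd: "p_coeff n = (- 1) ^ n * todd_coeff n"
  by (simp add: p_coeff_def todd_coeff_def)

text \<open>Positivity of \<nu> on \<open>I\<close> makes the truncated subtraction exact.\<close>

lemma pos_index_shift:
  assumes E: "finite E" "I \<subseteq> E" and \<nu>: "\<nu> \<in> pos_multi_indices I" "sum \<nu> E = n"
  defines "\<alpha> \<equiv> \<lambda>e. \<nu> e - (if e \<in> I then 1 else 0)"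
  shows "\<alpha> \<in> multi_indices I" "sum \<alpha> E + card I = n" "\<And>e. \<nu> e = \<alpha> e + (if e \<in> I then 1 else 0)"
proof -
  show *: "\<nu> e = \<alpha> e + (if e \<in> I then 1 else 0)" for e
    using \<nu>(1) unfolding \<alpha>_def pos_multi_indices_def by (auto simp: Suc_leI)
  show "\<alpha> \<in> multi_indices I" using \<nu>(1) by (auto simp: \<alpha>_def pos_multi_indices_def multi_indices_def)
  have "n = (\<Sum>e\<in>E. \<alpha> e + (if e \<in> I then 1 else 0))" unfolding \<nu>(2)[symmetric] using * by (rule sum.cong[OF refl])
  also have "\<dots> = sum \<alpha> E + card (E \<inter> I)" using E(1) by (simp add: sum.distrib sum.If_cases)
  finally show "sum \<alpha> E + card I = n" using E(2) by (simp add: Int_absorb1)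
qed

text \<open>A multi-index belongs to \<open>pos_multi_indices I\<close> for exactly one
  \<open>I\<close>, its support.\<close>

lemma sum_deg_indices_support:
  assumes E: "finite E"
  shows "(\<Sum>I\<in>Pow E. \<Sum>\<nu> | \<nu> \<in> pos_multi_indices I \<and> sum \<nu> E = n. h \<nu>) = (\<Sum>\<nu>\<in>deg_indices E n. h \<nu> :: real)"
proof -
  have eq: "{\<nu> \<in> deg_indices E n. {e\<in>E. \<nu> e \<noteq> 0} = I} = {\<nu>. \<nu> \<in> pos_multi_indices I \<and> sum \<nu> E = n}"
    if "I \<in> Pow E" for I
    using that by (auto simp: deg_indices_def pos_multi_indices_def multi_indices_def)
  have "(\<Sum>I\<in>Pow E. \<Sum>\<nu> \<in> {\<nu> \<in> deg_indices E n. {e\<in>E. \<nu> e \<noteq> 0} = I}. h \<nu>) = (\<Sum>\<nu>\<in>deg_indices E n. h \<nu>)"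
    by (rule sum.group) (use E finite_deg_indices[OF E] in auto)
  then show ?thesis using eq by simp
qed

text \<open>After interchanging the sums, for fixed \<open>I\<close> and \<nu> the sum over
  \<open>K\<close> is the relation of the operators \<open>L\<close> for \<nu> lowered by 1 on
  \<open>I\<close>. Its left side is, up to sign, the monomial with exponent \<nu>, and
  \<open>p_coeff\<close> supplies the Todd coefficients.\<close>

lemma explicit_symbol_relation:
  fixes E B :: "'a::euclidean_space set"
  assumes B: "independent B" "E \<subseteq> B" and L: "L_family (int_span B) E L"
  shows "(\<Sum>K | K \<subseteq> E \<and> card K \<le> n. explicit_symbol L E n K \<xi> * (\<Prod>e\<in>K. - (\<xi> \<bullet> e))) = todd_part E n \<xi>"
proof -
  have E: "finite E" using B independent_imp_finite finite_subset by blast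
  let ?\<K> = "{K. K \<subseteq> E \<and> card K \<le> n}"
  have finK: "finite ?\<K>" using E by simp
  show ?thesis
  proof (cases "n = 0")
    \<comment> \<open>Treated apart because here \<open>I = {}\<close> is the only index, and
      \<open>L\<close> is specified for nonempty \<open>I\<close> only.\<close>
    case True
    have "?\<K> = {{}}" using True E finite_subset by fastforce
    moreover have "deg_indices E 0 = {\<lambda>_. 0}"
      using E by (auto simp: deg_indices_def multi_indices_def fun_eq_iff)
    ultimately show ?thesis using True
      by (simp add: explicit_symbol_def todd_part_def taylor_part_def todd_coeff_0)
  next
    case False
    define N where "N I = {\<nu>. \<nu> \<in> pos_multi_indices I \<and> sum \<nu> E = n}" for I
    \<comment> \<open>In positive degree no index has empty support, so the case
      \<open>I = {}\<close>, not covered by the relation of \<open>L\<close>, contributes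
      nothing.\<close>
    have N0: "N {} = {}" using False by (auto simp: N_def pos_multi_indices_def multi_indices_def)
    define sh :: "'a set \<Rightarrow> ('a \<Rightarrow> nat) \<Rightarrow> 'a \<Rightarrow> nat" where "sh I \<nu> = (\<lambda>e. \<nu> e - (if e \<in> I then 1 else 0))" for I \<nu>
    define h where "h I K \<nu> = (- 1) ^ (n - card K) * ((\<Prod>e\<in>I. p_coeff (\<nu> e)) * op_symbol (L I K (sh I \<nu>)) \<xi>) *
      (\<Prod>e\<in>K. - (\<xi> \<bullet> e))" for I K \<nu>
    have "(\<Sum>K\<in>?\<K>. explicit_symbol L E n K \<xi> * (\<Prod>e\<in>K. - (\<xi> \<bullet> e))) = (\<Sum>K\<in>?\<K>. \<Sum>I\<in>Pow K. \<Sum>\<nu>\<in>N I. h I K \<nu>)"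
    proof (rule sum.cong[OF refl])
      fix K
      show "explicit_symbol L E n K \<xi> * (\<Prod>e\<in>K. - (\<xi> \<bullet> e)) = (\<Sum>I\<in>Pow K. \<Sum>\<nu>\<in>N I. h I K \<nu>)"
        by (cases "K = {}")
           (simp_all add: explicit_symbol_def False N0 h_def sh_def N_def[symmetric] sum_distrib_left sum_distrib_right mult.assoc)
    qed
    also have "\<dots> = (\<Sum>K\<in>?\<K>. \<Sum>I\<in>Pow E. if I \<subseteq> K then \<Sum>\<nu>\<in>N I. h I K \<nu> else 0)"
    proof (rule sum.cong[OF refl])
      fix K assume "K \<in> ?\<K>"
      then show "(\<Sum>I\<in>Pow K. \<Sum>\<nu>\<in>N I. h I K \<nu>) = (\<Sum>I\<in>Pow E. if I \<subseteq> K then \<Sum>\<nu>\<in>N I. h I K \<nu> else 0)"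
        using E by (intro sum.mono_neutral_cong_left) auto
    qed
    also have "\<dots> = (\<Sum>I\<in>Pow E. \<Sum>K\<in>?\<K>. if I \<subseteq> K then \<Sum>\<nu>\<in>N I. h I K \<nu> else 0)"
      by (rule sum.swap)
    also have "\<dots> = (\<Sum>I\<in>Pow E. \<Sum>\<nu>\<in>N I. \<Sum>K | I \<subseteq> K \<and> K \<subseteq> E \<and> card K \<le> n. h I K \<nu>)"
    proof (rule sum.cong[OF refl])
      fix I
      have "(\<Sum>K\<in>?\<K>. if I \<subseteq> K then \<Sum>\<nu>\<in>N I. h I K \<nu> else 0) = (\<Sum>K\<in>{K\<in>?\<K>. I \<subseteq> K}. \<Sum>\<nu>\<in>N I. h I K \<nu>)"
        by (rule sum.inter_filter[symmetric, OF finK])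
      also have "\<dots> = (\<Sum>\<nu>\<in>N I. \<Sum>K\<in>{K\<in>?\<K>. I \<subseteq> K}. h I K \<nu>)" by (rule sum.swap)
      also have "{K\<in>?\<K>. I \<subseteq> K} = {K. I \<subseteq> K \<and> K \<subseteq> E \<and> card K \<le> n}" by auto
      finally show "(\<Sum>K\<in>?\<K>. if I \<subseteq> K then \<Sum>\<nu>\<in>N I. h I K \<nu> else 0) =
        (\<Sum>\<nu>\<in>N I. \<Sum>K | I \<subseteq> K \<and> K \<subseteq> E \<and> card K \<le> n. h I K \<nu>)" .
    qed
    also have "\<dots> = (\<Sum>I\<in>Pow E. \<Sum>\<nu>\<in>N I. (\<Prod>e\<in>E. todd_coeff (\<nu> e)) * (\<Prod>e\<in>E. (\<xi> \<bullet> e) ^ \<nu> e))"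
    proof (intro sum.cong refl)
      fix I \<nu> assume "I \<in> Pow E" and \<nu>: "\<nu> \<in> N I"
      then have I: "I \<subseteq> E" "I \<noteq> {}" using N0 by auto
      have finI: "finite I" using I(1) E finite_subset by blast
      have \<nu>': "\<nu> \<in> pos_multi_indices I" "sum \<nu> E = n" using \<nu> by (auto simp: N_def)
      note sh = pos_index_shift[OF E I(1) \<nu>', folded sh_def]
      have par: "(- 1 :: real) ^ (n - card K) = (- 1) ^ (n - card I) * (- 1) ^ (card K - card I)"
        if "I \<subseteq> K" "K \<subseteq> E" "card K \<le> n" for K
      proof -
        have "card I \<le> card K" using that E finite_subset by (intro card_mono) auto
        then have "n - card I = (n - card K) + (card K - card I)" using that(3) by simp
        then show ?thesis by (simp add: power_add power_mult_distrib[symmetric] mult.assoc)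
      qed
      have "(\<Sum>K | I \<subseteq> K \<and> K \<subseteq> E \<and> card K \<le> n. h I K \<nu>) =
        (- 1) ^ (n - card I) * (\<Prod>e\<in>I. p_coeff (\<nu> e)) *
        (\<Sum>K | I \<subseteq> K \<and> K \<subseteq> E \<and> card K \<le> n. (- 1) ^ (card K - card I) * op_symbol (L I K (sh I \<nu>)) \<xi> * (\<Prod>e\<in>K. - (\<xi> \<bullet> e)))"
        unfolding sum_distrib_left by (intro sum.cong refl) (simp add: h_def par mult_ac)
      also have "\<dots> = (- 1) ^ (n - card I) * (\<Prod>e\<in>I. p_coeff (\<nu> e)) *
         ((\<Prod>e\<in>E. (\<xi> \<bullet> e) ^ sh I \<nu> e) * (\<Prod>e\<in>I. - (\<xi> \<bullet> e)))"
        using L_family_symbol[OF B L I(2,1) sh(1), of \<xi>] unfolding sh(2) by simp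
      also have "(\<Prod>e\<in>I. - (\<xi> \<bullet> e)) = (- 1) ^ card I * (\<Prod>e\<in>I. \<xi> \<bullet> e)"
        using prod.distrib[of "\<lambda>_. -1" "\<lambda>e. \<xi> \<bullet> e" I] by simp
      also have "(\<Prod>e\<in>I. p_coeff (\<nu> e)) = (- 1) ^ n * (\<Prod>e\<in>E. todd_coeff (\<nu> e))"
      proof -
        have z: "\<nu> e = 0" if "e \<notin> I" for e using \<nu>'(1) that by (auto simp: pos_multi_indices_def multi_indices_def)
        have "(\<Prod>e\<in>I. p_coeff (\<nu> e)) = (- 1) ^ sum \<nu> I * (\<Prod>e\<in>I. todd_coeff (\<nu> e))"
          by (simp add: p_coeff_todd prod.distrib power_sum)
        also have "sum \<nu> I = n"
          unfolding \<nu>'(2)[symmetric] using E I(1) z by (intro sum.mono_neutral_left) auto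
        also have "(\<Prod>e\<in>I. todd_coeff (\<nu> e)) = (\<Prod>e\<in>E. todd_coeff (\<nu> e))"
          using E I(1) z by (intro prod.mono_neutral_left) (auto simp: todd_coeff_0)
        finally show ?thesis .
      qed
      also have "(- 1) ^ (n - card I) * ((- 1) ^ n * (\<Prod>e\<in>E. todd_coeff (\<nu> e))) *
          ((\<Prod>e\<in>E. (\<xi> \<bullet> e) ^ sh I \<nu> e) * ((- 1) ^ card I * (\<Prod>e\<in>I. \<xi> \<bullet> e))) =
          (((- 1) ^ (n - card I) * (- 1) ^ card I) * (- 1) ^ n) * ((\<Prod>e\<in>E. todd_coeff (\<nu> e)) *
            ((\<Prod>e\<in>E. (\<xi> \<bullet> e) ^ sh I \<nu> e) * (\<Prod>e\<in>I. \<xi> \<bullet> e)))"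
        by (simp add: mult_ac)
      \<comment> \<open>The signs stem from the prefactor together with the relation of
        \<open>L\<close>, from the linear forms over \<open>I\<close>, and from
        \<open>p_coeff\<close>; the exponents add up to \<open>2 * n\<close>.\<close>
      also have "((- 1) ^ (n - card I) * (- 1) ^ card I) * (- 1 :: real) ^ n = 1"
      proof -
        have "(- 1 :: real) ^ (n - card I) * (- 1) ^ card I = (- 1) ^ n"
          using sh(2) by (simp add: power_add[symmetric])
        then show ?thesis by (simp only: minus_one_mult_self)
      qed
      also have "(\<Prod>e\<in>E. (\<xi> \<bullet> e) ^ sh I \<nu> e) * (\<Prod>e\<in>I. \<xi> \<bullet> e) = (\<Prod>e\<in>E. (\<xi> \<bullet> e) ^ \<nu> e)"
      proof -
        have "(\<Prod>e\<in>I. \<xi> \<bullet> e) = (\<Prod>e\<in>E. (\<xi> \<bullet> e) ^ (if e \<in> I then 1 else 0))"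
          using E I(1) by (intro prod.mono_neutral_cong_left) auto
        then have "(\<Prod>e\<in>E. (\<xi> \<bullet> e) ^ sh I \<nu> e) * (\<Prod>e\<in>I. \<xi> \<bullet> e) =
          (\<Prod>e\<in>E. (\<xi> \<bullet> e) ^ (sh I \<nu> e + (if e \<in> I then 1 else 0)))"
          by (simp add: prod.distrib[symmetric] power_add)
        also have "\<dots> = (\<Prod>e\<in>E. (\<xi> \<bullet> e) ^ \<nu> e)"
        proof (intro prod.cong refl arg_cong2[of _ _ _ _ "(^)"])
          show "sh I \<nu> e + (if e \<in> I then 1 else 0) = \<nu> e" for e
            using sh(3)[of e] by (simp add: sh_def)
        qed
        finally show ?thesis .
      qed
      finally show "(\<Sum>K | I \<subseteq> K \<and> K \<subseteq> E \<and> card K \<le> n. h I K \<nu>) =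
        (\<Prod>e\<in>E. todd_coeff (\<nu> e)) * (\<Prod>e\<in>E. (\<xi> \<bullet> e) ^ \<nu> e)" by simp
    qed
    also have "\<dots> = todd_part E n \<xi>"
      unfolding N_def todd_part_def taylor_part_def by (rule sum_deg_indices_support[OF E])
    finally show ?thesis .
  qed
qed


subsection \<open>Uniqueness of the solution of the symbol relation\<close>

lemma subspace_quot: "subspace X \<Longrightarrow> subspace (quot X L)"
  unfolding quot_def by (intro subspace_inter subspace_orthogonal_comp)

lemma quot_inner: "\<xi> \<in> quot X (span G) \<Longrightarrow> g \<in> span G \<Longrightarrow> \<xi> \<bullet> g = 0"
  by (auto simp: quot_def orthogonal_comp_def orthogonal_def inner_commute)

text \<open>The product over \<open>K\<close> has zeros on the annihilator of
  \<open>span (E - K)\<close>, so dividing by it pointwise is impossible; it is cancelled as a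
  nonzero function polynomial along lines. Then \<open>pull\<close> carries the result from the
  annihilator to \<open>X\<close>.\<close>

lemma symbol_relation_unique:
  fixes E :: "'a::euclidean_space set"
  assumes X: "subspace X" and E: "independent E" "span E \<subseteq> X" and \<K>: "\<K> \<subseteq> Pow E"
    and poly: "\<And>J. J \<in> \<K> \<Longrightarrow> poly_on_lines X (x J)"
    and pull: "\<And>J \<xi>. J \<in> \<K> \<Longrightarrow> \<xi> \<in> X \<Longrightarrow> x J (proj (quot X (span (E - J))) \<xi>) = x J \<xi>"
    and rel: "\<And>\<xi>. \<xi> \<in> X \<Longrightarrow> (\<Sum>J\<in>\<K>. x J \<xi> * (\<Prod>e\<in>J. - (\<xi> \<bullet> e))) = 0"
    and K: "K \<in> \<K>" and \<xi>: "\<xi> \<in> X"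
  shows "x K \<xi> = 0"
  using K \<xi>
proof (induction "card K" arbitrary: K \<xi> rule: less_induct)
  case less
  have finE: "finite E" using E(1) by (rule independent_imp_finite)
  have KE: "K \<subseteq> E" and finK: "finite K" using less.prems \<K> finE finite_subset by blast+
  have fin\<K>: "finite \<K>" using \<K> finE by (simp add: finite_subset)
  let ?W = "quot X (span (E - K))"
  have W: "subspace ?W" using X by (rule subspace_quot)
  have WX: "?W \<subseteq> X" by (auto simp: quot_def)
  have zero: "(\<Prod>e\<in>K. - (\<xi> \<bullet> e)) * x K \<xi> = 0" if \<xi>: "\<xi> \<in> ?W" for \<xi>
  proof -
    have "(\<Sum>J\<in>\<K> - {K}. x J \<xi> * (\<Prod>e\<in>J. - (\<xi> \<bullet> e))) = 0"
    proof (rule sum.neutral, intro ballI)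
      fix J assume J: "J \<in> \<K> - {K}"
      then have JE: "J \<subseteq> E" using \<K> by auto
      show "x J \<xi> * (\<Prod>e\<in>J. - (\<xi> \<bullet> e)) = 0"
      proof (cases "J \<subseteq> K")
        case True
        then have "card J < card K" using J finK by (intro psubset_card_mono) auto
        then have "x J \<xi> = 0" using less.hyps J \<xi> WX by auto
        then show ?thesis by simp
      next
        case False
        then obtain e where e: "e \<in> J" "e \<notin> K" by auto
        then have "\<xi> \<bullet> e = 0" using quot_inner[OF \<xi>, of e] JE by (auto simp: span_base)
        moreover have "finite J" using JE finE finite_subset by blast
        ultimately show ?thesis using e(1) by (auto simp: prod_zero_iff)
      qed
    qed
    then show ?thesis
      using rel[of \<xi>] \<xi> WX sum.remove[OF fin\<K> less.prems(1), of "\<lambda>J. x J \<xi> * (\<Prod>e\<in>J. - (\<xi> \<bullet> e))"]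
      by (auto simp: mult.commute)
  qed
  \<comment> \<open>A point of the annihilator at which the product over \<open>K\<close> is
    nonzero, as the cancellation requires.\<close>
  obtain \<xi>0 where \<xi>0: "\<xi>0 \<in> span E" "\<And>e. e \<in> E \<Longrightarrow> \<xi>0 \<bullet> e = (if e \<in> K then 1 else 0)"
    using ex_inner_eq[OF E(1), of "\<lambda>e. if e \<in> K then 1 else 0"] by auto
  have "\<xi>0 \<bullet> v = 0" if "v \<in> span (E - K)" for v
    using that
  proof (induction rule: span_induct)
    case base
    show ?case by (auto simp: subspace_def inner_simps)
  qed (use \<xi>0(2) in auto)
  then have \<xi>0W: "\<xi>0 \<in> ?W"
    using \<xi>0(1) E(2) by (auto simp: quot_def orthogonal_comp_def orthogonal_def inner_commute)
  have "x K (proj ?W \<xi>) = 0"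
  proof (rule poly_on_lines_zero_product[OF W _ _ \<xi>0W _ zero proj_in[OF W]])
    show "poly_on_lines ?W (\<lambda>\<xi>. \<Prod>e\<in>K. - (\<xi> \<bullet> e))"
      by (intro poly_on_lines_prod poly_on_lines_uminus poly_on_lines_inner)
    show "poly_on_lines ?W (x K)"
      using poly[OF less.prems(1)] WX unfolding poly_on_lines_def by blast
    show "(\<Prod>e\<in>K. - (\<xi>0 \<bullet> e)) \<noteq> 0" using \<xi>0(2) KE finK by (auto simp: prod_zero_iff)
  qed
  then show ?case using pull less.prems by simp
qed


subsection \<open>Exponential sums and integrals of simplicial cones as germs\<close>

lemma analytic_prod:
  assumes B: "independent B" "G \<subseteq> B" and r: "r > 0"
    and \<phi>: "\<And>z. \<bar>z\<bar> < r \<Longrightarrow> ((\<lambda>n. a n * z ^ n) has_sum \<phi> z) UNIV"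
  shows "analytic_at0 (span B) (\<lambda>\<xi>. \<Prod>g\<in>G. \<phi> (\<xi> \<bullet> g))"
proof -
  have fin: "finite B" using B(1) by (rule independent_imp_finite)
  \<comment> \<open>Basis vectors outside \<open>G\<close> contribute the constant series 1, which
    turns the product into an expansion in all coordinates of \<open>B\<close>.\<close>
  define a' where "a' b n = (if b \<in> G then a n else if n = 0 then 1 else 0)" for b n
  define \<phi>' where "\<phi>' b z = (if b \<in> G then \<phi> z else 1)" for b z
  have one: "((\<lambda>n. (if n = 0 then 1 else 0) * z ^ n) has_sum 1) (UNIV :: nat set)" for z :: real
    by (subst has_sum_cong_neutral[where T = "{0}" and g = "\<lambda>_. 1"]) (auto simp: has_sum_finite_iff)
  have "has_taylor B (\<lambda>\<alpha>. \<Prod>b\<in>B. a' b (\<alpha> b)) (\<lambda>\<xi>. \<Prod>b\<in>B. \<phi>' b (\<xi> \<bullet> b))"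
  proof (rule has_taylor_prod[OF fin r])
    show "((\<lambda>n. a' b n * z ^ n) has_sum \<phi>' b z) UNIV" if "\<bar>z\<bar> < r" for b z
      using \<phi>[OF that] one[of z] by (cases "b \<in> G") (auto simp: a'_def \<phi>'_def)
  qed
  moreover have "(\<Prod>b\<in>B. \<phi>' b (\<xi> \<bullet> b)) = (\<Prod>g\<in>G. \<phi> (\<xi> \<bullet> g))" for \<xi>
    using fin B(2) by (intro prod.mono_neutral_cong_right) (auto simp: \<phi>'_def)
  ultimately show ?thesis unfolding analytic_at0_def using B(1) by auto
qed

lemma nonzero_germ_prod_linear:
  assumes B: "independent B" "G \<subseteq> B"
  shows "nonzero_germ (span B) (\<lambda>\<xi>. \<Prod>g\<in>G. - (\<xi> \<bullet> g))"
proof -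
  have lin: "((\<lambda>n. (if n = 1 then -1 else 0) * z ^ n) has_sum - z) (UNIV :: nat set)" for z :: real
    by (subst has_sum_cong_neutral[where T = "{1}" and g = "\<lambda>_. - z"]) (auto simp: has_sum_finite_iff)
  have "analytic_at0 (span B) (\<lambda>\<xi>. \<Prod>g\<in>G. - (\<xi> \<bullet> g))"
    by (rule analytic_prod[OF B zero_less_one lin])
  moreover have "\<not> (\<forall>\<^sub>F \<xi> in near0 (span B). (\<Prod>g\<in>G. - (\<xi> \<bullet> g)) = 0)"
  proof
    assume "\<forall>\<^sub>F \<xi> in near0 (span B). (\<Prod>g\<in>G. - (\<xi> \<bullet> g)) = 0"
    then obtain e where e: "e > 0" "\<And>\<xi>. \<xi> \<in> span B \<Longrightarrow> norm \<xi> < e \<Longrightarrow> (\<Prod>g\<in>G. - (\<xi> \<bullet> g)) = 0"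
      unfolding eventually_near0 by blast
    \<comment> \<open>All pairings equal 1; scaling by \<open>t\<close> moves the point into the
      ball without making any factor zero.\<close>
    obtain \<xi> where \<xi>: "\<xi> \<in> span B" "\<And>b. b \<in> B \<Longrightarrow> \<xi> \<bullet> b = 1"
      using ex_inner_eq[OF B(1), of "\<lambda>_. 1"] by auto
    define t where "t = e / (2 * (norm \<xi> + 1))"
    have n: "norm \<xi> + 1 > 0" by (simp add: add_nonneg_pos)
    have t: "t > 0" unfolding t_def using e(1) n by (intro divide_pos_pos) auto
    have "norm (t *\<^sub>R \<xi>) < e"
    proof -
      have "norm (t *\<^sub>R \<xi>) = t * norm \<xi>" using t by simp
      also have "\<dots> \<le> t * (norm \<xi> + 1)" using t by simp
      also have "\<dots> = e / 2" using n by (simp add: t_def field_simps)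
      finally show ?thesis using e(1) by simp
    qed
    then have "(\<Prod>g\<in>G. - (t *\<^sub>R \<xi> \<bullet> g)) = 0" using \<xi>(1) by (intro e(2) span_scale)
    moreover have "finite G" using B independent_imp_finite finite_subset by blast
    ultimately show False using \<xi>(2) B(2) t by (auto simp: prod_zero_iff)
  qed
  ultimately show ?thesis unfolding nonzero_germ_def by blast
qed

lemma is_exp_integral_cone:
  fixes B :: "'a::euclidean_space set"
  assumes B: "independent B" "G \<subseteq> B"
  shows "is_exp_integral (span B) (int_span B) (convex_cone hull G) (\<lambda>\<xi>. \<Prod>g\<in>G. - 1 / (\<xi> \<bullet> g))"
proof -
  have G: "independent G" using B independent_mono by blast
  have "((\<lambda>n. (if n = 0 then 1 else 0) * z ^ n) has_sum 1) (UNIV :: nat set)" for z :: real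
    by (subst has_sum_cong_neutral[where T = "{0}" and g = "\<lambda>_. 1"]) (auto simp: has_sum_finite_iff)
  then have one: "analytic_at0 (span B) (\<lambda>\<xi>. 1)"
    using analytic_prod[OF B zero_less_one, of "\<lambda>n. if n = 0 then 1 else 0" "\<lambda>_. 1"] by simp
  have "(\<Prod>g\<in>G. - 1 / (\<xi> \<bullet> g)) = 1 / (\<Prod>g\<in>G. - (\<xi> \<bullet> g))" for \<xi>
  proof -
    have "(\<Prod>g\<in>G. - 1 / (\<xi> \<bullet> g)) = (\<Prod>g\<in>G. 1 / - (\<xi> \<bullet> g))" by (rule prod.cong) auto
    also have "\<dots> = 1 / (\<Prod>g\<in>G. - (\<xi> \<bullet> g))" unfolding prod_dividef by simp
    finally show ?thesis .
  qed
  then have "meromorphic_at0 (span B) (\<lambda>\<xi>. \<Prod>g\<in>G. - 1 / (\<xi> \<bullet> g))"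
    unfolding meromorphic_at0_def using one nonzero_germ_prod_linear[OF B]
    by (intro exI[of _ "\<lambda>_. 1"] exI[of _ "\<lambda>\<xi>. \<Prod>g\<in>G. - (\<xi> \<bullet> g)"]) simp_all
  moreover have "set_integrable (hull_measure (int_span B) (convex_cone hull G)) (convex_cone hull G) (\<lambda>x. exp (\<xi> \<bullet> x)) \<Longrightarrow>
      (\<Prod>g\<in>G. - 1 / (\<xi> \<bullet> g)) = integral_over (int_span B) (convex_cone hull G) (\<lambda>x. exp (\<xi> \<bullet> x))" for \<xi>
    unfolding integral_over_def hull_measure_cone[OF G int_span_subbasis[OF B]]
    using set_integrable_exp_cone[OF G] set_integral_exp_cone[OF G] by simp
  ultimately show ?thesis
    unfolding is_exp_integral_def using no_line_simplicial_cone[OF G] by simp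
qed

text \<open>Integral nonnegative coordinates are natural numbers; the floor in the inverse map
  merely converts types.\<close>

lemma cone_lattice_points:
  fixes B :: "'a::euclidean_space set"
  assumes B: "independent B" "E \<subseteq> B"
  shows "bij_betw (\<lambda>\<alpha>. \<Sum>e\<in>E. real (\<alpha> e) *\<^sub>R e) (multi_indices E) (convex_cone hull E \<inter> int_span B)"
proof (rule bij_betwI[of _ _ _ "\<lambda>x e. if e \<in> E then nat \<lfloor>x \<bullet> dual_vec E e\<rfloor> else 0"])
  have E: "independent E" using B independent_mono by blast
  have eq: "convex_cone hull E \<inter> int_span B = convex_cone hull E \<inter> int_span E"
    using int_span_subbasis[OF B] simplicial_cone_iff[OF E] by blast
  show "(\<lambda>\<alpha>. \<Sum>e\<in>E. real (\<alpha> e) *\<^sub>R e) \<in> multi_indices E \<rightarrow> convex_cone hull E \<inter> int_span B"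
    unfolding eq simplicial_cone_iff[OF E] int_span_mem_iff[OF E] Int_iff
    by (auto simp: inner_dual_vec_sum[OF E] simplicial_cone_iff[OF E] int_span_mem_iff[OF E]
        span_base intro!: span_sum span_scale)
  show "(\<lambda>x e. if e \<in> E then nat \<lfloor>x \<bullet> dual_vec E e\<rfloor> else 0) \<in> convex_cone hull E \<inter> int_span B \<rightarrow> multi_indices E"
    by (auto simp: multi_indices_def)
  show "(\<lambda>e. if e \<in> E then nat \<lfloor>(\<Sum>e\<in>E. real (\<alpha> e) *\<^sub>R e) \<bullet> dual_vec E e\<rfloor> else 0) = \<alpha>"
    if "\<alpha> \<in> multi_indices E" for \<alpha>
    using that by (auto simp: fun_eq_iff inner_dual_vec_sum[OF E] multi_indices_def)
  fix x assume "x \<in> convex_cone hull E \<inter> int_span B"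
  then have x: "x \<in> span E" "\<And>e. e \<in> E \<Longrightarrow> 0 \<le> x \<bullet> dual_vec E e" "\<And>e. e \<in> E \<Longrightarrow> x \<bullet> dual_vec E e \<in> \<int>"
    unfolding eq by (auto simp: simplicial_cone_iff[OF E] int_span_mem_iff[OF E])
  have "(\<Sum>e\<in>E. real (if e \<in> E then nat \<lfloor>x \<bullet> dual_vec E e\<rfloor> else 0) *\<^sub>R e) = (\<Sum>e\<in>E. (x \<bullet> dual_vec E e) *\<^sub>R e)"
    using x(2,3) by (intro sum.cong) (auto simp: of_nat_nat of_int_floor_cancel)
  then show "(\<Sum>e\<in>E. real (if e \<in> E then nat \<lfloor>x \<bullet> dual_vec E e\<rfloor> else 0) *\<^sub>R e) = x"
    using sum_dual_vec[OF E x(1)] by simp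
qed

lemma todd_eq: "z \<noteq> 0 \<Longrightarrow> todd z / - z = 1 / (1 - exp z)"
  by (simp add: todd_def divide_simps)

text \<open>A product of geometric series over the generators. The value is required wherever the
  series converges, so convergence has to be shown to force all pairings to be negative.\<close>

lemma is_exp_sum_cone:
  fixes B :: "'a::euclidean_space set"
  assumes B: "independent B" "E \<subseteq> B"
  shows "is_exp_sum (span B) (int_span B) (convex_cone hull E) (\<lambda>\<xi>. \<Prod>e\<in>E. 1 / (1 - exp (\<xi> \<bullet> e)))"
proof -
  have E: "independent E" using B independent_mono by blast
  have fin: "finite E" using E by (rule independent_imp_finite)
  obtain r where r: "r > 0" "\<And>z. \<bar>z\<bar> < r \<Longrightarrow> ((\<lambda>n. todd_coeff n * z ^ n) has_sum todd z) UNIV"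
    using todd_has_sum by blast
  have "(\<Prod>e\<in>E. 1 / (1 - exp (\<xi> \<bullet> e))) = (\<Prod>e\<in>E. todd (\<xi> \<bullet> e)) / (\<Prod>e\<in>E. - (\<xi> \<bullet> e))"
    if "(\<Prod>e\<in>E. - (\<xi> \<bullet> e)) \<noteq> 0" for \<xi>
    unfolding prod_dividef[symmetric] using that fin by (intro prod.cong refl todd_eq[symmetric]) (auto simp: prod_zero_iff)
  then have mero: "meromorphic_at0 (span B) (\<lambda>\<xi>. \<Prod>e\<in>E. 1 / (1 - exp (\<xi> \<bullet> e)))"
    unfolding meromorphic_at0_def
    using analytic_prod[OF B r] nonzero_germ_prod_linear[OF B]
    by (intro exI[of _ "\<lambda>\<xi>. \<Prod>e\<in>E. todd (\<xi> \<bullet> e)"] exI[of _ "\<lambda>\<xi>. \<Prod>e\<in>E. - (\<xi> \<bullet> e)"]) auto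
  have sum: "(\<Prod>e\<in>E. 1 / (1 - exp (\<xi> \<bullet> e))) = (\<Sum>\<^sub>\<infinity>\<gamma>\<in>convex_cone hull E \<inter> int_span B. exp (\<xi> \<bullet> \<gamma>))"
    if summ: "(\<lambda>\<gamma>. exp (\<xi> \<bullet> \<gamma>)) summable_on (convex_cone hull E \<inter> int_span B)" for \<xi>
  proof -
    note bij = cone_lattice_points[OF B]
    have exp_eq: "exp (\<xi> \<bullet> (\<Sum>e\<in>E. real (\<alpha> e) *\<^sub>R e)) = (\<Prod>e\<in>E. exp (\<xi> \<bullet> e) ^ \<alpha> e)" for \<alpha>
      by (simp add: inner_sum_right exp_sum[OF fin] exp_of_nat_mult)
    have summ': "(\<lambda>\<alpha>. \<Prod>e\<in>E. exp (\<xi> \<bullet> e) ^ \<alpha> e) summable_on multi_indices E"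
      using summ summable_on_reindex_bij_betw[OF bij, of "\<lambda>\<gamma>. exp (\<xi> \<bullet> \<gamma>)"] by (simp add: exp_eq)
    \<comment> \<open>Restricting the summable family to the multiples of one generator leaves a
      geometric series.\<close>
    have neg: "\<xi> \<bullet> e < 0" if e: "e \<in> E" for e
    proof -
      define f where "f n = (\<lambda>e'. if e' = e then n else 0)" for n :: nat
      have "inj f" by (rule injI) (metis f_def)
      have "(\<lambda>\<alpha>. \<Prod>e\<in>E. exp (\<xi> \<bullet> e) ^ \<alpha> e) summable_on range f"
        by (rule summable_on_subset_banach[OF summ']) (use e in \<open>auto simp: f_def multi_indices_def\<close>)
      then have "(\<lambda>n. \<Prod>e\<in>E. exp (\<xi> \<bullet> e) ^ f n e) summable_on UNIV"
        using summable_on_reindex[OF \<open>inj f\<close>, of "\<lambda>\<alpha>. \<Prod>e\<in>E. exp (\<xi> \<bullet> e) ^ \<alpha> e"]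
        by (simp only: o_def)
      moreover have "(\<Prod>e'\<in>E. exp (\<xi> \<bullet> e') ^ f n e') = exp (\<xi> \<bullet> e) ^ n" for n
        using e fin by (simp add: f_def prod.remove[of E e])
      ultimately have "summable (\<lambda>n. exp (\<xi> \<bullet> e) ^ n)"
        by (simp add: summable_on_UNIV_nonneg_real_iff)
      then show ?thesis by (simp add: summable_geometric_iff)
    qed
    have "((\<lambda>\<alpha>. \<Prod>e\<in>E. exp (\<xi> \<bullet> e) ^ \<alpha> e) has_sum (\<Prod>e\<in>E. 1 / (1 - exp (\<xi> \<bullet> e)))) (multi_indices E)"
    proof (rule has_sum_prod_multi_indices[OF fin])
      fix e assume "e \<in> E"
      then have "norm (exp (\<xi> \<bullet> e)) < 1" using neg by simp
      then show "((\<lambda>n. exp (\<xi> \<bullet> e) ^ n) has_sum 1 / (1 - exp (\<xi> \<bullet> e))) UNIV"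
        by (intro norm_summable_imp_has_sum geometric_sums) (auto simp: norm_power summable_geometric_iff)
    qed
    then have "((\<lambda>\<gamma>. exp (\<xi> \<bullet> \<gamma>)) has_sum (\<Prod>e\<in>E. 1 / (1 - exp (\<xi> \<bullet> e)))) (convex_cone hull E \<inter> int_span B)"
      using has_sum_reindex_bij_betw[OF bij, of "\<lambda>\<gamma>. exp (\<xi> \<bullet> \<gamma>)"] by (simp add: exp_eq)
    then show ?thesis by (simp add: infsumI)
  qed
  show ?thesis
    unfolding is_exp_sum_def using no_line_simplicial_cone[OF E] mero sum by simp
qed


subsection \<open>Quotients and transverse cones\<close>

lemma quot_in_rational_quotients:
  fixes B :: "'a::euclidean_space set"
  assumes B: "independent B" "G \<subseteq> B"
  shows "quot X (span G) \<in> rational_quotients X (int_span B)"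
proof -
  have "independent G" using B independent_mono by blast
  then have "integral_basis (span G \<inter> int_span B) G"
    by (simp add: integral_basis_def int_span_subbasis[OF B] independent_imp_finite)
  then have "rational_subspace (int_span B) (span G)"
    by (auto simp: rational_subspace_def lattice_in_def)
  then show ?thesis by (auto simp: rational_quotients_def)
qed

lemma quot_span_empty: "quot X (span {}) = X"
  by (auto simp: quot_def orthogonal_comp_def orthogonal_def)

lemma proj_quot_eq_0:
  assumes "subspace X" "u \<in> span G"
  shows "proj (quot X (span G)) u = 0"
  by (rule proj_eq_0[OF subspace_quot[OF assms(1)]])
     (use quot_inner[OF _ assms(2)] in \<open>auto simp: inner_commute\<close>)

text \<open>The projection kills the affine hull of the face as well as every vector of the face
  that is subtracted, so only the image of the cone is left.\<close>

lemma transverse_simplicial_cone: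
  assumes X: "subspace X"
  shows "transverse_cone X (convex_cone hull E) (convex_cone hull G) =
    proj (quot X (span G)) ` (convex_cone hull E)"
proof -
  let ?P = "proj (quot X (span G))" and ?C = "convex_cone hull E" and ?F = "convex_cone hull G"
  let ?D = "{y - x | x y. y \<in> ?C \<and> x \<in> ?F}"
  have W: "subspace (quot X (span G))" by (rule subspace_quot[OF X])
  note lin = linear_proj[OF W]
  have aff: "affine hull ?F \<subseteq> span G"
    by (rule hull_minimal) (use span_superset[of ?F] in \<open>auto simp: span_convex_cone_hull subspace_imp_affine\<close>)
  have D: "convex_cone hull ?D \<subseteq> {c. ?P c \<in> ?P ` ?C}"
  proof (rule hull_minimal)
    have "?P (y - x) = ?P y" if "x \<in> ?F" for x y
    proof -
      have "x \<in> span G" using that span_superset[of ?F] by (auto simp: span_convex_cone_hull)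
      then show ?thesis using proj_quot_eq_0[OF X] by (simp add: linear_diff[OF lin])
    qed
    then show "?D \<subseteq> {c. ?P c \<in> ?P ` ?C}" by auto
    have "convex_cone (?P ` ?C)"
      using convex_cone_linear_image[of ?C ?P] lin convex_cone_convex_cone_hull by blast
    then show "convex_cone {c. ?P c \<in> ?P ` ?C}"
      unfolding convex_cone_iff by (auto simp: linear_add[OF lin] linear_cmul[OF lin] linear_0[OF lin])
  qed
  have "?P ` {u + c | u c. u \<in> affine hull ?F \<and> c \<in> convex_cone hull ?D} = ?P ` ?C"
  proof (intro equalityI subsetI)
    fix z assume "z \<in> ?P ` {u + c | u c. u \<in> affine hull ?F \<and> c \<in> convex_cone hull ?D}"
    then obtain u c where "z = ?P (u + c)" "u \<in> affine hull ?F" "c \<in> convex_cone hull ?D" by auto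
    moreover have "?P u = 0" using aff \<open>u \<in> affine hull ?F\<close> by (intro proj_quot_eq_0[OF X]) blast
    moreover have "?P c \<in> ?P ` ?C" using subsetD[OF D \<open>c \<in> convex_cone hull ?D\<close>] by simp
    ultimately show "z \<in> ?P ` ?C" by (simp add: linear_add[OF lin])
  next
    fix z assume "z \<in> ?P ` ?C"
    then obtain y where y: "z = ?P y" "y \<in> ?C" by auto
    have "y - 0 \<in> ?D" using y(2) convex_cone_hull_contains_0 by blast
    then have "y \<in> convex_cone hull ?D" by (simp add: hull_inc)
    moreover have "0 \<in> affine hull ?F" by (intro hull_inc convex_cone_hull_contains_0)
    ultimately have "0 + y \<in> {u + c | u c. u \<in> affine hull ?F \<and> c \<in> convex_cone hull ?D}" by blast
    then show "z \<in> ?P ` {u + c | u c. u \<in> affine hull ?F \<and> c \<in> convex_cone hull ?D}"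
      unfolding y(1) by (metis (no_types, lifting) add_0 imageI)
  qed
  then show ?thesis by (simp add: transverse_cone_def Lin_convex_cone_hull)
qed

lemma rational_affine_cone_image:
  fixes E :: "'a::euclidean_space set"
  assumes W: "subspace W" and E: "finite E" "E \<subseteq> \<Lambda>" and zero: "0 \<in> \<Lambda>"
  shows "rational_affine_cone (proj W ` \<Lambda>) (proj W ` (convex_cone hull E))"
proof -
  note lin = linear_proj[OF W]
  have "proj W ` (convex_cone hull E) = convex_cone hull (proj W ` E)"
    using convex_cone_hull_linear_image[OF lin] by simp
  then have "rational_cone (proj W ` \<Lambda>) (proj W ` (convex_cone hull E))"
    unfolding rational_cone_def using E by (intro exI[of _ "proj W ` E"]) auto
  moreover have "0 \<in> rational_points (proj W ` \<Lambda>)"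
    using zero linear_0[OF lin] unfolding rational_points_def by (force intro: exI[of _ 1])
  ultimately show ?thesis unfolding rational_affine_cone_def by force
qed


subsection \<open>The symbol relation for the Berline--Vergne family\<close>

lemma taylor_part_proj: "taylor_part E c k (proj (span E) \<xi>) = taylor_part E c k \<xi>"
  unfolding taylor_part_def
  by (intro sum.cong refl arg_cong2[of _ _ _ _ "(*)"] prod.cong arg_cong2[of _ _ _ _ "(^)"])
     (simp add: proj_inner span_base)

text \<open>The Taylor expansion lives on \<open>span E\<close>. The function depends only on
  pairings with \<open>E\<close>, which projecting to \<open>span E\<close> preserves, so the
  expansion pulls back to \<open>X\<close>.\<close>

lemma todd_line_expansion:
  fixes E :: "'a::euclidean_space set"
  assumes E: "independent E"
  shows "line_expansion X (\<lambda>\<xi>. \<Prod>e\<in>E. todd (\<xi> \<bullet> e)) (\<lambda>\<xi>. Abs_fps (\<lambda>k. todd_part E k \<xi>))"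
proof -
  have fin: "finite E" using E by (rule independent_imp_finite)
  obtain r where r: "r > 0" "\<And>z. \<bar>z\<bar> < r \<Longrightarrow> ((\<lambda>n. todd_coeff n * z ^ n) has_sum todd z) UNIV"
    using todd_has_sum by blast
  have "has_taylor E (\<lambda>\<nu>. \<Prod>e\<in>E. todd_coeff (\<nu> e)) (\<lambda>\<xi>. \<Prod>e\<in>E. todd (\<xi> \<bullet> e))"
    by (rule has_taylor_prod[OF fin r(1)]) (rule r(2))
  from line_expansion_proj[OF subspace_span has_taylor_line_expansion[OF fin this], of X]
  have "line_expansion X (\<lambda>\<xi>. \<Prod>e\<in>E. todd (proj (span E) \<xi> \<bullet> e)) (\<lambda>\<xi>. Abs_fps (\<lambda>k. todd_part E k \<xi>))"
    by (simp only: taylor_part_proj todd_part_def)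
  moreover have "(\<Prod>e\<in>E. todd (proj (span E) \<xi> \<bullet> e)) = (\<Prod>e\<in>E. todd (\<xi> \<bullet> e))" for \<xi>
    by (intro prod.cong refl) (simp add: proj_inner span_base)
  ultimately show ?thesis by simp
qed

text \<open>As \<open>C(J)\<close> has linear span \<open>span (E - J)\<close>, this is the symbol
  of the Berline--Vergne operator of that face, taken in degree \<open>k\<close>.\<close>

definition bv_part ::
    "'a::euclidean_space set \<Rightarrow> ('a set \<Rightarrow> 'a set \<Rightarrow> 'a \<Rightarrow> real) \<Rightarrow> 'a set \<Rightarrow> nat \<Rightarrow> 'a set \<Rightarrow> 'a \<Rightarrow> real" where
  "bv_part X \<mu> E k J \<xi> =
     homogeneous_part k (\<mu> (quot X (span (E - J))) (proj (quot X (span (E - J))) ` (convex_cone hull E)))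
       (proj (quot X (span (E - J))) \<xi>)"

text \<open>The axioms give a Taylor expansion in a basis of the projected lattice, whose span is
  the whole quotient; its parts are the homogeneous parts, and they pull back to
  \<open>X\<close>.\<close>

lemma bv_line_expansion:
  fixes B E :: "'a::euclidean_space set"
  assumes B: "independent B" "E \<subseteq> B" "span B = X" and \<mu>: "berline_vergne_family X (int_span B) \<mu>"
  defines "W \<equiv> \<lambda>J. quot X (span (E - J))"
  shows "line_expansion X (\<lambda>\<xi>. \<mu> (W J) (proj (W J) ` (convex_cone hull E)) (proj (W J) \<xi>))
    (\<lambda>\<xi>. Abs_fps (\<lambda>k. bv_part X \<mu> E k J \<xi>))"
proof -
  have X: "subspace X" using B(3) subspace_span by blast
  have W: "subspace (W J)" unfolding W_def by (rule subspace_quot[OF X])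
  have finB: "finite B" using B(1) by (rule independent_imp_finite)
  let ?a = "proj (W J) ` (convex_cone hull E)"
  have "rational_affine_cone (proj (W J) ` int_span B) ?a"
  proof (rule rational_affine_cone_image[OF W])
    show "finite E" using finB B(2) finite_subset by blast
    show "E \<subseteq> int_span B"
      using B(2) by (auto simp: int_span_mem_iff[OF B(1)] span_base dual_vec_inner[OF B(1)])
    show "0 \<in> int_span B" by (auto simp: int_span_mem_iff[OF B(1)] span_zero)
  qed
  moreover have "W J \<in> rational_quotients X (int_span B)"
    unfolding W_def using B by (intro quot_in_rational_quotients) auto
  ultimately have "rational_analytic_at0 (proj (W J) ` int_span B) (\<mu> (W J) ?a)"
    using \<mu> unfolding berline_vergne_family_def by blast
  then obtain B' c where B': "finite B'" "proj (W J) ` int_span B = int_span B'" "has_taylor B' c (\<mu> (W J) ?a)"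
    unfolding rational_analytic_at0_def integral_basis_def by blast
  have "span B' = span (proj (W J) ` int_span B)" using B'(2) span_int_span[OF B'(1)] by simp
  also have "\<dots> = proj (W J) ` X"
    using linear_span_image[OF linear_proj[OF W], of "int_span B"] span_int_span[OF finB] B(3) by simp
  also have "\<dots> = W J"
  proof
    show "proj (W J) ` X \<subseteq> W J" using proj_in[OF W] by auto
    show "W J \<subseteq> proj (W J) ` X"
    proof
      fix w assume w: "w \<in> W J"
      then have "w \<in> X" by (auto simp: W_def quot_def)
      then show "w \<in> proj (W J) ` X" using proj_ident[OF W w] by force
    qed
  qed
  finally have "line_expansion (W J) (\<mu> (W J) ?a) (\<lambda>\<xi>. Abs_fps (\<lambda>k. taylor_part B' c k \<xi>))"
    using has_taylor_line_expansion[OF B'(1,3)] by simp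
  note le = this
  have "bv_part X \<mu> E k J \<xi> = taylor_part B' c k (proj (W J) \<xi>)" for k \<xi>
    using line_expansion_homogeneous_part[OF le proj_in[OF W]] by (simp add: bv_part_def W_def)
  then show ?thesis using line_expansion_proj[OF W le, of X] by simp
qed

text \<open>With denominators cleared, the equality of meromorphic germs says that \<open>h\<close>
  times two nonzero germs vanishes near 0. Both factors are cancelled in the line expansions, and
  the coefficient of degree \<open>n\<close> is the claim.\<close>

lemma bv_relation:
  fixes B E :: "'a::euclidean_space set"
  assumes B: "independent B" "E \<subseteq> B" "span B = X" and \<mu>: "berline_vergne_family X (int_span B) \<mu>"
    and \<xi>: "\<xi> \<in> X"
  shows "(\<Sum>J | J \<subseteq> E \<and> card J \<le> n. bv_part X \<mu> E (n - card J) J \<xi> * (\<Prod>e\<in>J. - (\<xi> \<bullet> e))) = todd_part E n \<xi>"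
proof -
  have E: "independent E" using B independent_mono by blast
  have finE: "finite E" using E by (rule independent_imp_finite)
  have X: "subspace X" using B(3) subspace_span by blast
  let ?C = "convex_cone hull E" and ?\<Lambda> = "int_span B"
  let ?W = "\<lambda>J. quot X (span (E - J))"
  define m where "m J \<xi> = \<mu> (?W J) (proj (?W J) ` ?C) (proj (?W J) \<xi>)" for J \<xi>
  define S where "S \<xi> = (\<Prod>e\<in>E. 1 / (1 - exp (\<xi> \<bullet> e)))" for \<xi>
  \<comment> \<open>The axiom indexes integrals by faces as sets; \<open>E \<inter> F\<close>
    recovers the generators of \<open>F\<close>.\<close>
  define I where "I F \<xi> = (\<Prod>e\<in>E \<inter> F. - 1 / (\<xi> \<bullet> e))" for F \<xi>
  have gens: "E \<inter> convex_cone hull G = G" if "G \<subseteq> E" for G using gens_in_subcone[OF E that] .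
  have projX: "proj X ` ?\<Lambda> = ?\<Lambda>"
  proof -
    have "proj X x = x" if "x \<in> ?\<Lambda>" for x
      using that B(3) by (intro proj_ident[OF X]) (auto simp: int_span_mem_iff[OF B(1)])
    then show ?thesis by simp
  qed
  have "rational_affine_cone (proj X ` ?\<Lambda>) (proj X ` ?C)"
  proof (rule rational_affine_cone_image[OF X finE])
    show "E \<subseteq> ?\<Lambda>"
      using B(2) by (auto simp: int_span_mem_iff[OF B(1)] span_base dual_vec_inner[OF B(1)])
    show "0 \<in> ?\<Lambda>" by (auto simp: int_span_mem_iff[OF B(1)] span_zero)
  qed
  moreover have "proj X ` ?C = ?C"
  proof -
    have "proj X x = x" if "x \<in> ?C" for x
      using that simplicial_cone_iff[OF E] span_mono[OF B(2)] B(3) by (intro proj_ident[OF X]) auto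
    then show ?thesis by simp
  qed
  ultimately have cone: "rational_affine_cone (proj X ` ?\<Lambda>) ?C" by simp
  \<comment> \<open>\<open>X\<close> is its own quotient by the zero subspace, the span of the empty
    set.\<close>
  have XQ: "X \<in> rational_quotients X ?\<Lambda>"
    using quot_in_rational_quotients[OF B(1), of "{}" X] by (simp only: quot_span_empty empty_subsetI)
  have exp_S: "is_exp_sum X (proj X ` ?\<Lambda>) ?C S"
    using is_exp_sum_cone[OF B(1,2)] by (simp add: S_def[abs_def] projX B(3))
  have exp_I: "is_exp_integral X (proj X ` ?\<Lambda>) F (I F)" if "F \<in> faces ?C" for F
  proof -
    obtain G where G: "G \<subseteq> E" "F = convex_cone hull G"
      using \<open>F \<in> faces ?C\<close> faces_simplicial_cone[OF E] by auto
    then show ?thesis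
      using is_exp_integral_cone[OF B(1), of G] B(2,3) by (auto simp: I_def[abs_def] gens projX)
  qed
  have "mero_eq X S (\<lambda>\<xi>. \<Sum>F\<in>faces ?C. \<mu> (quot X (Lin F)) (transverse_cone X ?C F) (proj (quot X (Lin F)) \<xi>) * I F \<xi>)"
    using \<mu> XQ cone exp_S exp_I unfolding berline_vergne_family_def by blast
  also have "(\<lambda>\<xi>. \<Sum>F\<in>faces ?C. \<mu> (quot X (Lin F)) (transverse_cone X ?C F) (proj (quot X (Lin F)) \<xi>) * I F \<xi>) =
    (\<lambda>\<xi>. \<Sum>J\<in>Pow E. m J \<xi> * (\<Prod>e\<in>E - J. - 1 / (\<xi> \<bullet> e)))"
  proof
    fix \<xi>
    let ?h = "\<lambda>F. \<mu> (quot X (Lin F)) (transverse_cone X ?C F) (proj (quot X (Lin F)) \<xi>) * I F \<xi>"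
    have bij: "bij_betw (\<lambda>J. convex_cone hull (E - J)) (Pow E) (faces ?C)"
    proof (rule bij_betw_imageI)
      show "inj_on (\<lambda>J. convex_cone hull (E - J)) (Pow E)"
      proof (rule inj_onI)
        fix J J' assume "J \<in> Pow E" "J' \<in> Pow E" "convex_cone hull (E - J) = convex_cone hull (E - J')"
        moreover from this have "E - J = E - J'" by (metis Diff_subset gens)
        ultimately show "J = J'" by auto
      qed
      have "Pow E = (\<lambda>J. E - J) ` Pow E" by (auto intro!: image_eqI[of _ _ "E - _"])
      then show "(\<lambda>J. convex_cone hull (E - J)) ` Pow E = faces ?C"
        unfolding faces_simplicial_cone[OF E] by (metis image_image)
    qed
    have "(\<Sum>F\<in>faces ?C. ?h F) = (\<Sum>J\<in>Pow E. ?h (convex_cone hull (E - J)))"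
      by (rule sum.reindex_bij_betw[OF bij, symmetric])
    also have "\<dots> = (\<Sum>J\<in>Pow E. m J \<xi> * (\<Prod>e\<in>E - J. - 1 / (\<xi> \<bullet> e)))"
      by (intro sum.cong refl)
         (simp add: m_def I_def gens Lin_convex_cone_hull transverse_simplicial_cone[OF X])
    finally show "(\<Sum>F\<in>faces ?C. ?h F) = (\<Sum>J\<in>Pow E. m J \<xi> * (\<Prod>e\<in>E - J. - 1 / (\<xi> \<bullet> e)))" .
  qed
  finally obtain g where g: "nonzero_germ X g"
    and gS: "\<forall>\<^sub>F \<xi> in near0 X. g \<xi> \<noteq> 0 \<longrightarrow> S \<xi> = (\<Sum>J\<in>Pow E. m J \<xi> * (\<Prod>e\<in>E - J. - 1 / (\<xi> \<bullet> e)))"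
    unfolding mero_eq_def by blast
  obtain G \<xi>0 where G: "line_expansion X g G" "\<xi>0 \<in> X" "G \<xi>0 \<noteq> 0"
    using nonzero_germ_line_expansion[OF g] by blast
  define lin where "lin J \<xi> = (\<Prod>e\<in>J. - (\<xi> \<bullet> e))" for J and \<xi> :: 'a
  define h where "h \<xi> = (\<Prod>e\<in>E. todd (\<xi> \<bullet> e)) - (\<Sum>J\<in>Pow E. m J \<xi> * lin J \<xi>)" for \<xi>
  define LF where "LF J \<xi> = fps_const (lin J \<xi>) * fps_X ^ card J" for J \<xi>
  define H where "H \<xi> = Abs_fps (\<lambda>k. todd_part E k \<xi>) - (\<Sum>J\<in>Pow E. Abs_fps (\<lambda>k. bv_part X \<mu> E k J \<xi>) * LF J \<xi>)" for \<xi>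
  have linexp: "line_expansion X (lin J) (LF J)" if "J \<in> Pow E" for J
    unfolding lin_def[abs_def] LF_def[abs_def]
    using that finE finite_subset by (intro line_expansion_prod_linear) blast
  have h: "line_expansion X h H"
    unfolding h_def[abs_def] H_def[abs_def] m_def
    by (intro line_expansion_diff line_expansion_sum line_expansion_mult linexp
        todd_line_expansion[OF E] bv_line_expansion[OF B \<mu>])
  \<comment> \<open>Where \<open>g\<close> or a linear factor is zero, the product is zero anyway;
    so the identity has no exceptional set.\<close>
  have "\<forall>\<^sub>F \<xi> in near0 X. g \<xi> * (lin E \<xi> * h \<xi>) = 0"
    using gS
  proof (rule eventually_mono)
    fix \<xi> assume gS: "g \<xi> \<noteq> 0 \<longrightarrow> S \<xi> = (\<Sum>J\<in>Pow E. m J \<xi> * (\<Prod>e\<in>E - J. - 1 / (\<xi> \<bullet> e)))"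
    show "g \<xi> * (lin E \<xi> * h \<xi>) = 0"
    proof (cases "g \<xi> \<noteq> 0 \<and> lin E \<xi> \<noteq> 0")
      case True
      then have nz: "\<xi> \<bullet> e \<noteq> 0" if "e \<in> E" for e using that finE by (auto simp: lin_def prod_zero_iff)
      have "S \<xi> * lin E \<xi> = (\<Prod>e\<in>E. todd (\<xi> \<bullet> e))"
        unfolding S_def lin_def prod.distrib[symmetric]
        by (intro prod.cong refl) (use nz in \<open>simp add: todd_eq[symmetric]\<close>)
      moreover have "(\<Prod>e\<in>E - J. - 1 / (\<xi> \<bullet> e)) * lin E \<xi> = lin J \<xi>" if J: "J \<in> Pow E" for J
      proof -
        have "(\<Prod>e\<in>E - J. - 1 / (\<xi> \<bullet> e)) * (\<Prod>e\<in>E - J. - (\<xi> \<bullet> e)) = 1"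
          unfolding prod.distrib[symmetric] using nz by (intro prod.neutral) auto
        moreover have "lin E \<xi> = (\<Prod>e\<in>E - J. - (\<xi> \<bullet> e)) * lin J \<xi>"
          unfolding lin_def using prod.subset_diff[of J E] J finE by blast
        ultimately show ?thesis by (simp add: mult.assoc[symmetric])
      qed
      ultimately have "h \<xi> = 0"
        using gS True by (simp add: h_def sum_distrib_right mult.assoc flip: \<open>S \<xi> * lin E \<xi> = _\<close>)
      then show ?thesis by simp
    qed auto
  qed
  then have "G \<xi> * (LF E \<xi> * H \<xi>) = 0" if "\<xi> \<in> X" for \<xi>
    using line_expansion_mult_eq_0[OF X G(1) line_expansion_mult[OF linexp h]] that by auto
  \<comment> \<open>First \<open>g\<close> is cancelled, whose expansion is nonzero in direction
    \<open>\<xi>0\<close>; afterwards the product of the linear forms, nonzero in direction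
    \<open>\<xi>1\<close>.\<close>
  then have LFH: "LF E \<xi> * H \<xi> = 0" if "\<xi> \<in> X" for \<xi>
    using G(1) line_expansion_mult[OF linexp[of E] h] that unfolding line_expansion_def
    by (intro poly_on_lines_fps_zero_product[where G = G and H = "\<lambda>\<xi>. LF E \<xi> * H \<xi>" and ?\<xi>0.0 = \<xi>0 and W = X])
       (auto simp: X G(2,3))
  obtain \<xi>1 where \<xi>1: "\<xi>1 \<in> X" "LF E \<xi>1 \<noteq> 0"
  proof -
    obtain \<xi>1 where "\<xi>1 \<in> span E" "\<And>e. e \<in> E \<Longrightarrow> \<xi>1 \<bullet> e = 1" using ex_inner_eq[OF E, of "\<lambda>_. 1"] by auto
    then show ?thesis
      using span_mono[OF B(2)] B(3) finE by (intro that[of \<xi>1]) (auto simp: LF_def lin_def)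
  qed
  have "H \<xi> = 0"
    using linexp[of E] h unfolding line_expansion_def
    by (intro poly_on_lines_fps_zero_product[where G = "LF E" and H = H and ?\<xi>0.0 = \<xi>1 and W = X])
       (auto simp: X \<xi>1 \<xi> LFH simp del: mult_eq_0_iff)
  then have "fps_nth (H \<xi>) n = 0" by simp
  then have "todd_part E n \<xi> = (\<Sum>J\<in>Pow E. fps_nth (Abs_fps (\<lambda>k. bv_part X \<mu> E k J \<xi>) * LF J \<xi>) n)"
    by (simp add: H_def fps_sum_nth)
  also have "\<dots> = (\<Sum>J\<in>Pow E. if card J \<le> n then bv_part X \<mu> E (n - card J) J \<xi> * lin J \<xi> else 0)"
  proof (intro sum.cong refl)
    fix J
    \<comment> \<open>The power of \<open>fps_X\<close> shifts degrees: degree \<open>n\<close> of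
      the product comes from degree \<open>n - card J\<close>, and is zero if
      \<open>card J > n\<close>.\<close>
    have eq: "Abs_fps (\<lambda>k. bv_part X \<mu> E k J \<xi>) * LF J \<xi> =
      fps_const (lin J \<xi>) * (Abs_fps (\<lambda>k. bv_part X \<mu> E k J \<xi>) * fps_X ^ card J)"
      by (simp add: LF_def mult_ac)
    show "fps_nth (Abs_fps (\<lambda>k. bv_part X \<mu> E k J \<xi>) * LF J \<xi>) n =
      (if card J \<le> n then bv_part X \<mu> E (n - card J) J \<xi> * lin J \<xi> else 0)"
      unfolding eq fps_mult_left_const_nth fps_X_power_mult_right_nth by simp
  qed
  also have "\<dots> = (\<Sum>J\<in>{J \<in> Pow E. card J \<le> n}. bv_part X \<mu> E (n - card J) J \<xi> * lin J \<xi>)"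
    by (rule sum.inter_filter[symmetric]) (use finE in simp)
  finally show ?thesis by (simp add: lin_def)
qed


subsection \<open>The explicit operators\<close>

lemma const_coeff_op_homogeneous: "homogeneous_op V k D \<Longrightarrow> V \<subseteq> X \<Longrightarrow> const_coeff_op X D"
proof -
  assume "homogeneous_op V k D" and V: "V \<subseteq> X"
  then obtain S c where "finite S" "\<forall>vs\<in>S. set vs \<subseteq> V \<and> length vs = k"
    "D = (\<lambda>f x. \<Sum>vs\<in>S. c vs * iter_deriv vs f x)" unfolding homogeneous_op_def by blast
  then show ?thesis unfolding const_coeff_op_def using V by (intro exI[of _ S] exI[of _ c]) auto
qed

lemma const_coeff_op_cmult:
  assumes "const_coeff_op X D"
  shows "const_coeff_op X (\<lambda>f x. a * D f x)"
proof -
  obtain S c where S: "finite S" "\<forall>vs\<in>S. set vs \<subseteq> X" "D = (\<lambda>f x. \<Sum>vs\<in>S. c vs * iter_deriv vs f x)"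
    using assms unfolding const_coeff_op_def by blast
  then show ?thesis
    unfolding const_coeff_op_def
    by (intro exI[of _ S] exI[of _ "\<lambda>vs. a * c vs"]) (simp add: sum_distrib_left mult.assoc)
qed

lemma const_coeff_op_add:
  assumes "const_coeff_op X D" "const_coeff_op X D'"
  shows "const_coeff_op X (\<lambda>f x. D f x + D' f x)"
proof -
  obtain S c where S: "finite S" "\<forall>vs\<in>S. set vs \<subseteq> X" "D = (\<lambda>f x. \<Sum>vs\<in>S. c vs * iter_deriv vs f x)"
    using assms(1) unfolding const_coeff_op_def by blast
  obtain S' c' where S': "finite S'" "\<forall>vs\<in>S'. set vs \<subseteq> X" "D' = (\<lambda>f x. \<Sum>vs\<in>S'. c' vs * iter_deriv vs f x)"
    using assms(2) unfolding const_coeff_op_def by blast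
  define d where "d vs = (if vs \<in> S then c vs else 0) + (if vs \<in> S' then c' vs else 0)" for vs
  have "D f x + D' f x = (\<Sum>vs\<in>S \<union> S'. d vs * iter_deriv vs f x)" for f x
  proof -
    have "D f x = (\<Sum>vs\<in>S \<union> S'. (if vs \<in> S then c vs else 0) * iter_deriv vs f x)"
      unfolding S(3) by (rule sum.mono_neutral_cong_left) (use S S' in auto)
    moreover have "D' f x = (\<Sum>vs\<in>S \<union> S'. (if vs \<in> S' then c' vs else 0) * iter_deriv vs f x)"
      unfolding S'(3) by (rule sum.mono_neutral_cong_left) (use S S' in auto)
    ultimately show ?thesis by (simp add: d_def distrib_right sum.distrib)
  qed
  then show ?thesis
    unfolding const_coeff_op_def using S S' by (intro exI[of _ "S \<union> S'"] exI[of _ d]) auto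
qed

lemma const_coeff_op_0: "const_coeff_op X (\<lambda>f x. 0)"
  unfolding const_coeff_op_def by (intro exI[of _ "{}"]) auto

lemma const_coeff_op_id: "const_coeff_op X (\<lambda>f. f)"
  unfolding const_coeff_op_def by (intro exI[of _ "{[]}"] exI[of _ "\<lambda>_. 1"]) auto

lemma const_coeff_op_sum:
  assumes "\<And>i. i \<in> A \<Longrightarrow> const_coeff_op X (D i)"
  shows "const_coeff_op X (\<lambda>f x. \<Sum>i\<in>A. D i f x)"
  using assms
  by (induction A rule: infinite_finite_induct) (auto intro: const_coeff_op_0 const_coeff_op_add)

lemma has_symbol_op_symbol:
  assumes "const_coeff_op X D"
  shows "has_symbol X D (op_symbol D)"
proof -
  obtain S c where D: "D = (\<lambda>f x. \<Sum>vs\<in>S. c vs * iter_deriv vs f x)"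
    using assms unfolding const_coeff_op_def by blast
  have "D (\<lambda>y. exp (\<xi> \<bullet> y)) x = op_symbol D \<xi> * exp (\<xi> \<bullet> x)" for \<xi> x
    unfolding D op_symbol_sum iter_deriv_exp sum_distrib_right by (simp add: mult.assoc)
  then show ?thesis unfolding has_symbol_def by (simp add: exp_minus field_simps)
qed

lemma has_symbol_cong:
  "has_symbol X D \<sigma> \<Longrightarrow> (\<And>\<xi>. \<xi> \<in> X \<Longrightarrow> \<sigma> \<xi> = \<sigma>' \<xi>) \<Longrightarrow> has_symbol X D \<sigma>'"
  unfolding has_symbol_def by auto

text \<open>The base change matrices are inverse to each other with nonnegative integer entries, hence permutations.\<close>

lemma integral_basis_cone_unique:
  fixes E E' :: "'a::euclidean_space set"
  assumes E: "independent E" and E': "independent E'" and eq: "int_span E = int_span E'"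
    and cone: "convex_cone hull E = convex_cone hull E'"
  shows "E \<subseteq> E'"
proof
  fix e assume e: "e \<in> E"
  have finE': "finite E'" using E' by (rule independent_imp_finite)
  have "e \<in> int_span E" using e by (auto simp: int_span_mem_iff[OF E] span_base dual_vec_inner[OF E])
  then have e_int: "e \<in> span E'" "\<And>g. g \<in> E' \<Longrightarrow> e \<bullet> dual_vec E' g \<in> \<int>"
    unfolding eq int_span_mem_iff[OF E'] by auto
  have "e \<in> convex_cone hull E'" using e unfolding cone[symmetric] by (rule hull_inc)
  then have e_nn: "0 \<le> e \<bullet> dual_vec E' g" if "g \<in> E'" for g
    using that simplicial_cone_iff[OF E'] by auto
  have g_int: "g \<in> span E" "\<And>f. f \<in> E \<Longrightarrow> g \<bullet> dual_vec E f \<in> \<int>" "\<And>f. f \<in> E \<Longrightarrow> 0 \<le> g \<bullet> dual_vec E f"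
    if g: "g \<in> E'" for g
  proof -
    have "g \<in> int_span E'" using g by (auto simp: int_span_mem_iff[OF E'] span_base dual_vec_inner[OF E'])
    then show "g \<in> span E" "\<And>f. f \<in> E \<Longrightarrow> g \<bullet> dual_vec E f \<in> \<int>"
      unfolding eq[symmetric] int_span_mem_iff[OF E] by auto
    have "g \<in> convex_cone hull E" using g unfolding cone by (rule hull_inc)
    then show "\<And>f. f \<in> E \<Longrightarrow> 0 \<le> g \<bullet> dual_vec E f" using simplicial_cone_iff[OF E] by auto
  qed
  have e_sum: "e = (\<Sum>g\<in>E'. (e \<bullet> dual_vec E' g) *\<^sub>R g)" using sum_dual_vec[OF E' e_int(1)] by simp
  \<comment> \<open>A row of the product of the two base change matrices, which is the
    identity.\<close>
  have coord: "(\<Sum>g\<in>E'. (e \<bullet> dual_vec E' g) * (g \<bullet> dual_vec E f)) = (if e = f then 1 else 0)" if f: "f \<in> E" for f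
  proof -
    have "(\<Sum>g\<in>E'. (e \<bullet> dual_vec E' g) * (g \<bullet> dual_vec E f)) = (\<Sum>g\<in>E'. (e \<bullet> dual_vec E' g) *\<^sub>R g) \<bullet> dual_vec E f"
      by (simp add: inner_sum_left)
    then show ?thesis using e_sum dual_vec_inner[OF E f e] by simp
  qed
  have "\<exists>g\<in>E'. 0 < (e \<bullet> dual_vec E' g) * (g \<bullet> dual_vec E e)"
  proof (rule ccontr)
    assume "\<not> ?thesis"
    then have "(\<Sum>g\<in>E'. (e \<bullet> dual_vec E' g) * (g \<bullet> dual_vec E e)) \<le> 0" by (intro sum_nonpos) (auto simp: not_less)
    then show False using coord[OF e] by simp
  qed
  then obtain g where g: "g \<in> E'" "0 < (e \<bullet> dual_vec E' g) * (g \<bullet> dual_vec E e)" by blast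
  have nn: "0 \<le> (e \<bullet> dual_vec E' g') * (g' \<bullet> dual_vec E f)" if "g' \<in> E'" "f \<in> E" for g' f
    using that e_nn g_int(3) by simp
  \<comment> \<open>All summands of such an entry are nonnegative, so each is bounded by the entry;
    off the diagonal this leaves \<open>g\<close> only its \<open>e\<close>-coordinate.\<close>
  have le: "(e \<bullet> dual_vec E' g) * (g \<bullet> dual_vec E f) \<le> (if e = f then 1 else 0)" if "f \<in> E" for f
    unfolding coord[OF that, symmetric] using g(1) finE' nn that by (intro member_le_sum) auto
  have pos: "0 < e \<bullet> dual_vec E' g" "0 < g \<bullet> dual_vec E e"
    using g(2) e_nn[OF g(1)] g_int(3)[OF g(1) e] by (auto simp: zero_less_mult_iff)
  have "g \<bullet> dual_vec E f = (if f = e then 1 else 0)" if f: "f \<in> E" for f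
  proof (cases "f = e")
    case False
    then have "(e \<bullet> dual_vec E' g) * (g \<bullet> dual_vec E f) \<le> 0" using le[OF f] by auto
    then have "g \<bullet> dual_vec E f \<le> 0" using pos(1) by (simp add: mult_le_0_iff)
    then show ?thesis using g_int(3)[OF g(1) f] False by simp
  next
    case True
    \<comment> \<open>Both numbers are positive integers, and their product is at most 1 by
      \<open>le\<close>.\<close>
    have "1 \<le> e \<bullet> dual_vec E' g" "1 \<le> g \<bullet> dual_vec E e"
      using pos e_int(2)[OF g(1)] g_int(2)[OF g(1) e] by (auto elim!: Ints_cases)
    moreover from this have "1 * (g \<bullet> dual_vec E e) \<le> (e \<bullet> dual_vec E' g) * (g \<bullet> dual_vec E e)"
      by (intro mult_right_mono) auto
    moreover have "(e \<bullet> dual_vec E' g) * (g \<bullet> dual_vec E e) \<le> 1" using le[OF e] by simp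
    ultimately have "g \<bullet> dual_vec E e = 1" by linarith
    then show ?thesis using True by simp
  qed
  then have "g = (\<Sum>f\<in>E. (if f = e then 1 else 0) *\<^sub>R f)"
    by (subst sum_dual_vec[OF E g_int(1)[OF g(1)], symmetric]) (intro sum.cong refl, simp)
  also have "\<dots> = (\<Sum>f\<in>E. if f = e then f else 0)" by (intro sum.cong) auto
  also have "\<dots> = e" using e independent_imp_finite[OF E] by simp
  finally show "e \<in> E'" using g(1) by simp
qed

section \<open>The explicit operators on the faces of a unimodular cone\<close>

lemma cone_basis_eq:
  fixes B :: "'a::euclidean_space set"
  assumes B: "independent B" "E \<subseteq> B"
  shows "cone_basis (int_span B) (convex_cone hull E) = E"
proof -
  have E: "independent E" using B independent_mono by blast
  show ?thesis
    unfolding cone_basis_def span_convex_cone_hull int_span_subbasis[OF B]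
  proof (rule the_equality)
    show "integral_basis (int_span E) E \<and> convex_cone hull E = convex_cone hull E"
      using E by (simp add: integral_basis_def independent_imp_finite)
    fix E' assume E': "integral_basis (int_span E) E' \<and> convex_cone hull E = convex_cone hull E'"
    then have i: "independent E'" "int_span E = int_span E'" by (auto simp: integral_basis_def)
    show "E' = E"
      using integral_basis_cone_unique[OF E i(1,2)] integral_basis_cone_unique[OF i(1) E i(2)[symmetric]] E' by auto
  qed
qed

lemma face_index_eq:
  fixes E :: "'a::euclidean_space set"
  assumes E: "independent E" and K: "K \<subseteq> E"
  shows "face_index E (convex_cone hull (E - K)) = K"
  unfolding face_index_def
proof (rule the_equality)
  show "K \<subseteq> E \<and> convex_cone hull (E - K) = sub_cone E K" using K by (simp add: sub_cone_def)
  fix I assume I: "I \<subseteq> E \<and> convex_cone hull (E - K) = sub_cone E I"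
  then have "E - K = E - I"
    by (metis Diff_subset gens_in_subcone[OF E] sub_cone_def)
  then show "I = K" using I K by blast
qed

lemma L_family_homogeneous:
  fixes E :: "'a::euclidean_space set"
  assumes E: "finite E" and L: "L_family \<Lambda> E L" and K: "K \<subseteq> E" "card K \<le> n" "K \<noteq> {}"
    and I: "I \<subseteq> K" and \<nu>: "\<nu> \<in> pos_multi_indices I" "sum \<nu> E = n"
  shows "homogeneous_op (span E \<inter> orthogonal_comp (span (E - K))) (n - card K)
    (L I K (\<lambda>e. \<nu> e - (if e \<in> I then 1 else 0)))"
proof -
  have IE: "I \<subseteq> E" using I K(1) by auto
  note sh = pos_index_shift[OF E IE \<nu>]
  have "finite K" using K(1) E finite_subset by blast
  \<comment> \<open>\<open>L_family\<close> speaks of nonempty \<open>I\<close> only. A nonempty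
    \<open>K\<close> forces \<open>n > 0\<close>, and an index of positive degree cannot have empty
    support.\<close>
  then have "n \<noteq> 0" using K(2,3) by auto
  then have ne: "I \<noteq> {}" using \<nu> by (auto simp: pos_multi_indices_def multi_indices_def)
  from L ne IE sh(1) have "\<forall>J. I \<subseteq> J \<and> J \<subseteq> E \<and> card J \<le> n \<longrightarrow>
      homogeneous_op (span E \<inter> orthogonal_comp (span (E - J))) (n - card J)
        (L I J (\<lambda>e. \<nu> e - (if e \<in> I then 1 else 0)))"
    unfolding L_family_def by (simp only: sh(2)[symmetric]) blast
  then show ?thesis using I K by blast
qed

lemma explicit_op_symbol:
  fixes B :: "'a::euclidean_space set"
  assumes B: "independent B" "E \<subseteq> B" "span B = X" and L: "L_family (int_span B) E L"
    and K: "K \<subseteq> E" "card K \<le> n"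
  defines "D \<equiv> explicit_op (int_span B) L n (convex_cone hull E) (convex_cone hull (E - K))"
  shows "const_coeff_op X D" "op_symbol D = explicit_symbol L E n K"
proof -
  have E: "independent E" using B independent_mono by blast
  have finE: "finite E" using E by (rule independent_imp_finite)
  have finK: "finite K" using K(1) finE finite_subset by blast
  have FC: "convex_cone hull (E - K) = convex_cone hull E \<longleftrightarrow> K = {}"
    using gens_in_subcone[OF E, of "E - K"] gens_in_subcone[OF E, of E] K(1) by auto
  have ad: "nat (int n - aff_dim (convex_cone hull E) + aff_dim (convex_cone hull (E - K))) = n - card K"
  proof -
    have "independent (E - K)" using E independent_mono by blast
    then show ?thesis
      using K finE finK card_mono[OF finE K(1)]
      by (simp add: aff_dim_simplicial_cone E card_Diff_subset of_nat_diff)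
  qed
  show "const_coeff_op X D"
  proof (cases "K = {}")
    case True
    then show ?thesis
      by (auto simp: D_def explicit_op_def const_coeff_op_0 const_coeff_op_id)
  next
    case False
    have "const_coeff_op X (L I K (\<lambda>e. \<nu> e - (if e \<in> I then 1 else 0)))"
      if "I \<in> Pow K" "\<nu> \<in> {\<nu>. \<nu> \<in> pos_multi_indices I \<and> sum \<nu> E = n}" for I \<nu>
      using const_coeff_op_homogeneous[OF L_family_homogeneous[OF finE L K False]] that
        span_mono[OF B(2)] B(3) by blast
    then show ?thesis
      using False
      by (auto simp: D_def explicit_op_def FC cone_basis_eq[OF B(1,2)] face_index_eq[OF E K(1)] Let_def
          intro!: const_coeff_op_cmult const_coeff_op_sum)
  qed
  show "op_symbol D = explicit_symbol L E n K"
  proof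
    fix \<xi>
    show "op_symbol D \<xi> = explicit_symbol L E n K \<xi>"
      by (simp add: D_def explicit_op_def explicit_symbol_def op_symbol_def FC ad
          cone_basis_eq[OF B(1,2)] face_index_eq[OF E K(1)] Let_def)
  qed
qed

text \<open>The operators \<open>L\<close> differentiate only in directions orthogonal to
  \<open>span (E - K)\<close>; these lie in the quotient, viewed as a subspace of \<open>X\<close>,
  so projecting the argument leaves the symbols unchanged.\<close>

lemma explicit_symbol_pullback:
  fixes B :: "'a::euclidean_space set"
  assumes B: "independent B" "E \<subseteq> B" "span B = X" and L: "L_family (int_span B) E L"
    and K: "K \<subseteq> E" "card K \<le> n"
  shows "poly_on_lines V (explicit_symbol L E n K)"
    and "explicit_symbol L E n K (proj (quot X (span (E - K))) \<xi>) = explicit_symbol L E n K \<xi>"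
proof -
  have finE: "finite E" using B independent_imp_finite finite_subset by blast
  have X: "subspace X" using B(3) subspace_span by blast
  have hom: "\<exists>k. homogeneous_op (quot X (span (E - K))) k (L I K (\<lambda>e. \<nu> e - (if e \<in> I then 1 else 0)))"
    if "K \<noteq> {}" "I \<in> Pow K" "\<nu> \<in> {\<nu>. \<nu> \<in> pos_multi_indices I \<and> sum \<nu> E = n}" for I \<nu>
  proof -
    have "homogeneous_op (span E \<inter> orthogonal_comp (span (E - K))) (n - card K)
       (L I K (\<lambda>e. \<nu> e - (if e \<in> I then 1 else 0)))"
      using L_family_homogeneous[OF finE L K] that by blast
    moreover have "span E \<inter> orthogonal_comp (span (E - K)) \<subseteq> quot X (span (E - K))"
      using span_mono[OF B(2)] B(3) by (auto simp: quot_def)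
    ultimately show ?thesis unfolding homogeneous_op_def by (meson order_trans)
  qed
  show "poly_on_lines V (explicit_symbol L E n K)"
  proof (cases "K = {}")
    case False
    then show ?thesis
      unfolding explicit_symbol_def[abs_def] if_not_P[OF False]
      using hom poly_on_lines_op_symbol
      by (intro poly_on_lines_mult poly_on_lines_sum poly_on_lines_const) blast
  qed (simp add: explicit_symbol_def[abs_def])
  show "explicit_symbol L E n K (proj (quot X (span (E - K))) \<xi>) = explicit_symbol L E n K \<xi>"
  proof (cases "K = {}")
    case False
    have "op_symbol (L I K (\<lambda>e. \<nu> e - (if e \<in> I then 1 else 0))) (proj (quot X (span (E - K))) \<xi>) =
        op_symbol (L I K (\<lambda>e. \<nu> e - (if e \<in> I then 1 else 0))) \<xi>"
      if I\<nu>: "I \<in> Pow K" "\<nu> \<in> {\<nu>. \<nu> \<in> pos_multi_indices I \<and> sum \<nu> E = n}" for I \<nu>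
    proof -
      obtain k where "homogeneous_op (quot X (span (E - K))) k (L I K (\<lambda>e. \<nu> e - (if e \<in> I then 1 else 0)))"
        using hom[OF False I\<nu>] by blast
      then show ?thesis by (rule op_symbol_cong) (rule proj_inner[OF subspace_quot[OF X]])
    qed
    then show ?thesis
      unfolding explicit_symbol_def if_not_P[OF False]
      by (intro arg_cong2[of _ _ _ _ "(*)"] refl sum.cong) simp_all
  qed (simp add: explicit_symbol_def)
qed

text \<open>The difference of the two families solves the homogeneous relation in degree
  \<open>n\<close> and has the polynomiality and pullback properties that force it to
  vanish.\<close>

lemma explicit_symbol_eq_bv_part:
  fixes B :: "'a::euclidean_space set"
  assumes B: "independent B" "E \<subseteq> B" "span B = X" and L: "L_family (int_span B) E L"
    and \<mu>: "berline_vergne_family X (int_span B) \<mu>" and K: "K \<subseteq> E" "card K \<le> n" and \<xi>: "\<xi> \<in> X"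
  shows "explicit_symbol L E n K \<xi> = bv_part X \<mu> E (n - card K) K \<xi>"
proof -
  have E: "independent E" using B independent_mono by blast
  have X: "subspace X" using B(3) subspace_span by blast
  let ?\<K> = "{K. K \<subseteq> E \<and> card K \<le> n}"
  let ?x = "\<lambda>K \<xi>. explicit_symbol L E n K \<xi> - bv_part X \<mu> E (n - card K) K \<xi>"
  have "?x K \<xi> = 0"
  proof (rule symbol_relation_unique[OF X E, of ?\<K> ?x K \<xi>])
    show "span E \<subseteq> X" using span_mono[OF B(2)] B(3) by simp
    show "poly_on_lines X (?x J)" if "J \<in> ?\<K>" for J
      using that explicit_symbol_pullback(1)[OF B L] bv_line_expansion[OF B \<mu>]
      by (intro poly_on_lines_diff) (auto simp: line_expansion_def)
    show "?x J (proj (quot X (span (E - J))) \<xi>) = ?x J \<xi>" if "J \<in> ?\<K>" for J \<xi>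
      using that explicit_symbol_pullback(2)[OF B L]
      by (simp add: bv_part_def proj_ident proj_in subspace_quot[OF X])
    show "(\<Sum>J\<in>?\<K>. ?x J \<xi> * (\<Prod>e\<in>J. - (\<xi> \<bullet> e))) = 0" if "\<xi> \<in> X" for \<xi>
      using explicit_symbol_relation[OF B(1,2) L, of n \<xi>] bv_relation[OF B \<mu> that, of n]
      by (simp add: left_diff_distrib sum_subtractf)
  qed (use K \<xi> in auto)
  then show ?thesis by simp
qed

theorem theorem3p9:
  fixes X \<Lambda> C F :: "'a::euclidean_space set"
    and n :: nat
    and \<mu> :: "'a set \<Rightarrow> 'a set \<Rightarrow> 'a \<Rightarrow> real"
    and L :: "'a set \<Rightarrow> 'a set \<Rightarrow> ('a \<Rightarrow> nat) \<Rightarrow> 'a operator"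
  assumes "rational_space X \<Lambda>"
    and "rational_inner_product \<Lambda>"
    and "unimodular_cone \<Lambda> C"
    and "F \<in> faces C"
    and "aff_dim F \<ge> aff_dim C - int n"
    and "berline_vergne_family X \<Lambda> \<mu>"
    and "L_family \<Lambda> (cone_basis \<Lambda> C) L"
  shows "op_eq X (explicit_op \<Lambda> L n C F) (BV_op X \<mu> n C F)"
proof -
  obtain B E where B: "independent B" "E \<subseteq> B" and \<Lambda>: "\<Lambda> = int_span B" and C: "C = convex_cone hull E"
    using assms(3) unfolding unimodular_cone_def integral_basis_def by blast
  have E: "independent E" using B independent_mono by blast
  have finE: "finite E" using E by (rule independent_imp_finite)
  have X: "subspace X" and BX: "span B = X"
  proof -
    obtain B' where B': "finite B'" "\<Lambda> = int_span B'" "span B' = X" and "subspace X"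
      using assms(1) unfolding rational_space_def lattice_in_def integral_basis_def by blast
    then show "subspace X" "span B = X"
      using span_int_span[OF B'(1)] span_int_span[OF independent_imp_finite[OF B(1)]] \<Lambda> by auto
  qed
  obtain G where G: "G \<subseteq> E" "F = convex_cone hull G"
    using assms(4) faces_simplicial_cone[OF E] C by auto
  \<comment> \<open>\<open>C(K)\<close> omits the generators in \<open>K\<close>, so
    \<open>K\<close> is the complement of the generators of the face.\<close>
  define K where "K = E - G"
  have K: "K \<subseteq> E" "E - K = G" using G(1) by (auto simp: K_def)
  have finK: "finite K" using K(1) finE finite_subset by blast
  have F: "F = convex_cone hull (E - K)" using G K by simp
  have "independent (E - K)" using E independent_mono by blast
  then have ad: "aff_dim C - aff_dim F = int (card K)"
    using card_mono[OF finE K(1)] finK K(1) unfolding C F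
    by (simp add: aff_dim_simplicial_cone E card_Diff_subset of_nat_diff)
  have Kn: "card K \<le> n" using assms(5) ad by simp
  have L: "L_family (int_span B) E L" using assms(7) by (simp add: C \<Lambda> cone_basis_eq[OF B])
  have \<mu>: "berline_vergne_family X (int_span B) \<mu>" using assms(6) by (simp add: \<Lambda>)
  let ?D = "explicit_op \<Lambda> L n C F"
  let ?\<sigma> = "\<lambda>\<xi>. homogeneous_part (nat (int n - aff_dim C + aff_dim F))
    (\<mu> (quot X (Lin F)) (proj (quot X (Lin F)) ` C)) (proj (quot X (Lin F)) \<xi>)"
  have \<sigma>: "?\<sigma> = bv_part X \<mu> E (n - card K) K"
  proof -
    have "nat (int n - aff_dim C + aff_dim F) = n - card K" using ad Kn by linarith
    moreover have "Lin F = span (E - K)" unfolding F by (rule Lin_convex_cone_hull)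
    ultimately show ?thesis by (simp add: bv_part_def[abs_def] C)
  qed
  have D: "const_coeff_op X ?D" "op_symbol ?D = explicit_symbol L E n K"
    using explicit_op_symbol[OF B BX L K(1) Kn] by (simp_all add: \<Lambda> C F)
  have "has_symbol X ?D ?\<sigma>"
    unfolding \<sigma> using has_symbol_op_symbol[OF D(1)]
    by (rule has_symbol_cong) (simp add: D(2) explicit_symbol_eq_bv_part[OF B BX L \<mu> K(1) Kn])
  \<comment> \<open>The choice in \<open>BV_op\<close> needs some operator with the prescribed
    symbol; the explicit operator is one.\<close>
  with D(1) have "const_coeff_op X (BV_op X \<mu> n C F) \<and> has_symbol X (BV_op X \<mu> n C F) ?\<sigma>"
    unfolding BV_op_def
    by (intro someI[where P = "\<lambda>D. const_coeff_op X D \<and> has_symbol X D ?\<sigma>" and x = ?D] conjI)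
  then show ?thesis using op_eq_symbol[OF X D(1) \<open>has_symbol X ?D ?\<sigma>\<close>] by blast
qed

end
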